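(* Let $(M,g)$ be a compact, oriented Riemannian manifold and $(N,h,J)$ a compact Kähler manifold with Kähler form $\omega=h(J\cdot,\cdot)$. Let $\phi:M\to N$ be a smooth map which is immersive on a dense set, that is, $d\phi_x:T_xM\to T_{\phi(x)}N$ is injective for all $x$ in a dense subset of $M$. Then $\phi$ is a critical point of the functional $E(\phi)=\frac12\int_M|\phi^*\omega|^2\,{\ast 1}$ if and only if $\phi^*\omega$ is a harmonic $2$-form on $M$. In particular, when $H^2(M,\mathbb{R})=0$, the only immersive critical points of $E$ defined on $M$ are isotropic immersions, i.e. immersions with $\phi^*\omega=0$ (and hence $E(\phi)=0$).
   Context: $\ast 1$ is the volume form of $M$; the pointwise norm on $p$-forms is induced by $\langle\alpha,\beta\rangle=\frac1{p!}\sum_{i_1,\dots,i_p}\alpha(e_{i_1},\dots,e_{i_p})\beta(e_{i_1},\dots,e_{i_p})$ for a local orthonormal frame. A critical point of $E$ is a map $\phi$ with $\frac{d}{dt}E(\phi_t)|_{t=0}=0$ for every smooth variation $\phi_t$ of $\phi=\phi_0$. A form is harmonic if it is closed and co-closed. *)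

theory Defs
  imports "HOL-Analysis.Analysis"
begin

section \<open>Smooth functions between Euclidean spaces\<close>

text \<open>Meaningful for open \<open>S\<close>.\<close>

primrec Ck_on :: "nat \<Rightarrow> 'a::euclidean_space set \<Rightarrow> ('a \<Rightarrow> 'b::euclidean_space) \<Rightarrow> bool" where
  "Ck_on 0 S f \<longleftrightarrow> continuous_on S f"
| "Ck_on (Suc k) S f \<longleftrightarrow> (\<forall>x\<in>S. f differentiable (at x)) \<and>
     (\<forall>v. Ck_on k S (\<lambda>x. frechet_derivative f (at x) v))"

definition smooth_on :: "'a::euclidean_space set \<Rightarrow> ('a \<Rightarrow> 'b::euclidean_space) \<Rightarrow> bool" where
  "smooth_on S f \<longleftrightarrow> (\<forall>k. Ck_on k S f)"

section \<open>Manifolds\<close>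

text \<open>A chart is a pair of its domain and its coordinate map (whose values off the domain are
  irrelevant). A manifold is a Hausdorff type, all of which is covered by an atlas; the manifolds
  considered below are compact, so second countability is automatic. A manifold of dimension
  \<open>n\<close> is modelled on \<^typ>\<open>real^'d\<close> with \<open>CARD('d) = n\<close>.\<close>

type_synonym ('m, 'd) chart = "'m set \<times> ('m \<Rightarrow> real^'d)"

abbreviation dom_c :: "('m, 'd) chart \<Rightarrow> 'm set" where
  "dom_c c \<equiv> fst c"

abbreviation img_c :: "('m, 'd) chart \<Rightarrow> (real^'d) set" where
  "img_c c \<equiv> snd c ` fst c"

abbreviation inv_c :: "('m, 'd) chart \<Rightarrow> real^'d \<Rightarrow> 'm" where
  "inv_c c \<equiv> inv_into (fst c) (snd c)"

definition is_chart :: "('m::t2_space, 'd::finite) chart \<Rightarrow> bool" where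
  "is_chart c \<longleftrightarrow> open (dom_c c) \<and> open (img_c c) \<and>
     homeomorphism (dom_c c) (img_c c) (snd c) (inv_c c)"

definition transition :: "('m, 'd) chart \<Rightarrow> ('m, 'd) chart \<Rightarrow> real^'d \<Rightarrow> real^'d" where
  "transition c c' = snd c' \<circ> inv_c c"

definition compatible :: "('m::t2_space, 'd::finite) chart \<Rightarrow> ('m, 'd) chart \<Rightarrow> bool" where
  "compatible c c' \<longleftrightarrow>
     smooth_on (snd c ` (dom_c c \<inter> dom_c c')) (transition c c') \<and>
     smooth_on (snd c' ` (dom_c c \<inter> dom_c c')) (transition c' c)"

definition smooth_atlas :: "('m::t2_space, 'd::finite) chart set \<Rightarrow> bool" where
  "smooth_atlas A \<longleftrightarrow> (\<forall>c\<in>A. is_chart c) \<and> (\<Union>c\<in>A. dom_c c) = UNIV \<and>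
     (\<forall>c\<in>A. \<forall>c'\<in>A. compatible c c')"

definition oriented_atlas :: "('m::t2_space, 'd::finite) chart set \<Rightarrow> bool" where
  "oriented_atlas A \<longleftrightarrow> smooth_atlas A \<and>
     (\<forall>c\<in>A. \<forall>c'\<in>A. \<forall>x\<in>snd c ` (dom_c c \<inter> dom_c c').
        det (matrix (frechet_derivative (transition c c') (at x))) > 0)"

section \<open>Tangent vectors and tensor fields\<close>

text \<open>Each point \<open>p\<close> has a preferred chart \<open>chart_at A p\<close>, and the tangent space at \<open>p\<close> is
  identified with the model space \<^typ>\<open>real^'d\<close> through it. A tensor field is thus a function
  of the point and of vectors in the model space. As the preferred chart does not depend
  continuously on the point, differentiation and smoothness only make sense for the
  representations in a fixed chart (\<open>loc1\<close>, \<open>loc2\<close> below). The map \<open>from_coord A c p\<close> takes the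
  components with respect to \<open>c\<close> of a tangent vector at \<open>p\<close> to those with respect to the
  preferred chart.\<close>

definition chart_at :: "('m, 'd) chart set \<Rightarrow> 'm \<Rightarrow> ('m, 'd) chart" where
  "chart_at A p = (SOME c. c \<in> A \<and> p \<in> dom_c c)"

definition from_coord ::
  "('m, 'd::finite) chart set \<Rightarrow> ('m, 'd) chart \<Rightarrow> 'm \<Rightarrow> real^'d \<Rightarrow> real^'d" where
  "from_coord A c p = frechet_derivative (transition c (chart_at A p)) (at (snd c p))"

type_synonym ('m, 'd) field1 = "'m \<Rightarrow> real^'d \<Rightarrow> real"
type_synonym ('m, 'd) field2 = "'m \<Rightarrow> real^'d \<Rightarrow> real^'d \<Rightarrow> real"
type_synonym ('m, 'd) field3 = "'m \<Rightarrow> real^'d \<Rightarrow> real^'d \<Rightarrow> real^'d \<Rightarrow> real"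

definition loc1 ::
  "('m, 'd::finite) chart set \<Rightarrow> ('m, 'd) chart \<Rightarrow> ('m, 'd) field1 \<Rightarrow> (real^'d, 'd) field1" where
  "loc1 A c \<alpha> x u = \<alpha> (inv_c c x) (from_coord A c (inv_c c x) u)"

definition loc2 ::
  "('m, 'd::finite) chart set \<Rightarrow> ('m, 'd) chart \<Rightarrow> ('m, 'd) field2 \<Rightarrow> (real^'d, 'd) field2" where
  "loc2 A c \<alpha> x u v =
     \<alpha> (inv_c c x) (from_coord A c (inv_c c x) u) (from_coord A c (inv_c c x) v)"

definition form1 :: "('m::t2_space, 'd::finite) chart set \<Rightarrow> ('m, 'd) field1 \<Rightarrow> bool" where
  "form1 A \<alpha> \<longleftrightarrow> (\<forall>p. linear (\<alpha> p)) \<and> (\<forall>c\<in>A. \<forall>u. smooth_on (img_c c) (\<lambda>x. loc1 A c \<alpha> x u))"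

definition smooth_bilinear_field ::
  "('m::t2_space, 'd::finite) chart set \<Rightarrow> ('m, 'd) field2 \<Rightarrow> bool" where
  "smooth_bilinear_field A \<alpha> \<longleftrightarrow> (\<forall>p. bilinear (\<alpha> p)) \<and>
     (\<forall>c\<in>A. \<forall>u v. smooth_on (img_c c) (\<lambda>x. loc2 A c \<alpha> x u v))"

definition form2 :: "('m::t2_space, 'd::finite) chart set \<Rightarrow> ('m, 'd) field2 \<Rightarrow> bool" where
  "form2 A \<alpha> \<longleftrightarrow> smooth_bilinear_field A \<alpha> \<and> (\<forall>p u. \<alpha> p u u = 0)"

definition riemannian_metric ::
  "('m::t2_space, 'd::finite) chart set \<Rightarrow> ('m, 'd) field2 \<Rightarrow> bool" where
  "riemannian_metric A g \<longleftrightarrow> smooth_bilinear_field A g \<and>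
     (\<forall>p u v. g p u v = g p v u) \<and> (\<forall>p u. u \<noteq> 0 \<longrightarrow> g p u u > 0)"

section \<open>Exterior derivative and second de Rham cohomology\<close>

definition ext_d1_eucl :: "(real^'d::finite, 'd) field1 \<Rightarrow> (real^'d, 'd) field2" where
  "ext_d1_eucl a x u v =
     frechet_derivative (\<lambda>y. a y v) (at x) u - frechet_derivative (\<lambda>y. a y u) (at x) v"

definition ext_d2_eucl :: "(real^'d::finite, 'd) field2 \<Rightarrow> (real^'d, 'd) field3" where
  "ext_d2_eucl a x u v w =
     frechet_derivative (\<lambda>y. a y v w) (at x) u - frechet_derivative (\<lambda>y. a y u w) (at x) v
     + frechet_derivative (\<lambda>y. a y u v) (at x) w"

text \<open>At \<open>p\<close> the derivatives are taken in the preferred chart of \<open>p\<close>, where tangent vectors at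
  \<open>p\<close> coincide with their components.\<close>

definition ext_d1 ::
  "('m, 'd::finite) chart set \<Rightarrow> ('m, 'd) field1 \<Rightarrow> ('m, 'd) field2" where
  "ext_d1 A \<alpha> p = ext_d1_eucl (loc1 A (chart_at A p) \<alpha>) (snd (chart_at A p) p)"

definition ext_d2 ::
  "('m, 'd::finite) chart set \<Rightarrow> ('m, 'd) field2 \<Rightarrow> ('m, 'd) field3" where
  "ext_d2 A \<alpha> p = ext_d2_eucl (loc2 A (chart_at A p) \<alpha>) (snd (chart_at A p) p)"

definition closed_form2 :: "('m, 'd::finite) chart set \<Rightarrow> ('m, 'd) field2 \<Rightarrow> bool" where
  "closed_form2 A \<alpha> \<longleftrightarrow> (\<forall>p u v w. ext_d2 A \<alpha> p u v w = 0)"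

definition H2_vanishes :: "('m::t2_space, 'd::finite) chart set \<Rightarrow> bool" where
  "H2_vanishes A \<longleftrightarrow>
     (\<forall>\<alpha>. form2 A \<alpha> \<and> closed_form2 A \<alpha> \<longrightarrow> (\<exists>\<beta>. form1 A \<beta> \<and> \<alpha> = ext_d1 A \<beta>))"

section \<open>Metric notions: frames, Levi-Civita connection, codifferential\<close>

definition orthonormal_frame ::
  "(real^'d \<Rightarrow> real^'d \<Rightarrow> real) \<Rightarrow> ('d::finite \<Rightarrow> real^'d) \<Rightarrow> bool" where
  "orthonormal_frame G e \<longleftrightarrow> (\<forall>i j. G (e i) (e j) = (if i = j then 1 else 0))"

definition some_frame :: "(real^'d \<Rightarrow> real^'d \<Rightarrow> real) \<Rightarrow> 'd::finite \<Rightarrow> real^'d" where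
  "some_frame G = (SOME e. orthonormal_frame G e)"

text \<open>The inner product of 2-forms at a point. This does not depend on the choice of the
  orthonormal frame.\<close>

definition inner_form2 ::
  "(real^'d \<Rightarrow> real^'d \<Rightarrow> real) \<Rightarrow> (real^'d \<Rightarrow> real^'d \<Rightarrow> real)
    \<Rightarrow> (real^'d::finite \<Rightarrow> real^'d \<Rightarrow> real) \<Rightarrow> real" where
  "inner_form2 G \<alpha> \<beta> = (let e = some_frame G in
     1 / fact 2 * (\<Sum>i\<in>UNIV. \<Sum>j\<in>UNIV. \<alpha> (e i) (e j) * \<beta> (e i) (e j)))"

text \<open>\<open>christoffel G x u v\<close> is the value at \<open>x\<close> of the Levi-Civita derivative, along \<open>u\<close>, of the
  constant vector field \<open>v\<close>, determined by the Koszul formula.\<close>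

definition christoffel ::
  "(real^'d::finite, 'd) field2 \<Rightarrow> real^'d \<Rightarrow> real^'d \<Rightarrow> real^'d \<Rightarrow> real^'d" where
  "christoffel G x u v = (THE z. \<forall>w. 2 * G x z w =
     frechet_derivative (\<lambda>y. G y v w) (at x) u + frechet_derivative (\<lambda>y. G y u w) (at x) v
     - frechet_derivative (\<lambda>y. G y u v) (at x) w)"

text \<open>\<open>cov_deriv2 G a x w u v\<close> is the value at \<open>x\<close> of \<open>(\<nabla>\<^sub>w a)(u, v)\<close>.\<close>

definition cov_deriv2 ::
  "(real^'d::finite, 'd) field2 \<Rightarrow> (real^'d, 'd) field2 \<Rightarrow> (real^'d, 'd) field3" where
  "cov_deriv2 G a x w u v = frechet_derivative (\<lambda>y. a y u v) (at x) w
     - a x (christoffel G x w u) v - a x u (christoffel G x w v)"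

text \<open>The codifferential of a 2-form: \<open>(\<delta>\<alpha>)(v) = - \<Sum>\<^sub>i (\<nabla>\<^bsub>e\<^sub>i\<^esub> \<alpha>)(e\<^sub>i, v)\<close>.\<close>

definition codiff2 ::
  "('m, 'd::finite) chart set \<Rightarrow> ('m, 'd) field2 \<Rightarrow> ('m, 'd) field2 \<Rightarrow> ('m, 'd) field1" where
  "codiff2 A g \<alpha> p v = (let c = chart_at A p; e = some_frame (g p) in
     - (\<Sum>i\<in>UNIV. cov_deriv2 (loc2 A c g) (loc2 A c \<alpha>) (snd c p) (e i) (e i) v))"

definition coclosed_form2 ::
  "('m, 'd::finite) chart set \<Rightarrow> ('m, 'd) field2 \<Rightarrow> ('m, 'd) field2 \<Rightarrow> bool" where
  "coclosed_form2 A g \<alpha> \<longleftrightarrow> (\<forall>p v. codiff2 A g \<alpha> p v = 0)"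

definition harmonic_form2 ::
  "('m::t2_space, 'd::finite) chart set \<Rightarrow> ('m, 'd) field2 \<Rightarrow> ('m, 'd) field2 \<Rightarrow> bool" where
  "harmonic_form2 A g \<alpha> \<longleftrightarrow> form2 A \<alpha> \<and> closed_form2 A \<alpha> \<and> coclosed_form2 A g \<alpha>"

section \<open>Integration over a compact oriented manifold\<close>

definition smooth_fun :: "('m::t2_space, 'd::finite) chart set \<Rightarrow> ('m \<Rightarrow> real) \<Rightarrow> bool" where
  "smooth_fun A f \<longleftrightarrow> (\<forall>c\<in>A. smooth_on (img_c c) (f \<circ> inv_c c))"

definition partition_of_unity :: "('m::t2_space, 'd::finite) chart set \<Rightarrow>
    ('m, 'd) chart set \<Rightarrow> (('m, 'd) chart \<Rightarrow> 'm \<Rightarrow> real) \<Rightarrow> bool" where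
  "partition_of_unity A C \<rho> \<longleftrightarrow> finite C \<and> C \<subseteq> A \<and>
     (\<forall>c\<in>C. smooth_fun A (\<rho> c) \<and> (\<forall>p. \<rho> c p \<ge> 0) \<and> closure {p. \<rho> c p \<noteq> 0} \<subseteq> dom_c c) \<and>
     (\<forall>p. (\<Sum>c\<in>C. \<rho> c p) = 1)"

text \<open>A form of top degree takes a point and a tuple of tangent vectors, the rows of a square
  matrix. The integral does not depend on the choice of the partition of unity.\<close>

type_synonym ('m, 'd) top_form = "'m \<Rightarrow> real^'d^'d \<Rightarrow> real"

definition integral_top ::
  "('m::t2_space, 'd::finite) chart set \<Rightarrow> ('m, 'd) top_form \<Rightarrow> real" where
  "integral_top A \<mu> = (let (C, \<rho>) = (SOME (C, \<rho>). partition_of_unity A C \<rho>) in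
     \<Sum>c\<in>C. integral (img_c c) (\<lambda>x. let p = inv_c c x in
       \<rho> c p * \<mu> p (\<chi> i. from_coord A c p (axis i 1))))"

text \<open>The volume form of an oriented Riemannian manifold. The preferred charts belong to the
  oriented atlas, so \<open>det v > 0\<close> exactly for the positively oriented frames \<open>v\<close>, and the
  value is 1 on the orthonormal ones among these.\<close>

definition volume_form :: "('m, 'd::finite) field2 \<Rightarrow> ('m, 'd) top_form" where
  "volume_form g p v = sqrt (det (\<chi> i j. g p (axis i 1) (axis j 1))) * det v"

section \<open>Smooth maps\<close>

definition smooth_map :: "('m::t2_space, 'd::finite) chart set \<Rightarrow>
    ('n::t2_space, 'k::finite) chart set \<Rightarrow> ('m \<Rightarrow> 'n) \<Rightarrow> bool" where
  "smooth_map A B \<phi> \<longleftrightarrow> continuous_on UNIV \<phi> \<and>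
     (\<forall>c\<in>A. \<forall>d\<in>B. smooth_on (snd c ` (dom_c c \<inter> \<phi> -` dom_c d)) (snd d \<circ> \<phi> \<circ> inv_c c))"

definition differential :: "('m, 'd::finite) chart set \<Rightarrow> ('n, 'k::finite) chart set \<Rightarrow>
    ('m \<Rightarrow> 'n) \<Rightarrow> 'm \<Rightarrow> real^'d \<Rightarrow> real^'k" where
  "differential A B \<phi> p =
     frechet_derivative (snd (chart_at B (\<phi> p)) \<circ> \<phi> \<circ> inv_c (chart_at A p))
       (at (snd (chart_at A p) p))"

definition pullback2 :: "('m, 'd::finite) chart set \<Rightarrow> ('n, 'k::finite) chart set \<Rightarrow>
    ('m \<Rightarrow> 'n) \<Rightarrow> ('n, 'k) field2 \<Rightarrow> ('m, 'd) field2" where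
  "pullback2 A B \<phi> \<omega> p u v = \<omega> (\<phi> p) (differential A B \<phi> p u) (differential A B \<phi> p v)"

definition immersive_at :: "('m, 'd::finite) chart set \<Rightarrow> ('n, 'k::finite) chart set \<Rightarrow>
    ('m \<Rightarrow> 'n) \<Rightarrow> 'm \<Rightarrow> bool" where
  "immersive_at A B \<phi> p \<longleftrightarrow> inj (differential A B \<phi> p)"

definition immersive_on_dense_set :: "('m::t2_space, 'd::finite) chart set \<Rightarrow>
    ('n::t2_space, 'k::finite) chart set \<Rightarrow> ('m \<Rightarrow> 'n) \<Rightarrow> bool" where
  "immersive_on_dense_set A B \<phi> \<longleftrightarrow> (\<exists>D. closure D = UNIV \<and> (\<forall>p\<in>D. immersive_at A B \<phi> p))"

definition immersion :: "('m::t2_space, 'd::finite) chart set \<Rightarrow>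
    ('n::t2_space, 'k::finite) chart set \<Rightarrow> ('m \<Rightarrow> 'n) \<Rightarrow> bool" where
  "immersion A B \<phi> \<longleftrightarrow> smooth_map A B \<phi> \<and> (\<forall>p. immersive_at A B \<phi> p)"

definition isotropic_immersion :: "('m::t2_space, 'd::finite) chart set \<Rightarrow>
    ('n::t2_space, 'k::finite) chart set \<Rightarrow> ('n, 'k) field2 \<Rightarrow> ('m \<Rightarrow> 'n) \<Rightarrow> bool" where
  "isotropic_immersion A B \<omega> \<phi> \<longleftrightarrow> immersion A B \<phi> \<and> (\<forall>p u v. pullback2 A B \<phi> \<omega> p u v = 0)"

section \<open>Kaehler manifolds\<close>

text \<open>\<open>J\<close> comes from a complex structure: around each point there is a chart of the smooth
  structure in which \<open>J\<close> is a constant endomorphism (hence the transition maps between such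
  charts are holomorphic, and \<open>J\<close> is smooth).\<close>

definition complex_structure ::
  "('n::t2_space, 'k::finite) chart set \<Rightarrow> ('n \<Rightarrow> real^'k \<Rightarrow> real^'k) \<Rightarrow> bool" where
  "complex_structure B J \<longleftrightarrow> (\<forall>q. linear (J q)) \<and> (\<forall>q u. J q (J q u) = - u) \<and>
     (\<forall>q. \<exists>c J0. is_chart c \<and> (\<forall>d\<in>B. compatible c d) \<and> q \<in> dom_c c \<and>
        (\<forall>r\<in>dom_c c. \<forall>u. J r (from_coord B c r u) = from_coord B c r (J0 u)))"

definition kaehler_form ::
  "('n, 'k) field2 \<Rightarrow> ('n \<Rightarrow> real^'k \<Rightarrow> real^'k) \<Rightarrow> ('n, 'k) field2" where
  "kaehler_form h J q u v = h q (J q u) v"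

definition kaehler :: "('n::t2_space, 'k::finite) chart set \<Rightarrow> ('n, 'k) field2 \<Rightarrow>
    ('n \<Rightarrow> real^'k \<Rightarrow> real^'k) \<Rightarrow> bool" where
  "kaehler B h J \<longleftrightarrow> smooth_atlas B \<and> riemannian_metric B h \<and> complex_structure B J \<and>
     (\<forall>q u v. h q (J q u) (J q v) = h q u v) \<and> closed_form2 B (kaehler_form h J)"

section \<open>The functional and its critical points\<close>

definition energy :: "('m::t2_space, 'd::finite) chart set \<Rightarrow> ('m, 'd) field2 \<Rightarrow>
    ('n::t2_space, 'k::finite) chart set \<Rightarrow> ('n, 'k) field2 \<Rightarrow> ('m \<Rightarrow> 'n) \<Rightarrow> real" where
  "energy A g B \<omega> \<phi> = 1 / 2 * integral_top A (\<lambda>p v.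
     inner_form2 (g p) (pullback2 A B \<phi> \<omega> p) (pullback2 A B \<phi> \<omega> p) * volume_form g p v)"

definition smooth_variation :: "('m::t2_space, 'd::finite) chart set \<Rightarrow>
    ('n::t2_space, 'k::finite) chart set \<Rightarrow> ('m \<Rightarrow> 'n) \<Rightarrow> (real \<Rightarrow> 'm \<Rightarrow> 'n) \<Rightarrow> bool" where
  "smooth_variation A B \<phi> \<Phi> \<longleftrightarrow> \<Phi> 0 = \<phi> \<and>
     (\<exists>\<epsilon>>0. continuous_on ({-\<epsilon><..<\<epsilon>} \<times> UNIV) (\<lambda>(t, p). \<Phi> t p) \<and>
        (\<forall>c\<in>A. \<forall>d\<in>B.
           smooth_on {(t, x). t \<in> {-\<epsilon><..<\<epsilon>} \<and> x \<in> img_c c \<and> \<Phi> t (inv_c c x) \<in> dom_c d}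
             (\<lambda>(t, x). snd d (\<Phi> t (inv_c c x)))))"

definition critical_point :: "('m::t2_space, 'd::finite) chart set \<Rightarrow> ('m, 'd) field2 \<Rightarrow>
    ('n::t2_space, 'k::finite) chart set \<Rightarrow> ('n, 'k) field2 \<Rightarrow> ('m \<Rightarrow> 'n) \<Rightarrow> bool" where
  "critical_point A g B \<omega> \<phi> \<longleftrightarrow> smooth_map A B \<phi> \<and>
     (\<forall>\<Phi>. smooth_variation A B \<phi> \<Phi> \<longrightarrow>
        ((\<lambda>t. energy A g B \<omega> (\<Phi> t)) has_real_derivative 0) (at 0))"

end

theory Submission
  imports Defs
begin

text \<open>Along a variation \<open>\<phi>\<^sub>t\<close> with variation field \<open>V\<close>, closedness of \<open>\<omega>\<close> gives
  \<open>d/dt \<phi>\<^sub>t\<^sup>*\<omega> = d\<beta>\<close> at \<open>t = 0\<close>, where \<open>\<beta> = \<omega>(V, d\<phi> \<cdot>)\<close>, so that the energy has the derivative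
  \<open>\<integral>\<langle>\<phi>\<^sup>*\<omega>, d\<beta>\<rangle> = \<integral>\<langle>\<delta>\<phi>\<^sup>*\<omega>, \<beta>\<rangle>\<close>. It vanishes if \<open>\<phi>\<^sup>*\<omega>\<close> is coclosed. Conversely, as \<open>V\<close> is arbitrary
  and \<open>\<omega>\<close> is nondegenerate, a critical point satisfies \<open>d\<phi> \<xi> = 0\<close> for the dual \<open>\<xi>\<close> of \<open>\<delta>\<phi>\<^sup>*\<omega>\<close>,
  hence \<open>\<xi> = 0\<close> on a dense set and, by continuity, everywhere. If moreover \<open>\<phi>\<^sup>*\<omega> = d\<gamma>\<close>, then
  \<open>\<integral>|\<phi>\<^sup>*\<omega>|\<^sup>2 = \<integral>\<langle>\<delta>\<phi>\<^sup>*\<omega>, \<gamma>\<rangle> = 0\<close>.\<close>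

section \<open>Calculus of smooth functions\<close>

text \<open>The obstacle is the encoding of tangent vectors: they are read off in a preferred chart
  that jumps from point to point, so no tensor can be differentiated as it stands. Tensors are
  therefore studied through their representations in a fixed chart, and the operators defined at the
  preferred chart are shown to be natural under transition maps. Likewise orthonormal frames are
  chosen pointwise and need not be continuous; sums over a frame are rewritten through the entries
  of the inverse Gram matrix, which are smooth. That d and \<delta> are adjoint is reduced by a
  partition of unity to forms supported in one chart, where the difference of the two integrands,
  times the density, is a Euclidean divergence. The formula for the time derivative of the pullback
  is obtained without Lie derivatives: \<omega> is pulled back to space-time, and its exterior
  derivative is evaluated on the time direction and two spatial directions.\<close>

abbreviation FD :: "('a::real_normed_vector \<Rightarrow> 'b::real_normed_vector) \<Rightarrow> 'a \<Rightarrow> 'a \<Rightarrow> 'b" where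
  "FD f x \<equiv> frechet_derivative f (at x)"

lemma FD_eq: "(f has_derivative f') (at x) \<Longrightarrow> FD f x = f'"
  using frechet_derivative_at by metis

lemma FD_has: "f differentiable (at x) \<Longrightarrow> (f has_derivative FD f x) (at x)"
  by (simp add: frechet_derivative_works)

lemma FD_linear: "f differentiable (at x) \<Longrightarrow> linear (FD f x)"
  using FD_has has_derivative_linear by blast

lemma FD_cong:
  assumes "open S" "x \<in> S" "\<And>y. y \<in> S \<Longrightarrow> f y = g y" "f differentiable (at x)"
  shows "FD f x = FD g x"
  using frechet_derivative_transform_within_open[OF assms(4,1,2)] assms(3) by blast

lemma differentiable_cong:
  assumes "open S" "x \<in> S" "\<And>y. y \<in> S \<Longrightarrow> f y = g y" "f differentiable (at x)"
  shows "g differentiable (at x)"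
  using assms has_derivative_transform_within_open unfolding differentiable_def by blast

lemma Ck_on_cong:
  assumes "open S" "\<And>x. x \<in> S \<Longrightarrow> f x = g x" "Ck_on k S f"
  shows "Ck_on k S g"
  using assms(2,3)
proof (induction k arbitrary: f g)
  case 0
  then show ?case using continuous_on_cong by (metis Ck_on.simps(1))
next
  case (Suc k)
  have d: "f differentiable (at x)" if "x \<in> S" for x using Suc.prems that by simp
  have "FD f x v = FD g x v" if "x \<in> S" for x v
    using FD_cong[OF assms(1) that] Suc.prems(1) d[OF that] by metis
  then have "Ck_on k S (\<lambda>x. FD g x v)" for v
    using Suc.IH[of "\<lambda>x. FD f x v" "\<lambda>x. FD g x v"] Suc.prems(2) by auto
  moreover have "g differentiable (at x)" if "x \<in> S" for x
    using differentiable_cong[OF assms(1) that] Suc.prems(1) d[OF that] by metis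
  ultimately show ?case by simp
qed

lemma Ck_on_subset: "Ck_on k S f \<Longrightarrow> T \<subseteq> S \<Longrightarrow> Ck_on k T f"
proof (induction k arbitrary: f)
  case 0
  then show ?case by (auto intro: continuous_on_subset)
next
  case (Suc k)
  have "Ck_on k T (\<lambda>x. FD f x v)" for v using Suc.prems by (intro Suc.IH) auto
  then show ?case using Suc.prems by auto
qed

text \<open>Derivatives are taken with \<open>at x\<close>, not within the set, so the derivative
  functions on the small open sets are restrictions of a single function; this lets the induction
  pass to them.\<close>

lemma Ck_on_local:
  assumes "\<And>x. x \<in> S \<Longrightarrow> \<exists>T. open T \<and> x \<in> T \<and> Ck_on k T f"
  shows "Ck_on k S f"
  using assms
proof (induction k arbitrary: f)
  case 0
  have "continuous (at x) f" if "x \<in> S" for x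
    using 0[OF that] continuous_on_eq_continuous_at by auto
  then show ?case by (simp add: continuous_at_imp_continuous_on)
next
  case (Suc k)
  show ?case
    unfolding Ck_on.simps
  proof (intro conjI allI ballI)
    fix x assume "x \<in> S" then show "f differentiable (at x)" using Suc.prems by fastforce
  next
    fix v
    have "\<exists>T. open T \<and> x \<in> T \<and> Ck_on k T (\<lambda>x. FD f x v)" if "x \<in> S" for x
      using Suc.prems[OF that] by auto
    then show "Ck_on k S (\<lambda>x. FD f x v)" by (rule Suc.IH)
  qed
qed

lemma Ck_on_imp_continuous_on: "Ck_on k S f \<Longrightarrow> continuous_on S f"
  by (cases k) (auto intro!: continuous_at_imp_continuous_on differentiable_imp_continuous_within)

lemma Ck_on_SucD: "Ck_on (Suc k) S f \<Longrightarrow> Ck_on k S f"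
proof (induction k arbitrary: f)
  case 0
  then show ?case using Ck_on_imp_continuous_on by fastforce
next
  case (Suc k)
  have "Ck_on k S (\<lambda>x. FD f x v)" for v using Suc.prems by (intro Suc.IH) auto
  then show ?case using Suc.prems by auto
qed

lemma Ck_on_const: "Ck_on k S (\<lambda>x. c)"
  by (induction k arbitrary: c) auto

lemma Ck_on_add:
  assumes "open S" "Ck_on k S f" "Ck_on k S g"
  shows "Ck_on k S (\<lambda>x. f x + g x)"
  using assms(2,3)
proof (induction k arbitrary: f g)
  case 0
  then show ?case by (simp add: continuous_on_add)
next
  case (Suc k)
  have 1: "((\<lambda>x. f x + g x) has_derivative (\<lambda>v. FD f x v + FD g x v)) (at x)" if "x \<in> S" for x
    using Suc.prems that by (intro has_derivative_add FD_has) auto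
  have "Ck_on k S (\<lambda>x. FD (\<lambda>x. f x + g x) x v)" for v
    by (rule Ck_on_cong[OF assms(1) _ Suc.IH[of "\<lambda>x. FD f x v" "\<lambda>x. FD g x v"]])
      (use 1[THEN FD_eq] Suc.prems in auto)
  then show ?case using 1 by (auto simp: differentiable_def)
qed

lemma Ck_on_bounded_linear:
  assumes "bounded_linear L" "open S" "Ck_on k S f"
  shows "Ck_on k S (\<lambda>x. L (f x))"
  using assms(3)
proof (induction k arbitrary: f)
  case 0
  then show ?case using assms(1) by (auto intro: bounded_linear.continuous_on)
next
  case (Suc k)
  have 1: "((\<lambda>x. L (f x)) has_derivative (\<lambda>v. L (FD f x v))) (at x)" if "x \<in> S" for x
    using Suc.prems that by (intro bounded_linear.has_derivative[OF assms(1)] FD_has) auto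
  have "Ck_on k S (\<lambda>x. FD (\<lambda>x. L (f x)) x v)" for v
    by (rule Ck_on_cong[OF assms(2) _ Suc.IH[of "\<lambda>x. FD f x v"]])
      (use 1[THEN FD_eq] Suc.prems in auto)
  then show ?case using 1 by (auto simp: differentiable_def)
qed

lemma Ck_on_id: "Ck_on k S (\<lambda>x. x)"
  by (cases k) (auto simp: Ck_on_const)

lemma Ck_on_bilinear:
  assumes "bounded_bilinear B" "open S" "Ck_on k S f" "Ck_on k S g"
  shows "Ck_on k S (\<lambda>x. B (f x) (g x))"
  using assms(3,4)
proof (induction k arbitrary: f g)
  case 0
  then show ?case using assms(1) by (auto intro: bounded_bilinear.continuous_on)
next
  case (Suc k)
  have 1: "((\<lambda>x. B (f x) (g x)) has_derivative (\<lambda>v. B (f x) (FD g x v) + B (FD f x v) (g x))) (at x)"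
    if "x \<in> S" for x
    using Suc.prems that by (intro bounded_bilinear.FDERIV[OF assms(1)] FD_has) auto
  have "Ck_on k S (\<lambda>x. FD (\<lambda>x. B (f x) (g x)) x v)" for v
  proof (rule Ck_on_cong[OF assms(2)])
    \<comment> \<open>The product rule pairs each derivative with the other factor undifferentiated,
      so \<open>f\<close> and \<open>g\<close> themselves are needed at order \<open>k\<close>, one
      below what is assumed.\<close>
    show "Ck_on k S (\<lambda>x. B (f x) (FD g x v) + B (FD f x v) (g x))"
      using Suc.prems Suc.prems[THEN Ck_on_SucD] by (intro Ck_on_add[OF assms(2)] Suc.IH) auto
  qed (use 1[THEN FD_eq] in auto)
  then show ?case using 1 by (auto simp: differentiable_def)
qed

lemma Ck_on_sum:
  assumes "open S" "\<And>i. i \<in> I \<Longrightarrow> Ck_on k S (f i)"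
  shows "Ck_on k S (\<lambda>x. \<Sum>i\<in>I. f i x)"
  using assms(2)
  by (induction I rule: infinite_finite_induct) (auto intro: Ck_on_const Ck_on_add[OF assms(1)])

lemma linear_Basis_expansion:
  fixes L :: "'a::euclidean_space \<Rightarrow> 'b::real_vector"
  assumes "linear L"
  shows "L v = (\<Sum>b\<in>Basis. (v \<bullet> b) *\<^sub>R L b)"
  by (metis (no_types, lifting) assms euclidean_representation linear_cmul linear_sum sum.cong)

text \<open>In the chain rule both the base point and the direction of \<open>FD g\<close> move.
  Expanding the direction in the basis leaves derivatives of \<open>g\<close> in fixed directions,
  again composed with \<open>f\<close>; hence the induction over arbitrary \<open>g\<close>.\<close>

lemma Ck_on_compose:
  fixes f :: "'a::euclidean_space \<Rightarrow> 'b::euclidean_space" and g :: "'b \<Rightarrow> 'c::euclidean_space"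
  assumes "open S" "open T" "f ` S \<subseteq> T" "Ck_on k S f" "Ck_on k T g"
  shows "Ck_on k S (\<lambda>x. g (f x))"
  using assms(4,5)
proof (induction k arbitrary: g)
  case 0
  then show ?case using assms(3) by (auto intro: continuous_on_compose2)
next
  case (Suc k)
  have 1: "((\<lambda>x. g (f x)) has_derivative (\<lambda>v. FD g (f x) (FD f x v))) (at x)" if "x \<in> S" for x
    by (rule has_derivative_compose[OF FD_has FD_has]) (use Suc.prems that assms(3) in auto)
  have "Ck_on k S (\<lambda>x. FD (\<lambda>x. g (f x)) x v)" for v
  proof (rule Ck_on_cong[OF assms(1)])
    show "Ck_on k S (\<lambda>x. \<Sum>b\<in>Basis. (FD f x v \<bullet> b) *\<^sub>R FD g (f x) b)"
      using Suc.prems Ck_on_SucD[OF Suc.prems(1)]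
      by (intro Ck_on_sum Ck_on_bilinear[OF bounded_bilinear_scaleR] assms(1)
         Ck_on_bounded_linear[OF bounded_linear_inner_left] Suc.IH[of "\<lambda>y. FD g y b" for b])
        auto
    show "(\<Sum>b\<in>Basis. (FD f x v \<bullet> b) *\<^sub>R FD g (f x) b) = FD (\<lambda>x. g (f x)) x v" if "x \<in> S" for x
    proof -
      have "linear (FD g (f x))" using Suc.prems that assms(3) by (intro FD_linear) auto
      from linear_Basis_expansion[OF this, of "FD f x v"] show ?thesis using 1[OF that, THEN FD_eq] by simp
    qed
  qed
  then show ?case using 1 by (auto simp: differentiable_def)
qed

lemma Ck_on_mult:
  fixes f g :: "'a::euclidean_space \<Rightarrow> real"
  shows "open S \<Longrightarrow> Ck_on k S f \<Longrightarrow> Ck_on k S g \<Longrightarrow> Ck_on k S (\<lambda>x. f x * g x)"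
  by (rule Ck_on_bilinear[OF bounded_bilinear_mult])

text \<open>The derivative is a product of the derivative of \<open>f\<close> with two copies of the
  reciprocal itself, so the induction closes with \<open>f\<close> fixed. The square root below
  behaves in the same way.\<close>

lemma Ck_on_inverse:
  fixes f :: "'a::euclidean_space \<Rightarrow> real"
  assumes "open S" "Ck_on k S f" "\<And>x. x \<in> S \<Longrightarrow> f x \<noteq> 0"
  shows "Ck_on k S (\<lambda>x. inverse (f x))"
  using assms(2)
proof (induction k)
  case 0
  then show ?case using assms(3) by (simp add: continuous_on_inverse)
next
  case (Suc k)
  have 1: "((\<lambda>x. inverse (f x)) has_derivative (\<lambda>v. - (inverse (f x) * FD f x v * inverse (f x)))) (at x)"
    if "x \<in> S" for x
    using Suc.prems that assms(3) by (intro Deriv.has_derivative_inverse FD_has) auto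
  have "Ck_on k S (\<lambda>x. FD (\<lambda>x. inverse (f x)) x v)" for v
  proof (rule Ck_on_cong[OF assms(1)])
    show "Ck_on k S (\<lambda>x. - (inverse (f x) * FD f x v * inverse (f x)))"
      using Suc.prems Suc.IH[OF Ck_on_SucD[OF Suc.prems]]
      by (intro Ck_on_bounded_linear[OF bounded_linear_minus[OF bounded_linear_ident]] Ck_on_mult assms(1)) auto
  qed (use 1[THEN FD_eq] in auto)
  then show ?case using 1 by (auto simp: differentiable_def)
qed

lemma Ck_on_sqrt:
  fixes f :: "'a::euclidean_space \<Rightarrow> real"
  assumes "open S" "Ck_on k S f" "\<And>x. x \<in> S \<Longrightarrow> f x > 0"
  shows "Ck_on k S (\<lambda>x. sqrt (f x))"
  using assms(2)
proof (induction k)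
  case 0
  then show ?case by (simp add: continuous_on_real_sqrt)
next
  case (Suc k)
  have 1: "((\<lambda>x. sqrt (f x)) has_derivative (\<lambda>v. FD f x v * (inverse (sqrt (f x)) / 2))) (at x)"
    if "x \<in> S" for x
  proof -
    have "(f has_derivative FD f x) (at x)" using Suc.prems that by (intro FD_has) auto
    from DERIV_compose_FDERIV[OF DERIV_real_sqrt[OF assms(3)[OF that]] this] show ?thesis .
  qed
  have nz: "sqrt (f x) \<noteq> 0" if "x \<in> S" for x using assms(3)[OF that] by simp
  have "Ck_on k S (\<lambda>x. FD (\<lambda>x. sqrt (f x)) x v)" for v
  proof (rule Ck_on_cong[OF assms(1)])
    show "Ck_on k S (\<lambda>x. FD f x v * (inverse (sqrt (f x)) / 2))"
      using Suc.prems Suc.IH[OF Ck_on_SucD[OF Suc.prems]] nz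
      by (intro Ck_on_mult Ck_on_bounded_linear[OF bounded_linear_divide] Ck_on_inverse assms(1)) simp_all
  qed (use 1[THEN FD_eq] in auto)
  then show ?case using 1 by (auto simp: differentiable_def)
qed

section \<open>Closure properties of smooth functions\<close>

lemma smooth_on_imp_continuous_on: "smooth_on S f \<Longrightarrow> continuous_on S f"
  using Ck_on_imp_continuous_on smooth_on_def by blast

lemma smooth_on_differentiable: "smooth_on S f \<Longrightarrow> x \<in> S \<Longrightarrow> f differentiable (at x)"
  unfolding smooth_on_def using Ck_on.simps(2)[of 0] by blast

lemma smooth_on_FD: "smooth_on S f \<Longrightarrow> smooth_on S (\<lambda>x. FD f x v)"
  unfolding smooth_on_def
proof
  fix k assume "\<forall>k. Ck_on k S f"
  then have "Ck_on (Suc k) S f" by blast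
  then show "Ck_on k S (\<lambda>x. FD f x v)" by simp
qed

lemma smooth_on_cong: "open S \<Longrightarrow> (\<And>x. x \<in> S \<Longrightarrow> f x = g x) \<Longrightarrow> smooth_on S f \<Longrightarrow> smooth_on S g"
  unfolding smooth_on_def using Ck_on_cong by blast

lemma smooth_on_subset: "smooth_on S f \<Longrightarrow> T \<subseteq> S \<Longrightarrow> smooth_on T f"
  unfolding smooth_on_def using Ck_on_subset by blast

text \<open>The test for smoothness in charts: near each point the function may be replaced by a
  different expression, for instance one written in a chart of the target chosen for that
  point.\<close>

lemma smooth_on_local:
  assumes "\<And>x. x \<in> S \<Longrightarrow> \<exists>T g. open T \<and> x \<in> T \<and> (\<forall>y\<in>T. f y = g y) \<and> smooth_on T g"
  shows "smooth_on S f"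
  unfolding smooth_on_def
proof (intro allI Ck_on_local)
  fix k x assume "x \<in> S"
  from assms[OF this] obtain T g where T: "open T" "x \<in> T" "\<forall>y\<in>T. f y = g y" "smooth_on T g" by blast
  then have "smooth_on T f" using smooth_on_cong[of T g f] by metis
  then show "\<exists>T. open T \<and> x \<in> T \<and> Ck_on k T f" using T by (auto simp: smooth_on_def)
qed

lemma smooth_on_const: "smooth_on S (\<lambda>x. c)"
  unfolding smooth_on_def using Ck_on_const by blast

lemma smooth_on_id: "smooth_on S (\<lambda>x. x)"
  unfolding smooth_on_def using Ck_on_id by blast

lemma smooth_on_add:
  "open S \<Longrightarrow> smooth_on S f \<Longrightarrow> smooth_on S g \<Longrightarrow> smooth_on S (\<lambda>x. f x + g x)"
  unfolding smooth_on_def by (intro allI Ck_on_add[of S _ f g]) auto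

lemma smooth_on_bounded_linear:
  "bounded_linear L \<Longrightarrow> open S \<Longrightarrow> smooth_on S f \<Longrightarrow> smooth_on S (\<lambda>x. L (f x))"
  unfolding smooth_on_def by (intro allI Ck_on_bounded_linear[of L S _ f]) auto

lemma smooth_on_minus: "open S \<Longrightarrow> smooth_on S f \<Longrightarrow> smooth_on S (\<lambda>x. - f x)"
  by (rule smooth_on_bounded_linear[OF bounded_linear_minus[OF bounded_linear_ident]])

lemma smooth_on_diff:
  "open S \<Longrightarrow> smooth_on S f \<Longrightarrow> smooth_on S g \<Longrightarrow> smooth_on S (\<lambda>x. f x - g x)"
  using smooth_on_add[of S f "\<lambda>x. - g x"] smooth_on_minus[of S g] by simp

lemma smooth_on_mult:
  fixes f g :: "'a::euclidean_space \<Rightarrow> real"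
  shows "open S \<Longrightarrow> smooth_on S f \<Longrightarrow> smooth_on S g \<Longrightarrow> smooth_on S (\<lambda>x. f x * g x)"
  unfolding smooth_on_def by (intro allI Ck_on_mult[of S _ f g]) auto

lemma smooth_on_scaleR:
  "open S \<Longrightarrow> smooth_on S f \<Longrightarrow> smooth_on S g \<Longrightarrow> smooth_on S (\<lambda>x. f x *\<^sub>R g x)"
  unfolding smooth_on_def by (intro allI Ck_on_bilinear[OF bounded_bilinear_scaleR, of S _ f g]) auto

lemma smooth_on_inner:
  "open S \<Longrightarrow> smooth_on S f \<Longrightarrow> smooth_on S g \<Longrightarrow> smooth_on S (\<lambda>x. f x \<bullet> g x)"
  unfolding smooth_on_def by (intro allI Ck_on_bilinear[OF bounded_bilinear_inner, of S _ f g]) auto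

lemma smooth_on_vec_nth: "open S \<Longrightarrow> smooth_on S f \<Longrightarrow> smooth_on S (\<lambda>x. f x $ i :: real)"
  by (rule smooth_on_bounded_linear[OF bounded_linear_vec_nth])

lemma smooth_on_sum:
  "open S \<Longrightarrow> (\<And>i. i \<in> I \<Longrightarrow> smooth_on S (f i)) \<Longrightarrow> smooth_on S (\<lambda>x. \<Sum>i\<in>I. f i x)"
  unfolding smooth_on_def by (intro allI Ck_on_sum[of S I _ f]) auto

lemma smooth_on_prod:
  fixes f :: "'i \<Rightarrow> 'a::euclidean_space \<Rightarrow> real"
  assumes "open S" "\<And>i. i \<in> I \<Longrightarrow> smooth_on S (f i)"
  shows "smooth_on S (\<lambda>x. \<Prod>i\<in>I. f i x)"
  using assms(2)
  by (induction I rule: infinite_finite_induct) (auto intro!: smooth_on_const smooth_on_mult assms(1))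

lemma smooth_on_inverse:
  fixes f :: "'a::euclidean_space \<Rightarrow> real"
  shows "open S \<Longrightarrow> smooth_on S f \<Longrightarrow> (\<And>x. x \<in> S \<Longrightarrow> f x \<noteq> 0) \<Longrightarrow> smooth_on S (\<lambda>x. inverse (f x))"
  unfolding smooth_on_def by (intro allI Ck_on_inverse[of S _ f]) auto

lemma smooth_on_divide:
  fixes f g :: "'a::euclidean_space \<Rightarrow> real"
  shows "open S \<Longrightarrow> smooth_on S f \<Longrightarrow> smooth_on S g \<Longrightarrow> (\<And>x. x \<in> S \<Longrightarrow> g x \<noteq> 0) \<Longrightarrow>
    smooth_on S (\<lambda>x. f x / g x)"
  unfolding divide_inverse by (intro smooth_on_mult smooth_on_inverse)

lemma smooth_on_sqrt:
  fixes f :: "'a::euclidean_space \<Rightarrow> real"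
  shows "open S \<Longrightarrow> smooth_on S f \<Longrightarrow> (\<And>x. x \<in> S \<Longrightarrow> f x > 0) \<Longrightarrow> smooth_on S (\<lambda>x. sqrt (f x))"
  unfolding smooth_on_def by (intro allI Ck_on_sqrt[of S _ f]) auto

lemma smooth_on_compose:
  fixes f :: "'a::euclidean_space \<Rightarrow> 'b::euclidean_space" and g :: "'b \<Rightarrow> 'c::euclidean_space"
  shows "open S \<Longrightarrow> open T \<Longrightarrow> f ` S \<subseteq> T \<Longrightarrow> smooth_on S f \<Longrightarrow> smooth_on T g \<Longrightarrow> smooth_on S (\<lambda>x. g (f x))"
  unfolding smooth_on_def by (intro allI Ck_on_compose[of S T f _ g]) auto

text \<open>Smoothness of a field is known for constant arguments only. Expanding a moving argument
  in the basis turns the value into a finite sum of products of such functions.\<close>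

lemma smooth_on_linear_field:
  fixes a :: "'a::euclidean_space \<Rightarrow> 'b::euclidean_space \<Rightarrow> 'c::euclidean_space"
  assumes "open S" "\<And>x. x \<in> S \<Longrightarrow> linear (a x)" "\<And>v. smooth_on S (\<lambda>x. a x v)" "smooth_on S w"
  shows "smooth_on S (\<lambda>x. a x (w x))"
proof (rule smooth_on_cong[OF assms(1)])
  show "smooth_on S (\<lambda>x. \<Sum>b\<in>Basis. (w x \<bullet> b) *\<^sub>R a x b)"
    by (intro smooth_on_sum smooth_on_scaleR smooth_on_inner smooth_on_const assms)
  show "(\<Sum>b\<in>Basis. (w x \<bullet> b) *\<^sub>R a x b) = a x (w x)" if "x \<in> S" for x
    using linear_Basis_expansion[OF assms(2)[OF that], of "w x"] by simp
qed

lemma smooth_on_bilinear_field: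
  fixes a :: "'a::euclidean_space \<Rightarrow> 'b::euclidean_space \<Rightarrow> 'b \<Rightarrow> 'c::euclidean_space"
  assumes "open S" "\<And>x. x \<in> S \<Longrightarrow> bilinear (a x)" "\<And>u v. smooth_on S (\<lambda>x. a x u v)"
    "smooth_on S u" "smooth_on S v"
  shows "smooth_on S (\<lambda>x. a x (u x) (v x))"
proof (rule smooth_on_linear_field[where a="\<lambda>x. a x (u x)", OF assms(1) _ _ assms(5)])
  show "smooth_on S (\<lambda>x. a x (u x) w)" for w
    by (rule smooth_on_linear_field[of S "\<lambda>x u. a x u w" u, OF assms(1) _ assms(3,4)])
      (use assms(2) in \<open>auto simp: bilinear_def\<close>)
qed (use assms(2) in \<open>auto simp: bilinear_def\<close>)

text \<open>Product rule for evaluating a field at a moving argument: one term differentiates the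
  field with the argument frozen, the other the argument with the field frozen. Derivatives of
  tensors along vector fields rest on it.\<close>

lemma has_derivative_linear_field:
  fixes a :: "'a::euclidean_space \<Rightarrow> 'b::euclidean_space \<Rightarrow> 'c::euclidean_space"
  assumes "open S" "x \<in> S" "\<And>y. y \<in> S \<Longrightarrow> linear (a y)" "\<And>v. (\<lambda>y. a y v) differentiable (at x)"
    "(w has_derivative w') (at x)"
  shows "((\<lambda>y. a y (w y)) has_derivative (\<lambda>h. FD (\<lambda>y. a y (w x)) x h + a x (w' h))) (at x)"
proof -
  have 1: "((\<lambda>y. \<Sum>b\<in>Basis. (w y \<bullet> b) *\<^sub>R a y b) has_derivative
      (\<lambda>h. \<Sum>b\<in>Basis. (w x \<bullet> b) *\<^sub>R FD (\<lambda>y. a y b) x h + (w' h \<bullet> b) *\<^sub>R a x b)) (at x)"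
  proof (rule has_derivative_sum)
    fix b
    show "((\<lambda>y. (w y \<bullet> b) *\<^sub>R a y b) has_derivative
      (\<lambda>h. (w x \<bullet> b) *\<^sub>R FD (\<lambda>y. a y b) x h + (w' h \<bullet> b) *\<^sub>R a x b)) (at x)"
      by (rule has_derivative_scaleR[OF has_derivative_inner_left[OF assms(5)] FD_has[OF assms(4)]])
  qed
  have 3: "((\<lambda>y. \<Sum>b\<in>Basis. (w x \<bullet> b) *\<^sub>R a y b) has_derivative
      (\<lambda>h. \<Sum>b\<in>Basis. (w x \<bullet> b) *\<^sub>R FD (\<lambda>y. a y b) x h)) (at x)"
    by (rule has_derivative_sum) (rule has_derivative_scaleR_right[OF FD_has[OF assms(4)]])
  have "((\<lambda>y. a y (w x)) has_derivative
      (\<lambda>h. \<Sum>b\<in>Basis. (w x \<bullet> b) *\<^sub>R FD (\<lambda>y. a y b) x h)) (at x)"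
    by (rule has_derivative_transform_within_open[OF 3 assms(1,2)])
      (rule linear_Basis_expansion[OF assms(3), symmetric])
  note 4 = FD_eq[OF this]
  have "((\<lambda>y. a y (w y)) has_derivative
      (\<lambda>h. \<Sum>b\<in>Basis. (w x \<bullet> b) *\<^sub>R FD (\<lambda>y. a y b) x h + (w' h \<bullet> b) *\<^sub>R a x b)) (at x)"
    by (rule has_derivative_transform_within_open[OF 1 assms(1,2)])
      (rule linear_Basis_expansion[OF assms(3), symmetric])
  then show ?thesis
    by (simp add: sum.distrib 4 flip: linear_Basis_expansion[OF assms(3)[OF assms(2)], of "w' _"])
qed

lemma has_derivative_bilinear_field:
  fixes a :: "'a::euclidean_space \<Rightarrow> 'b::euclidean_space \<Rightarrow> 'b \<Rightarrow> 'c::euclidean_space"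
  assumes "open S" "x \<in> S" "\<And>y. y \<in> S \<Longrightarrow> bilinear (a y)" "\<And>u v. (\<lambda>y. a y u v) differentiable (at x)"
    "(u has_derivative u') (at x)" "(v has_derivative v') (at x)"
  shows "((\<lambda>y. a y (u y) (v y)) has_derivative
    (\<lambda>h. FD (\<lambda>y. a y (u x) (v x)) x h + a x (u' h) (v x) + a x (u x) (v' h))) (at x)"
proof -
  have 1: "((\<lambda>y. a y (u y) w) has_derivative (\<lambda>h. FD (\<lambda>y. a y (u x) w) x h + a x (u' h) w)) (at x)" for w
    by (rule has_derivative_linear_field[of S x "\<lambda>y u. a y u w" u, OF assms(1,2) _ assms(4,5)])
      (use assms(3) in \<open>auto simp: bilinear_def\<close>)
  have 2: "(\<lambda>y. a y (u y) w) differentiable (at x)" for w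
    using 1 by (rule differentiableI)
  have "((\<lambda>y. a y (u y) (v y)) has_derivative
    (\<lambda>h. FD (\<lambda>y. a y (u y) (v x)) x h + a x (u x) (v' h))) (at x)"
    by (rule has_derivative_linear_field[of S x "\<lambda>y. a y (u y)" v, OF assms(1,2) _ _ assms(6)])
      (use assms(3) 2 in \<open>auto simp: bilinear_def\<close>)
  then show ?thesis by (simp add: 1[THEN FD_eq])
qed

section \<open>Symmetry of second derivatives and naturality of the exterior derivative\<close>

text \<open>Two mean value theorems over the parallelogram with corners \<open>p a b\<close>: one in
  \<open>a\<close> for the difference of the sides \<open>b = 1\<close> and \<open>b = 0\<close>,
  one in \<open>b\<close>. The second difference on the left does not change when \<open>u\<close>
  and \<open>v\<close> are exchanged.\<close>

lemma second_difference_mean_value: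
  fixes f :: "'a::euclidean_space \<Rightarrow> real"
  assumes f: "smooth_on (ball x r) f" and h: "0 < h" "h * (norm u + norm v) < r"
  shows "\<exists>\<xi>. norm (\<xi> - x) \<le> h * (norm u + norm v) \<and>
    f (x + h *\<^sub>R u + h *\<^sub>R v) - f (x + h *\<^sub>R u) - f (x + h *\<^sub>R v) + f x = h * (h * FD (\<lambda>y. FD f y u) \<xi> v)"
proof -
  have le: "norm ((a * h) *\<^sub>R u + (b * h) *\<^sub>R v) \<le> h * (norm u + norm v)"
    if "0 \<le> a" "a \<le> 1" "0 \<le> b" "b \<le> 1" for a b
  proof -
    have "norm ((a * h) *\<^sub>R u + (b * h) *\<^sub>R v) \<le> norm ((a * h) *\<^sub>R u) + norm ((b * h) *\<^sub>R v)"
      by (rule norm_triangle_ineq)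
    also have "\<dots> = a * (h * norm u) + b * (h * norm v)" using that h by (simp add: abs_mult)
    also have "\<dots> \<le> h * norm u + h * norm v"
      using that h by (intro add_mono mult_left_le_one_le) auto
    finally show ?thesis by (simp add: distrib_left)
  qed
  have in_ball: "x + ((a * h) *\<^sub>R u + (b * h) *\<^sub>R v) \<in> ball x r"
    if "0 \<le> a" "a \<le> 1" "0 \<le> b" "b \<le> 1" for a b
  proof -
    have "dist x (x + ((a * h) *\<^sub>R u + (b * h) *\<^sub>R v)) = norm ((a * h) *\<^sub>R u + (b * h) *\<^sub>R v)"
      by (metis add_diff_cancel_left' dist_norm norm_minus_commute)
    then show ?thesis using le[OF that] h by simp
  qed
  have d: "(f has_derivative FD f y) (at y)" if "y \<in> ball x r" for y
    using FD_has smooth_on_differentiable f that by blast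
  have d2: "((\<lambda>y. FD f y u) has_derivative FD (\<lambda>y. FD f y u) y) (at y)" if "y \<in> ball x r" for y
    using FD_has smooth_on_differentiable smooth_on_FD f that by blast
  define p where "p a b = x + ((a * h) *\<^sub>R u + (b * h) *\<^sub>R v)" for a b
  have pa: "((\<lambda>a. p a b) has_derivative (\<lambda>t. t *\<^sub>R (h *\<^sub>R u))) (at a)" for a b
    unfolding p_def by (auto intro!: derivative_eq_intros)
  have pb: "((\<lambda>b. p a b) has_derivative (\<lambda>t. t *\<^sub>R (h *\<^sub>R v))) (at b)" for a b
    unfolding p_def by (auto intro!: derivative_eq_intros)
  have fa: "((\<lambda>a. f (p a b)) has_field_derivative h * FD f (p a b) u) (at a)"
    if "0 \<le> a" "a \<le> 1" "0 \<le> b" "b \<le> 1" for a b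
  proof -
    have in_b: "p a b \<in> ball x r" using in_ball[OF that] by (simp add: p_def)
    have "((\<lambda>a. f (p a b)) has_derivative (\<lambda>t. FD f (p a b) (t *\<^sub>R (h *\<^sub>R u)))) (at a)"
      by (rule has_derivative_compose[OF pa d[OF in_b]])
    moreover have "linear (FD f (p a b))" using d[OF in_b] has_derivative_linear by blast
    then have "(\<lambda>t. FD f (p a b) (t *\<^sub>R (h *\<^sub>R u))) = (*) (h * FD f (p a b) u)"
      by (simp add: fun_eq_iff linear_cmul)
    ultimately show ?thesis by (simp add: has_field_derivative_def)
  qed
  have fb: "((\<lambda>b. FD f (p a b) u) has_field_derivative h * FD (\<lambda>y. FD f y u) (p a b) v) (at b)"
    if "0 \<le> a" "a \<le> 1" "0 \<le> b" "b \<le> 1" for a b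
  proof -
    have in_b: "p a b \<in> ball x r" using in_ball[OF that] by (simp add: p_def)
    have "((\<lambda>b. FD f (p a b) u) has_derivative (\<lambda>t. FD (\<lambda>y. FD f y u) (p a b) (t *\<^sub>R (h *\<^sub>R v)))) (at b)"
      by (rule has_derivative_compose[OF pb d2[OF in_b]])
    moreover have "linear (FD (\<lambda>y. FD f y u) (p a b))" using d2[OF in_b] has_derivative_linear by blast
    then have "(\<lambda>t. FD (\<lambda>y. FD f y u) (p a b) (t *\<^sub>R (h *\<^sub>R v))) = (*) (h * FD (\<lambda>y. FD f y u) (p a b) v)"
      by (simp add: fun_eq_iff linear_cmul)
    ultimately show ?thesis by (simp add: has_field_derivative_def)
  qed
  obtain a where a: "0 < a" "a < 1"
    and ea: "(f (p 1 1) - f (p 1 0)) - (f (p 0 1) - f (p 0 0)) = h * FD f (p a 1) u - h * FD f (p a 0) u"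
  proof -
    have "\<exists>z>0. z < 1 \<and> (f (p 1 1) - f (p 1 0)) - (f (p 0 1) - f (p 0 0)) =
      (1 - 0) * (h * FD f (p z 1) u - h * FD f (p z 0) u)"
      by (rule MVT2[of 0 1 "\<lambda>a. f (p a 1) - f (p a 0)" "\<lambda>a. h * FD f (p a 1) u - h * FD f (p a 0) u"])
        (auto intro!: DERIV_diff fa)
    then show ?thesis using that by auto
  qed
  obtain b where b: "0 < b" "b < 1"
    and eb: "FD f (p a 1) u - FD f (p a 0) u = h * FD (\<lambda>y. FD f y u) (p a b) v"
  proof -
    have "\<exists>z>0. z < 1 \<and> FD f (p a 1) u - FD f (p a 0) u = (1 - 0) * (h * FD (\<lambda>y. FD f y u) (p a z) v)"
      by (rule MVT2[of 0 1 "\<lambda>b. FD f (p a b) u"]) (use a in \<open>auto intro!: fb\<close>)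
    then show ?thesis using that by auto
  qed
  show ?thesis
  proof (intro exI conjI)
    show "norm (p a b - x) \<le> h * (norm u + norm v)"
      using le[of a b] a b by (simp add: p_def)
    have "f (x + h *\<^sub>R u + h *\<^sub>R v) - f (x + h *\<^sub>R u) - f (x + h *\<^sub>R v) + f x
      = (f (p 1 1) - f (p 1 0)) - (f (p 0 1) - f (p 0 0))"
      by (simp add: p_def add.assoc)
    also have "\<dots> = h * (FD f (p a 1) u - FD f (p a 0) u)" using ea by (simp add: algebra_simps)
    finally show "f (x + h *\<^sub>R u + h *\<^sub>R v) - f (x + h *\<^sub>R u) - f (x + h *\<^sub>R v) + f x
      = h * (h * FD (\<lambda>y. FD f y u) (p a b) v)" using eb by simp
  qed
qed

text \<open>One second difference computed in both orders gives points \<xi> and \<eta> near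
  \<open>x\<close> at which the two mixed derivatives take the same value; continuity carries the
  equality to \<open>x\<close>.\<close>

lemma FD_commute_real:
  fixes f :: "'a::euclidean_space \<Rightarrow> real"
  assumes S: "open S" "x \<in> S" and f: "smooth_on S f"
  shows "FD (\<lambda>y. FD f y u) x v = FD (\<lambda>y. FD f y v) x u"
proof (rule ccontr)
  define P where "P = (\<lambda>y. FD (\<lambda>y. FD f y u) y v)"
  define Q where "Q = (\<lambda>y. FD (\<lambda>y. FD f y v) y u)"
  assume "\<not> ?thesis"
  then have e: "\<bar>P x - Q x\<bar> > 0" by (simp add: P_def Q_def)
  define e where "e = \<bar>P x - Q x\<bar> / 2"
  have "e > 0" using e by (simp add: e_def)
  have "isCont P x" "isCont Q x"
    using f S smooth_on_FD smooth_on_imp_continuous_on continuous_on_eq_continuous_at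
    unfolding P_def Q_def by metis+
  then obtain d1 d2 where d: "d1 > 0" "d2 > 0" "\<And>y. dist y x < d1 \<Longrightarrow> dist (P y) (P x) < e"
    "\<And>y. dist y x < d2 \<Longrightarrow> dist (Q y) (Q x) < e"
    using \<open>e > 0\<close> unfolding continuous_at_eps_delta by metis
  obtain r where r: "r > 0" "ball x r \<subseteq> S" using S openE by blast
  define m where "m = min r (min d1 d2)"
  \<comment> \<open>The summand 1 covers \<open>u = v = 0\<close>, and the factor 1/2 keeps
    \<open>h * (norm u + norm v)\<close> strictly below the radius of smoothness and both radii of
    continuity.\<close>
  define h where "h = m / 2 / (norm u + norm v + 1)"
  have m: "m > 0" using r d by (simp add: m_def)
  have pos: "norm u + norm v + 1 > 0" by (simp add: add_nonneg_pos)
  have h: "h > 0" using m pos by (simp add: h_def)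
  have "h * (norm u + norm v) \<le> h * (norm u + norm v + 1)" using h by simp
  also have "\<dots> = m / 2" using pos unfolding h_def by (metis nonzero_eq_divide_eq less_irrefl)
  also have "\<dots> < m" using m by simp
  finally have hm: "h * (norm u + norm v) < m" .
  have fr: "smooth_on (ball x r) f" using f r smooth_on_subset by blast
  have hr: "h * (norm u + norm v) < r" using hm by (simp add: m_def)
  obtain \<xi> where \<xi>: "norm (\<xi> - x) \<le> h * (norm u + norm v)"
    "f (x + h *\<^sub>R u + h *\<^sub>R v) - f (x + h *\<^sub>R u) - f (x + h *\<^sub>R v) + f x = h * (h * P \<xi>)"
    using second_difference_mean_value[OF fr h hr] unfolding P_def by blast
  have hr': "h * (norm v + norm u) < r" using hr by (simp add: add.commute)
  obtain \<eta> where \<eta>: "norm (\<eta> - x) \<le> h * (norm v + norm u)"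
    "f (x + h *\<^sub>R v + h *\<^sub>R u) - f (x + h *\<^sub>R v) - f (x + h *\<^sub>R u) + f x = h * (h * Q \<eta>)"
    using second_difference_mean_value[OF fr h hr'] unfolding Q_def by blast
  have "x + h *\<^sub>R v + h *\<^sub>R u = x + h *\<^sub>R u + h *\<^sub>R v" by simp
  then have "h * (h * P \<xi>) = h * (h * Q \<eta>)" using \<xi>(2) \<eta>(2) by (metis add.commute diff_diff_eq)
  then have "P \<xi> = Q \<eta>" using h by simp
  moreover have "dist (P \<xi>) (P x) < e" using \<xi>(1) hm by (intro d) (simp add: dist_norm m_def)
  moreover have "dist (Q \<eta>) (Q x) < e"
    using \<eta>(1) hm by (intro d) (simp add: dist_norm m_def add.commute)
  moreover have "dist (P x) (Q x) \<le> dist (P \<xi>) (P x) + dist (P \<xi>) (Q x)" by (rule dist_triangle3)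
  ultimately show False unfolding e_def by (simp add: dist_real_def)
qed

lemma FD_commute:
  fixes f :: "'a::euclidean_space \<Rightarrow> 'b::euclidean_space"
  assumes S: "open S" "x \<in> S" and f: "smooth_on S f"
  shows "FD (\<lambda>y. FD f y u) x v = FD (\<lambda>y. FD f y v) x u"
proof (rule euclidean_eqI)
  fix b :: 'b
  have fb: "smooth_on S (\<lambda>y. f y \<bullet> b)" by (intro smooth_on_inner S f smooth_on_const)
  have 1: "FD (\<lambda>y. f y \<bullet> b) y w = FD f y w \<bullet> b" if "y \<in> S" for y w
    using bounded_linear.has_derivative[OF bounded_linear_inner_left[of b] FD_has[OF smooth_on_differentiable[OF f that]], THEN FD_eq] by simp
  have 2: "FD (\<lambda>y. FD f y w \<bullet> b) x w' = FD (\<lambda>y. FD f y w) x w' \<bullet> b" for w w'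
    using bounded_linear.has_derivative[OF bounded_linear_inner_left[of b] FD_has[OF smooth_on_differentiable[OF smooth_on_FD[OF f] S(2)]], THEN FD_eq]
    by simp
  have 3: "FD (\<lambda>y. FD (\<lambda>y. f y \<bullet> b) y w) x w' = FD (\<lambda>y. FD f y w \<bullet> b) x w'" for w w'
    using FD_cong[OF S, of "\<lambda>y. FD (\<lambda>y. f y \<bullet> b) y w" "\<lambda>y. FD f y w \<bullet> b"] 1
      smooth_on_differentiable[OF smooth_on_FD[OF fb] S(2)] by metis
  show "FD (\<lambda>y. FD f y u) x v \<bullet> b = FD (\<lambda>y. FD f y v) x u \<bullet> b"
    using FD_commute_real[OF S fb, of u v] by (simp add: 2 3)
qed

section \<open>Pullback of fields along smooth maps of Euclidean spaces\<close>

lemma FD_pullback1: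
  fixes F :: "'a::euclidean_space \<Rightarrow> 'b::euclidean_space" and b :: "'b \<Rightarrow> 'b \<Rightarrow> real"
  assumes "open S" "open T" "F ` S \<subseteq> T" "smooth_on S F" "\<And>y. y \<in> T \<Longrightarrow> linear (b y)"
    "\<And>u. smooth_on T (\<lambda>y. b y u)" "x \<in> S"
  shows "FD (\<lambda>y. b (F y) (FD F y u)) x w =
    FD (\<lambda>z. b z (FD F x u)) (F x) (FD F x w) + b (F x) (FD (\<lambda>y. FD F y u) x w)"
proof -
  have Fx: "F x \<in> T" using assms by auto
  have 1: "((\<lambda>y. b (F y) p) has_derivative (\<lambda>h. FD (\<lambda>z. b z p) (F x) (FD F x h))) (at x)" for p
    by (rule has_derivative_compose[OF FD_has[OF smooth_on_differentiable[OF assms(4,7)]]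
          FD_has[OF smooth_on_differentiable[OF assms(6) Fx]]])
  have "((\<lambda>y. b (F y) (FD F y u)) has_derivative
    (\<lambda>h. FD (\<lambda>y. b (F y) (FD F x u)) x h + b (F x) (FD (\<lambda>y. FD F y u) x h))) (at x)"
  proof (rule has_derivative_linear_field[of S x "\<lambda>y. b (F y)" "\<lambda>y. FD F y u"])
    show "linear (b (F y))" if "y \<in> S" for y using that assms(3,5) by auto
    show "(\<lambda>y. b (F y) v) differentiable (at x)" for v using 1 by (rule differentiableI)
    show "((\<lambda>y. FD F y u) has_derivative FD (\<lambda>y. FD F y u) x) (at x)"
      by (rule FD_has[OF smooth_on_differentiable[OF smooth_on_FD[OF assms(4)] assms(7)]])
  qed (rule assms)+
  then show ?thesis by (simp add: FD_eq[OF 1] FD_eq)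
qed

text \<open>The terms with second derivatives of \<open>F\<close> are kept visible: they cancel in
  the exterior derivative, and for a metric they produce the inhomogeneous term in the
  transformation law of the Christoffel symbols.\<close>

lemma FD_pullback2:
  fixes F :: "'a::euclidean_space \<Rightarrow> 'b::euclidean_space" and a :: "'b \<Rightarrow> 'b \<Rightarrow> 'b \<Rightarrow> real"
  assumes "open S" "open T" "F ` S \<subseteq> T" "smooth_on S F" "\<And>y. y \<in> T \<Longrightarrow> bilinear (a y)"
    "\<And>u v. smooth_on T (\<lambda>y. a y u v)" "x \<in> S"
  shows "FD (\<lambda>y. a (F y) (FD F y u) (FD F y v)) x w =
    FD (\<lambda>z. a z (FD F x u) (FD F x v)) (F x) (FD F x w)
    + a (F x) (FD (\<lambda>y. FD F y u) x w) (FD F x v) + a (F x) (FD F x u) (FD (\<lambda>y. FD F y v) x w)"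
proof -
  have Fx: "F x \<in> T" using assms by auto
  have 1: "((\<lambda>y. a (F y) p q) has_derivative (\<lambda>h. FD (\<lambda>z. a z p q) (F x) (FD F x h))) (at x)" for p q
    by (rule has_derivative_compose[OF FD_has[OF smooth_on_differentiable[OF assms(4,7)]]
          FD_has[OF smooth_on_differentiable[OF assms(6) Fx]]])
  have 2: "((\<lambda>y. FD F y u) has_derivative FD (\<lambda>y. FD F y u) x) (at x)" for u
    by (rule FD_has[OF smooth_on_differentiable[OF smooth_on_FD[OF assms(4)] assms(7)]])
  have "((\<lambda>y. a (F y) (FD F y u) (FD F y v)) has_derivative
    (\<lambda>h. FD (\<lambda>y. a (F y) (FD F x u) (FD F x v)) x h + a (F x) (FD (\<lambda>y. FD F y u) x h) (FD F x v)
      + a (F x) (FD F x u) (FD (\<lambda>y. FD F y v) x h))) (at x)"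
  proof (rule has_derivative_bilinear_field[of S x "\<lambda>y. a (F y)" "\<lambda>y. FD F y u" _ "\<lambda>y. FD F y v"])
    show "bilinear (a (F y))" if "y \<in> S" for y using that assms(3,5) by auto
    show "(\<lambda>y. a (F y) u v) differentiable (at x)" for u v using 1 by (rule differentiableI)
  qed (rule assms 2)+
  then show ?thesis by (simp add: FD_eq[OF 1] FD_eq)
qed

lemma smooth_on_pullback2:
  fixes F :: "'a::euclidean_space \<Rightarrow> 'b::euclidean_space" and a :: "'b \<Rightarrow> 'b \<Rightarrow> 'b \<Rightarrow> real"
  assumes "open S" "open T" "F ` S \<subseteq> T" "smooth_on S F" "\<And>y. y \<in> T \<Longrightarrow> bilinear (a y)"
    "\<And>u v. smooth_on T (\<lambda>y. a y u v)"
  shows "smooth_on S (\<lambda>y. a (F y) (FD F y u) (FD F y v))"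
  by (rule smooth_on_bilinear_field[of S "\<lambda>y. a (F y)" "\<lambda>y. FD F y u" "\<lambda>y. FD F y v"])
    (use assms smooth_on_compose[OF assms(1-4) assms(6)] smooth_on_FD in auto)

lemma ext_d1_pullback:
  fixes F :: "'a::euclidean_space \<Rightarrow> 'b::euclidean_space" and b :: "'b \<Rightarrow> 'b \<Rightarrow> real"
  assumes "open S" "open T" "F ` S \<subseteq> T" "smooth_on S F" "\<And>y. y \<in> T \<Longrightarrow> linear (b y)"
    "\<And>u. smooth_on T (\<lambda>y. b y u)" "x \<in> S"
  shows "FD (\<lambda>y. b (F y) (FD F y v)) x u - FD (\<lambda>y. b (F y) (FD F y u)) x v =
    FD (\<lambda>z. b z (FD F x v)) (F x) (FD F x u) - FD (\<lambda>z. b z (FD F x u)) (F x) (FD F x v)"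
  using FD_pullback1[OF assms] FD_commute[OF assms(1,7,4), of u v] by simp

text \<open>Six terms contain second derivatives of \<open>F\<close>. They cancel in pairs by the
  symmetry of second derivatives and the antisymmetry of \<open>a\<close>.\<close>

lemma ext_d2_pullback:
  fixes F :: "'a::euclidean_space \<Rightarrow> 'b::euclidean_space" and a :: "'b \<Rightarrow> 'b \<Rightarrow> 'b \<Rightarrow> real"
  assumes "open S" "open T" "F ` S \<subseteq> T" "smooth_on S F" "\<And>y. y \<in> T \<Longrightarrow> bilinear (a y)"
    "\<And>u v. smooth_on T (\<lambda>y. a y u v)" "x \<in> S" and anti: "\<And>y u v. y \<in> T \<Longrightarrow> a y u v = - a y v u"
  shows "FD (\<lambda>y. a (F y) (FD F y v) (FD F y w)) x u - FD (\<lambda>y. a (F y) (FD F y u) (FD F y w)) x v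
      + FD (\<lambda>y. a (F y) (FD F y u) (FD F y v)) x w =
    FD (\<lambda>z. a z (FD F x v) (FD F x w)) (F x) (FD F x u)
      - FD (\<lambda>z. a z (FD F x u) (FD F x w)) (F x) (FD F x v)
      + FD (\<lambda>z. a z (FD F x u) (FD F x v)) (F x) (FD F x w)"
proof -
  have Fx: "F x \<in> T" using assms by auto
  note c = FD_commute[OF assms(1,7,4)]
  note e = FD_pullback2[OF assms(1-7)]
  show ?thesis
    using e[of v w u] e[of u w v] e[of u v w] c[of v u] c[of w u] c[of w v]
      anti[OF Fx, of "FD (\<lambda>y. FD F y u) x w" "FD F x v"] by simp
qed

section \<open>Integrals of compactly supported functions\<close>

text \<open>A point of \<open>W\<close> lies in the open set \<open>S\<close> or in the open
  complement of \<open>K\<close>, and the extension is regular on both. \<open>K\<close> is merely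
  closed and \<open>W\<close> arbitrary so that a support of the form all times times a compact set
  can be treated over a time interval.\<close>

lemma Ck_on_zero_extension:
  fixes f :: "'a::euclidean_space \<Rightarrow> 'b::euclidean_space"
  assumes "open S" "closed K" "K \<inter> W \<subseteq> S" "Ck_on k S f" "\<And>x. x \<in> S - K \<Longrightarrow> f x = 0"
  shows "Ck_on k W (\<lambda>x. if x \<in> S then f x else 0)"
proof (rule Ck_on_local)
  fix x assume "x \<in> W"
  show "\<exists>T. open T \<and> x \<in> T \<and> Ck_on k T (\<lambda>x. if x \<in> S then f x else 0)"
  proof (cases "x \<in> S")
    case True
    have "Ck_on k S (\<lambda>x. if x \<in> S then f x else 0)"
      by (rule Ck_on_cong[OF assms(1) _ assms(4)]) simp
    then show ?thesis using True assms(1) by blast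
  next
    case False
    have "Ck_on k (- K) (\<lambda>x. if x \<in> S then f x else 0)"
      by (rule Ck_on_cong[OF _ _ Ck_on_const[of k _ 0]]) (use assms in auto)
    then show ?thesis using False \<open>x \<in> W\<close> assms(2,3) by blast
  qed
qed

text \<open>Extension by zero makes the function continuous on the whole space, so an integral over
  a possibly irregular open set becomes the integral of a continuous function over a box.\<close>

lemma
  fixes f :: "'a::euclidean_space \<Rightarrow> real"
  assumes "open S" "compact K" "K \<subseteq> S" "continuous_on S f" "\<And>x. x \<in> S - K \<Longrightarrow> f x = 0"
  shows compactly_supported_absolutely_integrable: "f absolutely_integrable_on S"
    and compactly_supported_integral_cbox:
      "K \<subseteq> cbox a b \<Longrightarrow> integral S f = integral (cbox a b) (\<lambda>x. if x \<in> S then f x else 0)"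
    and compactly_supported_integral_UNIV:
      "((\<lambda>x. if x \<in> S then f x else 0) has_integral integral S f) UNIV"
proof -
  let ?e = "\<lambda>x. if x \<in> S then f x else 0"
  have "Ck_on 0 UNIV ?e"
    by (rule Ck_on_zero_extension[OF assms(1) compact_imp_closed[OF assms(2)]]) (use assms in auto)
  then have cont: "continuous_on UNIV ?e" by simp
  have box: "?e absolutely_integrable_on UNIV \<and> integral S f = integral (cbox a b) ?e"
    if K: "K \<subseteq> cbox a b" for a b
  proof -
    have 1: "?e absolutely_integrable_on (cbox a b)"
      by (rule absolutely_integrable_continuous[OF continuous_on_subset[OF cont]]) simp
    have z: "?e x = 0" if "x \<notin> cbox a b" for x using that K assms by auto
    have zz: "(\<lambda>x. if x \<in> cbox a b then ?e x else 0) = ?e"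
      by (rule ext) (metis z)
    with 1 have "?e absolutely_integrable_on UNIV"
      using absolutely_integrable_restrict_UNIV[of "cbox a b" ?e] by simp
    moreover have "integral S f = integral UNIV ?e" by (rule integral_restrict_UNIV[symmetric])
    moreover have "integral UNIV ?e = integral (cbox a b) ?e"
      using integral_restrict_UNIV[of "cbox a b" ?e] unfolding zz .
    ultimately show ?thesis by simp
  qed
  obtain c d where ab: "K \<subseteq> cbox c d"
    using assms(2) compact_imp_bounded bounded_subset_cbox_symmetric by metis
  show "f absolutely_integrable_on S"
    using box[OF ab] absolutely_integrable_restrict_UNIV[of S f] by blast
  show "((\<lambda>x. if x \<in> S then f x else 0) has_integral integral S f) UNIV"
  proof -
    have "?e integrable_on UNIV"
      using box[OF ab] set_lebesgue_integral_eq_integral(1) by blast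
    from integrable_integral[OF this] show ?thesis unfolding integral_restrict_UNIV .
  qed
  show "K \<subseteq> cbox a b \<Longrightarrow> integral S f = integral (cbox a b) ?e" using box by blast
qed

text \<open>The integral of the translate of \<open>f\<close> by \<open>t v\<close> does not depend
  on \<open>t\<close>, while its derivative at \<open>t = 0\<close> is the integral of the
  directional derivative. Translation invariance takes the place of Fubini and boundary
  terms.\<close>

lemma integral_FD_zero_UNIV:
  fixes f :: "'a::euclidean_space \<Rightarrow> real"
  assumes f: "Ck_on 1 UNIV f" and K: "compact K" "\<And>x. x \<notin> K \<Longrightarrow> f x = 0"
  shows "((\<lambda>x. FD f x v) has_integral 0) UNIV"
proof -
  have contf: "continuous_on UNIV f" using f Ck_on_imp_continuous_on by blast
  have d: "(f has_derivative FD f x) (at x)" for x using f by (intro FD_has) simp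
  have contd: "continuous_on UNIV (\<lambda>x. FD f x v)" using f by simp
  obtain R where R: "\<And>x. x \<in> K \<Longrightarrow> norm x \<le> R"
    using compact_imp_bounded[OF K(1)] bounded_iff by metis
  \<comment> \<open>The box is so large that the support stays inside it under every shift by
    \<open>t v\<close> with |t| < 1.\<close>
  obtain a b where ab: "cball 0 (R + norm v + 1) \<subseteq> cbox a (b::'a)"
    using bounded_subset_cbox_symmetric[OF bounded_cball] by metis
  have out: "f (x + t *\<^sub>R v) = 0" if "x \<notin> cbox a b" "t \<in> {-1<..<1}" for x t
  proof (rule K(2))
    have "R + norm v + 1 < norm x" using that ab by (auto simp: subset_iff not_le)
    moreover have "norm (t *\<^sub>R v) \<le> norm v"
      using that mult_left_le_one_le[of "norm v" "\<bar>t\<bar>"] by (auto simp: abs_le_iff)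
    moreover have "norm x \<le> norm (x + t *\<^sub>R v) + norm (t *\<^sub>R v)" by (metis add_diff_cancel_right' norm_triangle_ineq4)
    ultimately show "x + t *\<^sub>R v \<notin> K" using R by fastforce
  qed
  have out0: "f x = 0" if "x \<notin> cbox a b" for x using out[OF that, of 0] by simp
  define I where "I = integral (cbox a b) f"
  have fI: "(f has_integral I) (cbox a b)"
    unfolding I_def by (intro integrable_integral integrable_continuous continuous_on_subset[OF contf]) simp
  have const: "integral (cbox a b) (\<lambda>x. f (x + t *\<^sub>R v)) = I" if t: "t \<in> {-1<..<1}" for t
  proof -
    have "((\<lambda>x. f (1 *\<^sub>R x + t *\<^sub>R v)) has_integral (1 / \<bar>1\<bar> ^ DIM('a)) *\<^sub>R I)
        ((\<lambda>x. (1 / 1) *\<^sub>R x + - ((1 / 1) *\<^sub>R (t *\<^sub>R v))) ` cbox a b)"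
      by (rule has_integral_affinity[OF fI]) simp
    then have h: "((\<lambda>x. f (x + t *\<^sub>R v)) has_integral I) ((\<lambda>x. x - t *\<^sub>R v) ` cbox a b)" by simp
    have "((\<lambda>x. f (x + t *\<^sub>R v)) has_integral I) UNIV"
    proof (rule has_integral_on_superset[OF h])
      fix x assume "x \<notin> (\<lambda>x. x - t *\<^sub>R v) ` cbox a b"
      then have "x + t *\<^sub>R v \<notin> cbox a b" by force
      then show "f (x + t *\<^sub>R v) = 0" by (rule out0)
    qed simp
    moreover have "((\<lambda>x. f (x + t *\<^sub>R v)) has_integral integral (cbox a b) (\<lambda>x. f (x + t *\<^sub>R v))) UNIV"
    proof (rule has_integral_on_superset[OF integrable_integral])
      show "(\<lambda>x. f (x + t *\<^sub>R v)) integrable_on cbox a b"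
        by (intro integrable_continuous continuous_on_compose2[OF contf] continuous_intros) simp
    qed (use out t in auto)
    ultimately show ?thesis using has_integral_unique by blast
  qed
  have "((\<lambda>t. integral (cbox a b) (\<lambda>x. f (x + t *\<^sub>R v))) has_field_derivative
      integral (cbox a b) (\<lambda>x. FD f (x + 0 *\<^sub>R v) v)) (at 0 within {-1<..<1})"
  proof (rule leibniz_rule_field_derivative)
    fix t :: real and x
    have "((\<lambda>t. x + t *\<^sub>R v) has_derivative (\<lambda>s. s *\<^sub>R v)) (at t)" by (auto intro!: derivative_eq_intros)
    from has_derivative_compose[OF this d]
    have "((\<lambda>t. f (x + t *\<^sub>R v)) has_derivative (\<lambda>s. FD f (x + t *\<^sub>R v) (s *\<^sub>R v))) (at t)" .
    moreover have "(\<lambda>s. FD f (x + t *\<^sub>R v) (s *\<^sub>R v)) = (*) (FD f (x + t *\<^sub>R v) v)"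
      using linear_cmul[OF has_derivative_linear[OF d]] by (simp add: fun_eq_iff)
    ultimately show "((\<lambda>t. f (x + t *\<^sub>R v)) has_field_derivative FD f (x + t *\<^sub>R v) v) (at t within {-1<..<1})"
      by (simp add: has_field_derivative_def has_derivative_at_withinI)
  next
    fix t :: real
    show "(\<lambda>x. f (x + t *\<^sub>R v)) integrable_on cbox a b"
      by (intro integrable_continuous continuous_on_compose2[OF contf] continuous_intros) simp
  next
    have "continuous_on ({-1<..<1} \<times> cbox a b) (\<lambda>p::real \<times> 'a. FD f (snd p + fst p *\<^sub>R v) v)"
      by (rule continuous_on_compose2[OF contd]) (auto intro!: continuous_intros)
    then show "continuous_on ({-1<..<1} \<times> cbox a b) (\<lambda>(t, x). FD f (x + t *\<^sub>R v) v)"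
      by (simp add: case_prod_beta')
  qed auto
  then have "((\<lambda>t. integral (cbox a b) (\<lambda>x. f (x + t *\<^sub>R v))) has_field_derivative
      integral (cbox a b) (\<lambda>x. FD f x v)) (at 0)"
    by (simp add: at_within_open[of 0 "{-1<..<1::real}"])
  moreover have "((\<lambda>t. integral (cbox a b) (\<lambda>x. f (x + t *\<^sub>R v))) has_field_derivative 0) (at 0)"
    by (rule has_field_derivative_transform_within_open[of "\<lambda>_. I" _ _ "{-1<..<1}"]) (use const in auto)
  ultimately have "integral (cbox a b) (\<lambda>x. FD f x v) = 0" by (rule DERIV_unique)
  then have "((\<lambda>x. FD f x v) has_integral 0) (cbox a b)"
    using integrable_integral[OF integrable_continuous[OF continuous_on_subset[OF contd subset_UNIV]], of a b] by simp
  then show ?thesis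
  proof (rule has_integral_on_superset)
    fix x assume x: "x \<notin> cbox a b"
    have "FD (\<lambda>x. 0) x = FD f x"
      by (rule FD_cong[of "- cbox a b"]) (use x out0 in \<open>auto simp: closed_cbox open_Compl\<close>)
    then show "FD f x v = 0" by (metis frechet_derivative_const)
  qed simp
qed

lemma integral_FD_zero:
  fixes f :: "'a::euclidean_space \<Rightarrow> real"
  assumes "open S" "compact K" "K \<subseteq> S" "Ck_on 1 S f" "\<And>x. x \<in> S - K \<Longrightarrow> f x = 0"
  shows "((\<lambda>x. FD f x v) has_integral 0) S"
proof -
  let ?e = "\<lambda>x. if x \<in> S then f x else 0"
  have e: "Ck_on 1 UNIV ?e"
    by (rule Ck_on_zero_extension[OF assms(1) compact_imp_closed[OF assms(2)]]) (use assms in auto)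
  have "((\<lambda>x. FD ?e x v) has_integral 0) UNIV"
    by (rule integral_FD_zero_UNIV[OF e assms(2)]) (use assms in auto)
  moreover have "FD ?e x v = (if x \<in> S then FD f x v else 0)" for x
  proof (cases "x \<in> S")
    case True
    have "FD f x = FD ?e x" by (rule FD_cong[OF assms(1) True]) (use assms(4) True in auto)
    then show ?thesis using True by simp
  next
    case False
    have "FD (\<lambda>x. 0) x = FD ?e x"
      by (rule FD_cong[of "- K"]) (use False assms compact_imp_closed in auto)
    then show ?thesis using False by (metis frechet_derivative_const)
  qed
  ultimately show ?thesis by (simp add: has_integral_restrict_UNIV)
qed

section \<open>Change of variables without an order on the index type\<close>

text \<open>The library states the change of variables theorem for index types with a well-order only.
  A finite type is transported to a copy that is well-ordered by an enumeration.\<close>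

typedef 'd wo = "UNIV :: 'd set" morphisms un_wo Wo by simp

lemmas [simp] = un_wo_inverse Wo_inverse[OF UNIV_I]

lemma bij_Wo: "bij Wo"
  by (metis bijI' Wo_inverse UNIV_I un_wo_inverse)

lemma bij_un_wo: "bij un_wo"
  by (metis bijI' Wo_inverse UNIV_I un_wo_inverse)

instance wo :: (finite) finite
proof
  have "(UNIV :: 'a wo set) = range Wo" by (metis bij_Wo bij_is_surj)
  then show "finite (UNIV :: 'a wo set)" by (metis finite finite_imageI)
qed

instantiation wo :: (finite) wellorder
begin

definition less_eq_wo :: "'a wo \<Rightarrow> 'a wo \<Rightarrow> bool" where
  "x \<le> y \<longleftrightarrow> to_nat (un_wo x) \<le> to_nat (un_wo y)"

definition less_wo :: "'a wo \<Rightarrow> 'a wo \<Rightarrow> bool" where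
  "x < y \<longleftrightarrow> to_nat (un_wo x) < to_nat (un_wo y)"

instance
proof
  fix x y z :: "'a wo"
  show "(x < y) = (x \<le> y \<and> \<not> y \<le> x)" "x \<le> x" "x \<le> y \<Longrightarrow> y \<le> z \<Longrightarrow> x \<le> z" "x \<le> y \<or> y \<le> x"
    by (auto simp: less_eq_wo_def less_wo_def)
  show "x \<le> y \<Longrightarrow> y \<le> x \<Longrightarrow> x = y"
    by (metis less_eq_wo_def le_antisym to_nat_split un_wo_inverse from_nat_to_nat)
next
  fix P :: "'a wo \<Rightarrow> bool" and a :: "'a wo"
  assume *: "\<And>x. (\<And>y. y < x \<Longrightarrow> P y) \<Longrightarrow> P x"
  show "P a"
  proof (induction a rule: measure_induct_rule[of "\<lambda>x. to_nat (un_wo x)"])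
    case (less x)
    show ?case by (rule *) (rule less, simp add: less_wo_def)
  qed
qed

end

definition to_wo :: "real^'d \<Rightarrow> real^'d wo" where "to_wo x = (\<chi> i. x $ un_wo i)"
definition of_wo :: "real^'d wo \<Rightarrow> real^'d" where "of_wo x = (\<chi> i. x $ Wo i)"

lemma wo_vec_inverses [simp]: "of_wo (to_wo x) = x" "to_wo (of_wo y) = y"
  by (simp_all add: to_wo_def of_wo_def vec_eq_iff)

lemma bounded_linear_to_wo: "bounded_linear (to_wo :: real^'d::finite \<Rightarrow> _)"
  unfolding linear_conv_bounded_linear[symmetric] by (rule linearI) (simp_all add: to_wo_def vec_eq_iff)

lemma bounded_linear_of_wo: "bounded_linear (of_wo :: _ \<Rightarrow> real^'d::finite)"
  unfolding linear_conv_bounded_linear[symmetric] by (rule linearI) (simp_all add: of_wo_def vec_eq_iff)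

lemma to_wo_cbox: "to_wo ` cbox a b = cbox (to_wo a) (to_wo (b :: real^'d::finite))"
proof (intro equalityI subsetI)
  fix y assume "y \<in> to_wo ` cbox a b"
  then show "y \<in> cbox (to_wo a) (to_wo b)" by (auto simp: mem_box_cart to_wo_def)
next
  fix y :: "real^'d wo" assume y: "y \<in> cbox (to_wo a) (to_wo b)"
  have "a $ i \<le> of_wo y $ i \<and> of_wo y $ i \<le> b $ i" for i
  proof -
    have "to_wo a $ Wo i \<le> y $ Wo i \<and> y $ Wo i \<le> to_wo b $ Wo i" using y by (simp add: mem_box_cart)
    then show ?thesis by (simp add: to_wo_def of_wo_def)
  qed
  then have "of_wo y \<in> cbox a b" by (simp add: mem_box_cart)
  then show "y \<in> to_wo ` cbox a b" by (rule image_eqI[rotated]) simp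
qed

lemma of_wo_cbox: "of_wo ` cbox a b = cbox (of_wo a) (of_wo b :: real^'d::finite)"
proof -
  have "of_wo ` cbox a b = of_wo ` to_wo ` cbox (of_wo a) (of_wo b :: real^'d)" unfolding to_wo_cbox by simp
  then show ?thesis unfolding image_image by simp
qed

lemma content_to_wo: "Henstock_Kurzweil_Integration.content (to_wo ` cbox a b) = Henstock_Kurzweil_Integration.content (cbox a (b :: real^'d::finite))"
proof (cases "cbox a b = {}")
  case False
  have "(\<Prod>i\<in>UNIV. to_wo b $ i - to_wo a $ i) = (\<Prod>i\<in>UNIV. b $ i - a $ i)"
    unfolding to_wo_def by (simp add: prod.reindex_bij_betw[OF bij_un_wo, of "\<lambda>i. b $ i - a $ i"])
  moreover have "cbox (to_wo a) (to_wo b) \<noteq> {}" using False to_wo_cbox by (metis image_is_empty)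
  ultimately show ?thesis unfolding to_wo_cbox using False by (simp add: content_cbox_cart)
qed simp

text \<open>Relabelling coordinates carries boxes to boxes of the same content, so the substitution
  has scaling factor 1.\<close>

lemma has_integral_of_wo:
  fixes f :: "real^'d::finite \<Rightarrow> real"
  assumes "(f has_integral I) (cbox a b)"
  shows "((\<lambda>y. f (of_wo y)) has_integral I) (to_wo ` cbox a b)"
proof -
  have "((\<lambda>y. f (of_wo y)) has_integral (1 / 1) *\<^sub>R I) (to_wo ` cbox a b)"
  proof (rule has_integral_twiddle[OF _ _ _ _ _ _ _ assms])
    show "\<exists>w z. of_wo ` cbox u v = cbox w (z :: real^'d)" for u v using of_wo_cbox by blast
    show "\<exists>w z. to_wo ` cbox u v = cbox w z" for u v :: "real^'d" using to_wo_cbox by blast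
    show "continuous (at x) (of_wo :: _ \<Rightarrow> real^'d)" for x
      by (rule linear_continuous_at[OF bounded_linear_of_wo])
    show "Henstock_Kurzweil_Integration.content (of_wo ` cbox u v :: (real^'d) set) = 1 * Henstock_Kurzweil_Integration.content (cbox u v)" for u v
      using content_to_wo[of "of_wo u" "of_wo v"] by (simp add: of_wo_cbox to_wo_cbox)
  qed auto
  then show ?thesis by simp
qed

lemma integral_of_wo:
  fixes f :: "real^'d::finite \<Rightarrow> real"
  assumes "open S" "compact K" "K \<subseteq> S" "continuous_on S f" "\<And>x. x \<in> S - K \<Longrightarrow> f x = 0"
  shows "integral (to_wo ` S) (\<lambda>y. f (of_wo y)) = integral S f"
proof -
  obtain a b where ab: "K \<subseteq> cbox a b"
    using assms(2) compact_imp_bounded bounded_subset_cbox_symmetric by metis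
  let ?e = "\<lambda>x. if x \<in> S then f x else 0"
  have "Ck_on 0 UNIV ?e"
    by (rule Ck_on_zero_extension[OF assms(1) compact_imp_closed[OF assms(2)]]) (use assms in auto)
  then have cont: "continuous_on UNIV ?e" by simp
  have "(?e has_integral integral S f) (cbox a b)"
    using compactly_supported_integral_cbox[OF assms ab] integrable_integral integrable_continuous
      continuous_on_subset[OF cont] by (metis (no_types, lifting) subset_UNIV)
  from has_integral_of_wo[OF this]
  have "((\<lambda>y. ?e (of_wo y)) has_integral integral S f) UNIV"
    by (rule has_integral_on_superset) (use ab assms in \<open>force simp: image_iff split: if_splits\<close>)+
  moreover have "(\<lambda>y. ?e (of_wo y)) = (\<lambda>y. if y \<in> to_wo ` S then f (of_wo y) else 0)"
    by (force simp: fun_eq_iff image_iff)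
  ultimately have "((\<lambda>y. f (of_wo y)) has_integral integral S f) (to_wo ` S)"
    by (simp only: has_integral_restrict_UNIV)
  then show ?thesis by (rule integral_unique)
qed

text \<open>Conjugation by the bijection of index types is a bijection between the permutations that
  preserves signs, so the two Leibniz expansions agree term by term.\<close>

lemma det_reindex_wo: "det (\<chi> i j. A $ un_wo i $ un_wo j) = det (A :: real^'d::finite^'d)"
proof -
  have s: "sign (Wo \<circ> p \<circ> un_wo) = sign p" if "p permutes (UNIV :: 'd set)" for p
  proof -
    have "map_permutation UNIV Wo p = Wo \<circ> p \<circ> un_wo"
    proof
      fix x :: "'d wo"
      have "inv Wo x = un_wo x" by (metis bij_Wo bij_is_inj inv_f_f un_wo_inverse)
      then show "map_permutation UNIV Wo p x = (Wo \<circ> p \<circ> un_wo) x"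
        unfolding map_permutation_def restrict_id_def by (simp add: bij_is_surj[OF bij_Wo])
    qed
    then show ?thesis using sign_map_permutation[OF bij_is_inj[OF bij_Wo] that finite] by metis
  qed
  show ?thesis
    unfolding det_def
  proof (rule sum.reindex_bij_witness[where i="\<lambda>p. Wo \<circ> p \<circ> un_wo" and j="\<lambda>p. un_wo \<circ> p \<circ> Wo"])
    fix p assume p: "p \<in> {p. p permutes (UNIV :: 'd wo set)}"
    show "Wo \<circ> (un_wo \<circ> p \<circ> Wo) \<circ> un_wo = p" by (simp add: fun_eq_iff)
    have "bij (un_wo \<circ> p \<circ> Wo)"
      using bij_comp[OF bij_comp[OF bij_Wo permutes_bij] bij_un_wo] p by (simp add: comp_assoc)
    then show q: "un_wo \<circ> p \<circ> Wo \<in> {p. p permutes UNIV}" by (simp add: permutes_def bij_iff)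
    have "sign p = sign (un_wo \<circ> p \<circ> Wo)" using s[of "un_wo \<circ> p \<circ> Wo"] q by (simp add: comp_def)
    moreover have "(\<Prod>i\<in>UNIV. A $ un_wo i $ un_wo (p i)) = (\<Prod>i\<in>UNIV. A $ i $ (un_wo \<circ> p \<circ> Wo) i)"
      using prod.reindex_bij_betw[OF bij_un_wo, of "\<lambda>i. A $ i $ (un_wo \<circ> p \<circ> Wo) i"] by simp
    ultimately show "of_int (sign (un_wo \<circ> p \<circ> Wo)) * (\<Prod>i\<in>UNIV. A $ i $ (un_wo \<circ> p \<circ> Wo) i) =
      of_int (sign p) * (\<Prod>i\<in>UNIV. (\<chi> i j. A $ un_wo i $ un_wo j) $ i $ p i)" by simp
  next
    fix p assume p: "p \<in> {p. p permutes (UNIV :: 'd set)}"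
    show "un_wo \<circ> (Wo \<circ> p \<circ> un_wo) \<circ> Wo = p" by (simp add: fun_eq_iff)
    have "bij (Wo \<circ> p \<circ> un_wo)"
      using bij_comp[OF bij_comp[OF bij_un_wo permutes_bij] bij_Wo] p by (simp add: comp_assoc)
    then show "Wo \<circ> p \<circ> un_wo \<in> {p. p permutes UNIV}" by (simp add: permutes_def bij_iff)
  qed
qed

lemma integral_change_of_variables_wo:
  fixes f :: "real^'m::{finite,wellorder} \<Rightarrow> real"
  assumes "open S" "\<And>x. x \<in> S \<Longrightarrow> (F has_derivative F' x) (at x)" "inj_on F S"
    "open (F ` S)" "compact K" "K \<subseteq> F ` S" "continuous_on (F ` S) f" "\<And>x. x \<in> F ` S - K \<Longrightarrow> f x = 0"
  shows "integral S (\<lambda>x. \<bar>det (matrix (F' x))\<bar> * f (F x)) = integral (F ` S) f"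
proof -
  have "f absolutely_integrable_on (F ` S)"
    by (rule compactly_supported_absolutely_integrable[OF assms(4-8)])
  \<comment> \<open>The substitution theorem speaks of vector-valued integrands; a real function
    enters as one with values in \<open>real^1\<close>.\<close>
  then have "(\<lambda>x. vec (f x) :: real^1) absolutely_integrable_on (F ` S)"
    by (simp add: absolutely_integrable_on_1_iff)
  moreover have "integral (F ` S) (\<lambda>x. vec (f x) :: real^1) = vec (integral (F ` S) f)"
    by (simp add: integral_on_1_eq)
  ultimately have "integral S (\<lambda>x. \<bar>det (matrix (F' x))\<bar> *\<^sub>R vec (f (F x)) :: real^1) = vec (integral (F ` S) f)"
    using has_absolute_integral_change_of_variables[of S F F' "\<lambda>x. vec (f x) :: real^1", OF _ _ assms(3)]
      assms(1,2) by (auto simp: has_derivative_at_withinI intro!: sets_completionI_sets)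
  then show ?thesis by (simp add: integral_on_1_eq vec_eq_iff)
qed

lemma integral_change_of_variables:
  fixes f :: "real^'d::finite \<Rightarrow> real" and F :: "real^'d \<Rightarrow> real^'d"
  assumes S: "open S" and F: "\<And>x. x \<in> S \<Longrightarrow> (F has_derivative F' x) (at x)" and inj: "inj_on F S"
    and FS: "open (F ` S)" and K: "compact K" "K \<subseteq> F ` S" and f: "continuous_on (F ` S) f"
    and supp: "\<And>x. x \<in> F ` S - K \<Longrightarrow> f x = 0"
    and G: "continuous_on (F ` S) G" "\<And>x. x \<in> S \<Longrightarrow> G (F x) = x"
    and cont: "continuous_on S (\<lambda>x. \<bar>det (matrix (F' x))\<bar> * f (F x))"
  shows "integral S (\<lambda>x. \<bar>det (matrix (F' x))\<bar> * f (F x)) = integral (F ` S) f"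
proof -
  define F1 where "F1 y = to_wo (F (of_wo y))" for y
  define F1' where "F1' y h = to_wo (F' (of_wo y) (of_wo h))" for y h
  have op: "open (to_wo ` T)" if "open T" for T :: "(real^'d) set"
  proof -
    have "to_wo ` T = of_wo -` T" by (force simp: image_iff)
    moreover have "continuous_on UNIV (of_wo :: _ \<Rightarrow> real^'d)"
      by (rule linear_continuous_on[OF bounded_linear_of_wo])
    ultimately show ?thesis using that by (simp add: open_vimage)
  qed
  have im: "F1 ` (to_wo ` S) = to_wo ` (F ` S)" unfolding F1_def image_image by simp
  have "integral (to_wo ` S) (\<lambda>y. \<bar>det (matrix (F1' y))\<bar> * f (of_wo (F1 y))) = integral (F1 ` (to_wo ` S)) (\<lambda>z. f (of_wo z))"
  proof (rule integral_change_of_variables_wo)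
    show "open (to_wo ` S)" "open (F1 ` (to_wo ` S))" unfolding im using S FS by (auto intro: op)
    show "(F1 has_derivative F1' y) (at y)" if "y \<in> to_wo ` S" for y
    proof -
      have "of_wo y \<in> S" using that by auto
      have "((\<lambda>y. F (of_wo y)) has_derivative (\<lambda>h. F' (of_wo y) (of_wo h))) (at y)"
        by (rule has_derivative_compose[OF bounded_linear_imp_has_derivative[OF bounded_linear_of_wo] F[OF \<open>of_wo y \<in> S\<close>]])
      then show ?thesis unfolding F1_def F1'_def by (rule bounded_linear.has_derivative[OF bounded_linear_to_wo])
    qed
    show "inj_on F1 (to_wo ` S)"
      unfolding F1_def using inj by (auto simp: inj_on_def) (metis wo_vec_inverses(1))
    show "compact (to_wo ` K)"
      by (rule compact_continuous_image[OF linear_continuous_on[OF bounded_linear_to_wo] K(1)])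
    show "to_wo ` K \<subseteq> F1 ` to_wo ` S" unfolding im using K by auto
    show "continuous_on (F1 ` to_wo ` S) (\<lambda>z. f (of_wo z))"
      unfolding im by (rule continuous_on_compose2[OF f linear_continuous_on[OF bounded_linear_of_wo]]) auto
    show "f (of_wo z) = 0" if "z \<in> F1 ` to_wo ` S - to_wo ` K" for z
      using that unfolding im by (intro supp) auto
  qed
  moreover have "integral (F1 ` (to_wo ` S)) (\<lambda>z. f (of_wo z)) = integral (F ` S) f"
    unfolding im by (rule integral_of_wo[OF FS K f supp])
  moreover have "det (matrix (F1' y)) = det (matrix (F' (of_wo y)))" for y
  proof -
    have "of_wo (axis j 1) = (axis (un_wo j) 1 :: real^'d)" for j
      unfolding of_wo_def axis_def by (auto simp: vec_eq_iff)
    then have "matrix (F1' y) = (\<chi> i j. matrix (F' (of_wo y)) $ un_wo i $ un_wo j)"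
      by (simp add: matrix_def F1'_def to_wo_def)
    then show ?thesis using det_reindex_wo by metis
  qed
  moreover have "integral (to_wo ` S) (\<lambda>y. \<bar>det (matrix (F' (of_wo y)))\<bar> * f (F (of_wo y)))
    = integral S (\<lambda>x. \<bar>det (matrix (F' x))\<bar> * f (F x))"
  proof (rule integral_of_wo[of S "G ` K", OF S _ _ cont])
    \<comment> \<open>The transformed integrand is supported in the preimage of \<open>K\<close>,
      which is compact because the inverse \<open>G\<close> is continuous.\<close>
    show "compact (G ` K)" using G(1) K by (metis compact_continuous_image continuous_on_subset)
    show "G ` K \<subseteq> S" using K(2) G(2) by auto
    show "\<bar>det (matrix (F' x))\<bar> * f (F x) = 0" if "x \<in> S - G ` K" for x
      using that G(2) supp[of "F x"] by force
  qed
  ultimately show ?thesis by (simp add: F1_def)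
qed

section \<open>Inner products on the model space\<close>

definition pos_inner :: "(real^'d \<Rightarrow> real^'d \<Rightarrow> real) \<Rightarrow> bool" where
  "pos_inner G \<longleftrightarrow> bilinear G \<and> (\<forall>u v. G u v = G v u) \<and> (\<forall>u. u \<noteq> 0 \<longrightarrow> G u u > 0)"

definition gram :: "(real^'d \<Rightarrow> real^'d \<Rightarrow> real) \<Rightarrow> real^'d::finite^'d" where
  "gram G = (\<chi> i j. G (axis i 1) (axis j 1))"

lemma bilinear_sum_left: "bilinear h \<Longrightarrow> h (\<Sum>i\<in>I. f i) y = (\<Sum>i\<in>I. h (f i) y)"
  using linear_sum[of "\<lambda>x. h x y"] by (simp add: bilinear_def)

lemma bilinear_sum_right: "bilinear h \<Longrightarrow> h x (\<Sum>i\<in>I. f i) = (\<Sum>i\<in>I. h x (f i))"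
  using linear_sum[of "h x"] by (simp add: bilinear_def)

lemmas bilinear_simps = bilinear_ladd bilinear_radd bilinear_lmul bilinear_rmul
  bilinear_lneg bilinear_rneg bilinear_lzero bilinear_rzero bilinear_lsub bilinear_rsub
  bilinear_sum_left bilinear_sum_right

text \<open>Gram-Schmidt, by induction on the set of indices already served: fewer than
  \<open>CARD('d)\<close> vectors leave some \<open>v\<close> outside their span, and
  \<open>v\<close> minus its projections can be normalized.\<close>

lemma orthonormal_subset_frame:
  fixes G :: "real^'d \<Rightarrow> real^'d::finite \<Rightarrow> real" and I :: "'d set"
  assumes G: "pos_inner G" and I: "finite I"
  shows "\<exists>e. \<forall>i\<in>I. \<forall>j\<in>I. G (e i) (e j) = (if i = j then 1 else 0 :: real)"
  using I
proof (induction I)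
  case empty
  then show ?case by simp
next
  case (insert i I)
  then obtain e where e: "\<forall>i\<in>I. \<forall>j\<in>I. G (e i) (e j) = (if i = j then 1 else 0)" by blast
  have bil: "bilinear G" and sym: "\<And>u v. G u v = G v u" using G by (auto simp: pos_inner_def)
  have "dim (span (e ` I)) \<le> card (e ` I)" using insert by (simp add: dim_le_card')
  also have "\<dots> \<le> card I" using insert by (simp add: card_image_le)
  also have "\<dots> < CARD('d)" using insert by (intro psubset_card_mono) auto
  finally have "span (e ` I) \<noteq> UNIV" using dim_eq_full[of "e ` I"] by auto
  then obtain v where v: "v \<notin> span (e ` I)" by blast
  define w where "w = v - (\<Sum>j\<in>I. G v (e j) *\<^sub>R e j)"
  have "(\<Sum>j\<in>I. G v (e j) *\<^sub>R e j) \<in> span (e ` I)"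
    by (intro span_sum span_scale span_base) auto
  then have "w \<noteq> 0" using v unfolding w_def by auto
  then have pos: "G w w > 0" using G by (auto simp: pos_inner_def)
  have orth: "G w (e k) = 0" if "k \<in> I" for k
  proof -
    have "G w (e k) = G v (e k) - (\<Sum>j\<in>I. G v (e j) * (if j = k then 1 else 0))"
      unfolding w_def using that e by (simp add: bilinear_simps[OF bil] cong: sum.cong)
    then show ?thesis using that insert by (simp add: mult_ac if_distrib cong: if_cong)
  qed
  define f where "f = e(i := (1 / sqrt (G w w)) *\<^sub>R w)"
  have "G (f a) (f b) = (if a = b then 1 else 0)" if "a \<in> insert i I" "b \<in> insert i I" for a b
  proof (cases "a = i"; cases "b = i")
    assume "a = i" "b = i"
    have "sqrt (G w w) * sqrt (G w w) = G w w" using pos by simp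
    then show ?thesis using \<open>a = i\<close> \<open>b = i\<close> pos by (simp add: f_def bilinear_simps[OF bil])
  next
    assume "a = i" "b \<noteq> i"
    then show ?thesis using that orth by (simp add: f_def bilinear_simps[OF bil])
  next
    assume "a \<noteq> i" "b = i"
    moreover have "G (e a) w = 0" using that \<open>a \<noteq> i\<close> orth sym[of "e a" w] by simp
    ultimately show ?thesis by (simp add: f_def bilinear_simps[OF bil])
  next
    assume "a \<noteq> i" "b \<noteq> i"
    then show ?thesis using that e by (simp add: f_def)
  qed
  then show ?case by blast
qed

lemma orthonormal_some_frame:
  assumes "pos_inner G"
  shows "orthonormal_frame G (some_frame G)"
proof -
  have "\<exists>e. orthonormal_frame G e"
    using orthonormal_subset_frame[OF assms finite_class.finite_UNIV]
    unfolding orthonormal_frame_def by blast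
  then show ?thesis unfolding some_frame_def by (rule someI_ex)
qed

lemma vec_axis_sum: "(v :: real^'d::finite) = (\<Sum>k\<in>UNIV. (v $ k) *\<^sub>R axis k 1)"
  using basis_expansion[of v, symmetric] unfolding scalar_mult_eq_scaleR .

lemma linear_axis_sum:
  assumes "linear L"
  shows "L (v :: real^'d::finite) = (\<Sum>k\<in>UNIV. (v $ k) *\<^sub>R L (axis k 1))"
proof -
  have "L (\<Sum>k\<in>UNIV. (v $ k) *\<^sub>R axis k 1) = (\<Sum>k\<in>UNIV. (v $ k) *\<^sub>R L (axis k 1))"
    by (simp add: linear_sum[OF assms] linear_cmul[OF assms])
  then show ?thesis using vec_axis_sum[of v] by simp
qed

lemma bilinear_axis_sum:
  assumes "bilinear b"
  shows "b (u :: real^'d::finite) (v :: real^'d) =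
    (\<Sum>k\<in>UNIV. \<Sum>l\<in>UNIV. u $ k * v $ l * (b (axis k 1) (axis l 1) :: real))"
proof -
  have "b (\<Sum>k\<in>UNIV. (u $ k) *\<^sub>R axis k 1) (\<Sum>l\<in>UNIV. (v $ l) *\<^sub>R axis l 1) =
    (\<Sum>k\<in>UNIV. \<Sum>l\<in>UNIV. u $ k * v $ l * (b (axis k 1) (axis l 1) :: real))"
    by (subst sum.swap) (simp add: bilinear_simps[OF assms] sum_distrib_left mult_ac)
  then show ?thesis using vec_axis_sum[of u] vec_axis_sum[of v] by simp
qed

lemma sum_product_swap:
  fixes a b :: "'d::finite \<Rightarrow> real"
  shows "(\<Sum>l\<in>UNIV. (\<Sum>k\<in>UNIV. a k * M k l) * b l) = (\<Sum>k\<in>UNIV. \<Sum>l\<in>UNIV. a k * b l * M k l)"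
proof -
  have "(\<Sum>l\<in>UNIV. (\<Sum>k\<in>UNIV. a k * M k l) * b l) = (\<Sum>l\<in>UNIV. \<Sum>k\<in>UNIV. a k * b l * M k l)"
    by (simp add: sum_distrib_left mult_ac)
  also have "\<dots> = (\<Sum>k\<in>UNIV. \<Sum>l\<in>UNIV. a k * b l * M k l)" by (rule sum.swap)
  finally show ?thesis .
qed

text \<open>Entry \<open>(k, l)\<close> of the inverse matrix in the form of Cramer's rule. As a
  quotient of determinants it depends smoothly on the entries of \<open>M\<close>.\<close>

definition inverse_entry :: "real^'d::finite^'d \<Rightarrow> 'd \<Rightarrow> 'd \<Rightarrow> real" where
  "inverse_entry M k l = det (\<chi> i j. if j = k then axis l 1 $ i else M $ i $ j) / det M"

text \<open>The contraction \<open>g^{kl} b_{kl}\<close>, a substitute for the sum of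
  \<open>b (e i) (e i)\<close> over an orthonormal frame that involves no choice of frame.\<close>

definition metric_trace ::
  "(real^'d \<Rightarrow> real^'d \<Rightarrow> real) \<Rightarrow> (real^'d \<Rightarrow> real^'d \<Rightarrow> real) \<Rightarrow> real" where
  "metric_trace G b = (\<Sum>k\<in>UNIV. \<Sum>l\<in>UNIV. inverse_entry (gram G) k l * b (axis k 1) (axis l 1 :: real^'d::finite))"

text \<open>Raising an index: the vector dual to \<beta> under the metric, again through the inverse
  Gram matrix so that smoothness in a parameter is visible.\<close>

definition sharp :: "(real^'d::finite \<Rightarrow> real^'d \<Rightarrow> real) \<Rightarrow> (real^'d \<Rightarrow> real) \<Rightarrow> real^'d" where
  "sharp G \<beta> = (\<Sum>k\<in>UNIV. \<Sum>l\<in>UNIV. (inverse_entry (gram G) k l * \<beta> (axis k 1)) *\<^sub>R axis l 1)"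

section \<open>Computations in an orthonormal frame\<close>

context
  fixes G :: "real^'d::finite \<Rightarrow> real^'d \<Rightarrow> real" and e :: "'d \<Rightarrow> real^'d"
  assumes G: "pos_inner G" and e: "orthonormal_frame G e"
begin

text \<open>Orthonormality as a matrix equation, with the frame vectors as columns. The determinant
  and inverse of the Gram matrix and the expansion in the frame all follow from it.\<close>

lemma frame_matrix:
  defines "E \<equiv> (\<chi> k i. e i $ k) :: real^'d^'d"
  shows "transpose E ** gram G ** E = mat 1"
proof -
  have "(transpose E ** gram G ** E) $ i $ j = G (e i) (e j)" for i j
  proof -
    have "(transpose E ** gram G ** E) $ i $ j = (\<Sum>l\<in>UNIV. (\<Sum>k\<in>UNIV. e i $ k * G (axis k 1) (axis l 1)) * e j $ l)"
      by (simp add: matrix_matrix_mult_def transpose_def E_def gram_def)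
    also have "\<dots> = (\<Sum>k\<in>UNIV. \<Sum>l\<in>UNIV. e i $ k * e j $ l * G (axis k 1) (axis l 1))"
      by (rule sum_product_swap)
    also have "\<dots> = G (e i) (e j)" using G by (subst bilinear_axis_sum[symmetric]) (auto simp: pos_inner_def)
    finally show ?thesis .
  qed
  then show ?thesis using e by (simp add: vec_eq_iff mat_def orthonormal_frame_def)
qed

lemma det_frame: "(det (\<chi> k i. e i $ k))\<^sup>2 * det (gram G) = 1"
  using arg_cong[OF frame_matrix, of det] by (simp add: det_mul det_transpose power2_eq_square mult_ac)

lemma det_gram_pos: "det (gram G) > 0"
proof (rule ccontr)
  assume "\<not> ?thesis"
  then have "(det (\<chi> k i. e i $ k))\<^sup>2 * det (gram G) \<le> 0"
    by (intro mult_nonneg_nonpos) auto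
  then show False using det_frame by simp
qed

text \<open>\<open>E\<close> times its transpose is the inverse of the Gram matrix, since a
  one-sided inverse of a square matrix is two-sided; Cramer's rule, applied to its column
  \<open>l\<close>, gives the entries.\<close>

lemma frame_inverse_entry: "(\<Sum>i\<in>UNIV. e i $ k * e i $ l) = inverse_entry (gram G) k l"
proof -
  define E where "E = ((\<chi> k i. e i $ k) :: real^'d^'d)"
  have "(transpose E ** gram G) ** E = mat 1" using frame_matrix by (simp add: E_def)
  then have "E ** (transpose E ** gram G) = mat 1" using matrix_left_right_inverse by blast
  then have "(E ** transpose E) ** gram G = mat 1" by (simp add: matrix_mul_assoc)
  then have 1: "gram G ** (E ** transpose E) = mat 1" using matrix_left_right_inverse by blast
  define x where "x = column l (E ** transpose E)"
  have "gram G *v x = axis l 1"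
    using arg_cong[OF 1, of "column l"]
    by (simp add: x_def vec_eq_iff column_def matrix_vector_mult_def matrix_matrix_mult_def mat_def axis_def)
  then have "x = (\<chi> k. det (\<chi> i j. if j = k then axis l 1 $ i else gram G $ i $ j) / det (gram G))"
    using cramer[of "gram G"] det_gram_pos by simp
  then have "x $ k = inverse_entry (gram G) k l" by (simp add: inverse_entry_def)
  then show ?thesis by (simp add: x_def column_def matrix_matrix_mult_def transpose_def E_def)
qed

text \<open>The right side does not mention the frame: the trace is the same for every orthonormal
  frame, and it inherits smoothness from the metric and \<open>b\<close>.\<close>

lemma metric_trace_frame:
  assumes "bilinear b"
  shows "(\<Sum>i\<in>UNIV. b (e i) (e i)) = metric_trace G b"
proof -
  have "(\<Sum>i\<in>UNIV. b (e i) (e i)) =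
      (\<Sum>i\<in>UNIV. \<Sum>k\<in>UNIV. \<Sum>l\<in>UNIV. e i $ k * e i $ l * b (axis k 1) (axis l 1))"
    by (rule sum.cong[OF refl], rule bilinear_axis_sum[OF assms])
  also have "\<dots> = (\<Sum>k\<in>UNIV. \<Sum>i\<in>UNIV. \<Sum>l\<in>UNIV. e i $ k * e i $ l * b (axis k 1) (axis l 1))"
    by (rule sum.swap)
  also have "\<dots> = (\<Sum>k\<in>UNIV. \<Sum>l\<in>UNIV. \<Sum>i\<in>UNIV. e i $ k * e i $ l * b (axis k 1) (axis l 1))"
    by (rule sum.cong[OF refl], rule sum.swap)
  also have "\<dots> = metric_trace G b"
    unfolding metric_trace_def frame_inverse_entry[symmetric] by (simp add: sum_distrib_right)
  finally show ?thesis .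
qed

lemma frame_expansion: "v = (\<Sum>i\<in>UNIV. G v (e i) *\<^sub>R e i)"
proof -
  have bil: "bilinear G" using G by (simp add: pos_inner_def)
  have orth: "G (v - (\<Sum>i\<in>UNIV. G v (e i) *\<^sub>R e i)) (e k) = 0" for k
  proof -
    have e': "G (e i) (e j) = (if i = j then 1 else 0)" for i j
      using e by (simp add: orthonormal_frame_def)
    show ?thesis by (simp add: bilinear_simps[OF bil] e' if_distrib cong: if_cong)
  qed
  define E where "E = ((\<chi> k i. e i $ k) :: real^'d^'d)"
  define w where "w = v - (\<Sum>i\<in>UNIV. G v (e i) *\<^sub>R e i)"
  have "(transpose E ** gram G) ** E = mat 1" using frame_matrix by (simp add: E_def)
  then have inv: "E ** (transpose E ** gram G) = mat 1" using matrix_left_right_inverse by blast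
  have Ev: "E *v z = (\<Sum>i\<in>UNIV. z $ i *\<^sub>R e i)" for z
    by (simp add: vec_eq_iff matrix_vector_mult_def E_def mult.commute)
  \<comment> \<open>The coefficients of the remainder \<open>w\<close> in the frame are its inner
    products with the frame vectors, all of which vanish.\<close>
  have "w = E *v ((transpose E ** gram G) *v w)" by (simp add: matrix_vector_mul_assoc inv)
  then have "w = (\<Sum>i\<in>UNIV. ((transpose E ** gram G) *v w) $ i *\<^sub>R e i)" by (simp only: Ev)
  moreover have "((transpose E ** gram G) *v w) $ i = G (e i) w" for i
  proof -
    have "((transpose E ** gram G) *v w) $ i = (\<Sum>l\<in>UNIV. (\<Sum>k\<in>UNIV. e i $ k * G (axis k 1) (axis l 1)) * w $ l)"
      by (simp add: matrix_vector_mult_def matrix_matrix_mult_def transpose_def E_def gram_def)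
    also have "\<dots> = (\<Sum>k\<in>UNIV. \<Sum>l\<in>UNIV. e i $ k * w $ l * G (axis k 1) (axis l 1))"
      by (rule sum_product_swap)
    also have "\<dots> = G (e i) w" by (rule bilinear_axis_sum[OF bil, symmetric])
    finally show ?thesis .
  qed
  moreover have "G (e i) w = 0" for i using orth[of i] G by (simp add: w_def pos_inner_def)
  ultimately have "w = 0" by simp
  then show ?thesis by (simp add: w_def)
qed

lemma linear_frame_sum: "linear L \<Longrightarrow> L v = (\<Sum>i\<in>UNIV. G v (e i) *\<^sub>R L (e i))"
  by (subst frame_expansion[of v]) (simp add: linear_sum linear_cmul)

text \<open>Basis independence of the trace of an endomorphism; it converts the Euclidean
  divergence, a sum over the axes, into a sum over a frame.\<close>

lemma trace_frame: "linear L \<Longrightarrow> (\<Sum>k\<in>UNIV. L (axis k 1) $ k) = (\<Sum>i\<in>UNIV. G (L (e i)) (e i))"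
proof -
  assume L: "linear L"
  have bil: "bilinear G" using G by (simp add: pos_inner_def)
  have lin: "linear (\<lambda>u. G (L u) w)" for w
    using linear_compose[OF L, of "\<lambda>u. G u w"] bil by (simp add: bilinear_def o_def)
  have "L (axis k 1) $ k = (\<Sum>i\<in>UNIV. G (L (axis k 1)) (e i) * e i $ k)" for k
    using arg_cong[OF frame_expansion, of "\<lambda>x. x $ k" "L (axis k 1)"] by simp
  then have "(\<Sum>k\<in>UNIV. L (axis k 1) $ k) = (\<Sum>i\<in>UNIV. \<Sum>k\<in>UNIV. e i $ k * G (L (axis k 1)) (e i))"
    by (subst sum.swap) (simp add: mult.commute)
  also have "\<dots> = (\<Sum>i\<in>UNIV. G (L (e i)) (e i))"
  proof (rule sum.cong[OF refl])
    fix i show "(\<Sum>k\<in>UNIV. e i $ k * G (L (axis k 1)) (e i)) = G (L (e i)) (e i)"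
      using linear_axis_sum[OF lin[of "e i"], of "e i"] by simp
  qed
  finally show ?thesis .
qed

lemma sharp_frame: "linear \<beta> \<Longrightarrow> sharp G \<beta> = (\<Sum>i\<in>UNIV. \<beta> (e i) *\<^sub>R e i)"
proof -
  assume b: "linear \<beta>"
  have "sharp G \<beta> $ m = (\<Sum>i\<in>UNIV. \<beta> (e i) *\<^sub>R e i) $ m" for m
  proof -
    \<comment> \<open>Component \<open>m\<close> of \<open>sharp\<close> is the metric trace of this
      bilinear form, so it can be computed in the frame.\<close>
    have bil: "bilinear (\<lambda>u v. \<beta> u * v $ m)"
      using b by (auto simp: bilinear_def linear_iff algebra_simps)
    show ?thesis
      using metric_trace_frame[OF bil]
      by (simp add: sharp_def metric_trace_def mult_ac)
  qed
  then show ?thesis by (simp add: vec_eq_iff)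
qed

lemma sharp_inner:
  assumes "linear \<beta>"
  shows "G (sharp G \<beta>) w = \<beta> w"
proof -
  have bil: "bilinear G" using G by (simp add: pos_inner_def)
  show ?thesis
    unfolding sharp_frame[OF assms] linear_frame_sum[OF assms, of w]
    using G by (simp add: bilinear_simps[OF bil] pos_inner_def mult.commute)
qed

end

section \<open>Riemannian metrics on open subsets of the model space\<close>

lemma smooth_on_det:
  assumes "open S" "\<And>i j. smooth_on S (\<lambda>x. M x $ i $ j :: real)"
  shows "smooth_on S (\<lambda>x. det (M x))"
  unfolding det_def by (intro smooth_on_sum smooth_on_mult smooth_on_prod smooth_on_const assms)

text \<open>Only the identity permutation contributes to the derivative of the Leibniz expansion:
  any other one moves at least two indices, so after one factor is differentiated an off-diagonal
  zero remains in the product.\<close>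

lemma det_has_derivative_at_mat_1:
  fixes M :: "'a::real_normed_vector \<Rightarrow> real^'d::finite^'d"
  assumes "\<And>i j. ((\<lambda>y. M y $ i $ j) has_derivative M' i j) (at x)" "M x = mat 1"
  shows "((\<lambda>y. det (M y)) has_derivative (\<lambda>h. \<Sum>i\<in>UNIV. M' i i h)) (at x)"
proof -
  have 1: "((\<lambda>y. det (M y)) has_derivative (\<lambda>h. \<Sum>p | p permutes (UNIV :: 'd set).
     of_int (sign p) * (\<Sum>i\<in>UNIV. M' i (p i) h * (\<Prod>j\<in>UNIV - {i}. M x $ j $ p j)))) (at x)"
    unfolding det_def
    by (rule has_derivative_sum, rule has_derivative_mult_right, rule has_derivative_prod, rule assms(1))
  have "(\<Sum>i\<in>UNIV. M' i (p i) h * (\<Prod>j\<in>UNIV - {i}. M x $ j $ p j)) = 0"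
    if p: "p permutes (UNIV :: 'd set)" "p \<noteq> id" for p h
  proof (rule sum.neutral, rule ballI)
    fix i
    obtain j where j: "p j \<noteq> j" using p(2) by (auto simp: fun_eq_iff)
    have "\<exists>k. k \<noteq> i \<and> p k \<noteq> k"
    proof (cases "j = i")
      case True
      have "p (p j) \<noteq> p j" using j permutes_inj[OF p(1)] by (simp add: inj_eq)
      then show ?thesis using True j by blast
    qed (use j in blast)
    then obtain k where k: "k \<noteq> i" "p k \<noteq> k" by blast
    have "(\<Prod>j\<in>UNIV - {i}. M x $ j $ p j) = 0"
      by (rule prod_zero[OF finite_Diff[OF finite]]) (use k assms(2) in \<open>auto simp: mat_def intro!: bexI[of _ k]\<close>)
    then show "M' i (p i) h * (\<Prod>j\<in>UNIV - {i}. M x $ j $ p j) = 0" by simp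
  qed
  then have "(\<Sum>p | p permutes (UNIV :: 'd set).
     of_int (sign p) * (\<Sum>i\<in>UNIV. M' i (p i) h * (\<Prod>j\<in>UNIV - {i}. M x $ j $ p j))) =
     (\<Sum>p\<in>{id}. of_int (sign p) * (\<Sum>i\<in>UNIV. M' i (p i) h * (\<Prod>j\<in>UNIV - {i}. M x $ j $ p j)))" for h
    by (intro sum.mono_neutral_right) (auto simp: permutes_id finite_permutations)
  also have "\<dots> h = (\<Sum>i\<in>UNIV. M' i i h)" for h
    using assms(2) by (simp add: mat_def)
  finally show ?thesis using 1 by simp
qed

definition metric_on :: "(real^'d::finite) set \<Rightarrow> (real^'d, 'd) field2 \<Rightarrow> bool" where
  "metric_on S G \<longleftrightarrow> open S \<and> (\<forall>x\<in>S. pos_inner (G x)) \<and> (\<forall>u v. smooth_on S (\<lambda>x. G x u v))"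


lemma FD_linear_field:
  assumes "open S" "x \<in> S" "\<And>y. y \<in> S \<Longrightarrow> linear (a y)" "\<And>v. (\<lambda>y. a y v) differentiable (at x)"
  shows "linear (\<lambda>v. FD (\<lambda>y. a y v) x h)"
proof (rule linearI)
  fix u v c
  have "FD (\<lambda>y. a y (u + v)) x = FD (\<lambda>y. a y u + a y v) x"
    by (rule FD_cong[OF assms(1,2) _ assms(4)]) (use assms(3) linear_add in blast)
  also have "\<dots> = (\<lambda>h. FD (\<lambda>y. a y u) x h + FD (\<lambda>y. a y v) x h)"
    by (rule FD_eq[OF has_derivative_add[OF FD_has FD_has]]) (rule assms)+
  finally show "FD (\<lambda>y. a y (u + v)) x h = FD (\<lambda>y. a y u) x h + FD (\<lambda>y. a y v) x h" by simp
  have "FD (\<lambda>y. a y (c *\<^sub>R v)) x = FD (\<lambda>y. c *\<^sub>R a y v) x"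
    by (rule FD_cong[OF assms(1,2) _ assms(4)]) (use assms(3) linear_cmul in blast)
  also have "\<dots> = (\<lambda>h. c *\<^sub>R FD (\<lambda>y. a y v) x h)"
    by (rule FD_eq[OF has_derivative_scaleR_right[OF FD_has]]) (rule assms)
  finally show "FD (\<lambda>y. a y (c *\<^sub>R v)) x h = c *\<^sub>R FD (\<lambda>y. a y v) x h" by simp
qed

lemma FD_bilinear_field:
  assumes "open S" "x \<in> S" "\<And>y. y \<in> S \<Longrightarrow> bilinear (a y)" "\<And>u v. (\<lambda>y. a y u v) differentiable (at x)"
  shows "bilinear (\<lambda>u v. FD (\<lambda>y. a y u v) x h)"
  unfolding bilinear_def
proof (intro conjI allI)
  show "linear (\<lambda>v. FD (\<lambda>y. a y u v) x h)" for u
    by (rule FD_linear_field[of S x "\<lambda>y. a y u"]) (use assms in \<open>auto simp: bilinear_def\<close>)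
  show "linear (\<lambda>u. FD (\<lambda>y. a y u v) x h)" for v
    by (rule FD_linear_field[of S x "\<lambda>y u. a y u v"]) (use assms in \<open>auto simp: bilinear_def\<close>)
qed

section \<open>Levi-Civita connection, volume density and divergence in coordinates\<close>

context
  fixes S :: "(real^'d::finite) set" and G :: "(real^'d, 'd) field2"
  assumes GS: "metric_on S G"
begin

lemma metric_on_facts:
  shows "open S" "\<And>x. x \<in> S \<Longrightarrow> pos_inner (G x)" "\<And>x. x \<in> S \<Longrightarrow> bilinear (G x)"
    "\<And>x u v. x \<in> S \<Longrightarrow> G x u v = G x v u" "\<And>u v. smooth_on S (\<lambda>x. G x u v)"
    "\<And>x u v. x \<in> S \<Longrightarrow> (\<lambda>y. G y u v) differentiable (at x)"
  using GS smooth_on_differentiable[of S "\<lambda>y. G y u v" for u v] by (auto simp: metric_on_def pos_inner_def)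

lemma metric_FD_sym: "x \<in> S \<Longrightarrow> FD (\<lambda>y. G y u v) x = FD (\<lambda>y. G y v u) x"
  by (rule FD_cong[OF metric_on_facts(1)]) (auto intro: metric_on_facts)

lemma metric_FD_bilinear: "x \<in> S \<Longrightarrow> bilinear (\<lambda>u v. FD (\<lambda>y. G y u v) x h)"
  by (rule FD_bilinear_field[of S]) (auto intro: metric_on_facts)

lemma metric_FD_linear: "x \<in> S \<Longrightarrow> linear (FD (\<lambda>y. G y u v) x)"
  by (rule FD_linear[OF metric_on_facts(6)])

lemma pos_inner_nondegenerate:
  assumes "x \<in> S" "\<And>w. G x z w = G x z' w"
  shows "z = z'"
proof (rule ccontr)
  assume "z \<noteq> z'"
  then have "G x (z - z') (z - z') > 0" using metric_on_facts(2)[OF assms(1)] by (simp add: pos_inner_def)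
  moreover have "G x (z - z') (z - z') = 0"
    using assms(2) by (simp add: bilinear_lsub[OF metric_on_facts(3)[OF assms(1)]])
  ultimately show False by simp
qed

text \<open>This resolves the definite description in \<open>christoffel\<close>: the dual vector of
  half the Koszul expression, which is linear in \<open>w\<close>, is a solution, and nondegeneracy
  makes it the only one.\<close>

lemma christoffel_koszul:
  assumes x: "x \<in> S"
  shows "2 * G x (christoffel G x u v) w =
    FD (\<lambda>y. G y v w) x u + FD (\<lambda>y. G y u w) x v - FD (\<lambda>y. G y u v) x w"
proof -
  define K where "K w = (FD (\<lambda>y. G y v w) x u + FD (\<lambda>y. G y u w) x v - FD (\<lambda>y. G y u v) x w) / 2" for w
  have lin: "linear (\<lambda>w. FD (\<lambda>y. G y v w) x u)" for u v
    using metric_FD_bilinear[OF x, of u] by (simp add: bilinear_def)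
  have "linear K"
    using lin[of v u] lin[of u v] metric_FD_linear[OF x, of u v]
    by (auto simp: K_def linear_iff algebra_simps add_divide_distrib diff_divide_distrib)
  then have s: "G x (sharp (G x) K) w = K w" for w
    by (rule sharp_inner[OF metric_on_facts(2)[OF x] orthonormal_some_frame[OF metric_on_facts(2)[OF x]]])
  have "2 * K w = FD (\<lambda>y. G y v w) x u + FD (\<lambda>y. G y u w) x v - FD (\<lambda>y. G y u v) x w" for w
    by (simp add: K_def)
  then have ex: "\<forall>w. 2 * G x (sharp (G x) K) w =
    FD (\<lambda>y. G y v w) x u + FD (\<lambda>y. G y u w) x v - FD (\<lambda>y. G y u v) x w"
    unfolding s by blast
  have "\<forall>w. 2 * G x (christoffel G x u v) w =
    FD (\<lambda>y. G y v w) x u + FD (\<lambda>y. G y u w) x v - FD (\<lambda>y. G y u v) x w"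
    unfolding christoffel_def
  proof (rule theI[where a="sharp (G x) K"])
    show "\<forall>w. 2 * G x (sharp (G x) K) w =
      FD (\<lambda>y. G y v w) x u + FD (\<lambda>y. G y u w) x v - FD (\<lambda>y. G y u v) x w" by (rule ex)
  next
    fix z assume z: "\<forall>w. 2 * G x z w =
      FD (\<lambda>y. G y v w) x u + FD (\<lambda>y. G y u w) x v - FD (\<lambda>y. G y u v) x w"
    show "z = sharp (G x) K"
    proof (rule pos_inner_nondegenerate[OF x])
      fix w
      have "2 * G x z w = 2 * G x (sharp (G x) K) w" using z ex by simp
      then show "G x z w = G x (sharp (G x) K) w" by simp
    qed
  qed
  then show ?thesis by blast
qed

lemma christoffel_sym:
  assumes x: "x \<in> S"
  shows "christoffel G x u v = christoffel G x v u"
proof (rule pos_inner_nondegenerate[OF x])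
  fix w
  have "2 * G x (christoffel G x u v) w = 2 * G x (christoffel G x v u) w"
    unfolding christoffel_koszul[OF x] metric_FD_sym[OF x, of u v] by simp
  then show "G x (christoffel G x u v) w = G x (christoffel G x v u) w" by simp
qed

lemma metric_compatible:
  assumes x: "x \<in> S"
  shows "FD (\<lambda>y. G y u v) x w = G x (christoffel G x w u) v + G x u (christoffel G x w v)"
  using christoffel_koszul[OF x, of w u v] christoffel_koszul[OF x, of w v u]
    metric_FD_sym[OF x, of w u] metric_FD_sym[OF x, of w v] metric_FD_sym[OF x, of u v]
    metric_on_facts(4)[OF x, of u "christoffel G x w v"]
  by simp

lemma christoffel_bilinear:
  assumes x: "x \<in> S"
  shows "bilinear (christoffel G x)"
proof -
  note b = metric_on_facts(3)[OF x]
  note f = metric_FD_bilinear[OF x] metric_FD_linear[OF x]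
  have 1: "linear (christoffel G x u)" for u
  proof (rule linearI; rule pos_inner_nondegenerate[OF x])
    fix v v' w c
    have "2 * G x (christoffel G x u (v + v')) w = 2 * (G x (christoffel G x u v) w + G x (christoffel G x u v') w)"
      unfolding distrib_left christoffel_koszul[OF x]
      by (simp add: bilinear_ladd[OF f(1)] bilinear_radd[OF f(1)] linear_add[OF f(2)])
    then show "G x (christoffel G x u (v + v')) w = G x (christoffel G x u v + christoffel G x u v') w"
      by (simp add: bilinear_ladd[OF b])
    have "2 * G x (christoffel G x u (c *\<^sub>R v)) w = c * (2 * G x (christoffel G x u v) w)"
      unfolding christoffel_koszul[OF x]
      by (simp add: bilinear_lmul[OF f(1)] bilinear_rmul[OF f(1)] linear_cmul[OF f(2)] algebra_simps)
    then show "G x (christoffel G x u (c *\<^sub>R v)) w = G x (c *\<^sub>R christoffel G x u v) w"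
      by (simp add: bilinear_lmul[OF b])
  qed
  moreover have "linear (\<lambda>u. christoffel G x u v)" for v
    using 1[of v] christoffel_sym[OF x] by (simp add: linear_iff)
  ultimately show ?thesis by (simp add: bilinear_def)
qed

lemma smooth_inverse_entry: "smooth_on S (\<lambda>x. inverse_entry (gram (G x)) k l)"
proof -
  have g: "smooth_on S (\<lambda>x. gram (G x) $ i $ j)" for i j
    unfolding gram_def by (simp add: metric_on_facts(5))
  have "det (gram (G x)) \<noteq> 0" if "x \<in> S" for x
    using det_gram_pos[OF metric_on_facts(2)[OF that] orthonormal_some_frame[OF metric_on_facts(2)[OF that]]] by simp
  moreover have "smooth_on S (\<lambda>x. (\<chi> i j. if j = k then axis l 1 $ i else gram (G x) $ i $ j) $ i $ j)" for i j
    by (cases "j = k") (simp_all add: smooth_on_const g)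
  ultimately show ?thesis
    unfolding inverse_entry_def
    by (intro smooth_on_divide smooth_on_det metric_on_facts(1) g) auto
qed

lemma smooth_metric_trace:
  assumes "\<And>u v. smooth_on S (\<lambda>x. b x u v)"
  shows "smooth_on S (\<lambda>x. metric_trace (G x) (b x))"
  unfolding metric_trace_def
  by (intro smooth_on_sum smooth_on_mult smooth_inverse_entry assms metric_on_facts(1))

lemma smooth_sharp:
  assumes "\<And>u. smooth_on S (\<lambda>x. b x u)"
  shows "smooth_on S (\<lambda>x. sharp (G x) (b x))"
  unfolding sharp_def
  by (intro smooth_on_sum smooth_on_scaleR smooth_on_mult smooth_inverse_entry smooth_on_const assms metric_on_facts(1))

lemma sqrt_det_pos: "x \<in> S \<Longrightarrow> det (gram (G x)) > 0"
  using det_gram_pos orthonormal_some_frame metric_on_facts(2) by blast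

lemma smooth_sqrt_det: "smooth_on S (\<lambda>x. sqrt (det (gram (G x))))"
  by (intro smooth_on_sqrt smooth_on_det metric_on_facts(1) sqrt_det_pos)
    (simp_all add: gram_def metric_on_facts(5))

text \<open>Jacobi's formula. Conjugating with the frame matrix at \<open>x\<close> brings the Gram
  matrix to the identity there, where the derivative of the determinant is the trace; the constant
  factor \<open>(det E)^2\<close> is the reciprocal of the determinant at \<open>x\<close>.\<close>

lemma det_gram_has_derivative:
  assumes x: "x \<in> S" and e: "orthonormal_frame (G x) e"
  shows "((\<lambda>y. det (gram (G y))) has_derivative
    (\<lambda>h. det (gram (G x)) * (\<Sum>i\<in>UNIV. FD (\<lambda>y. G y (e i) (e i)) x h))) (at x)"
proof -
  define E where "E = ((\<chi> k i. e i $ k) :: real^'d^'d)"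
  note P = metric_on_facts(2)[OF x]
  have M: "(transpose E ** gram (G y) ** E) $ i $ j = G y (e i) (e j)" if "y \<in> S" for y i j
  proof -
    have "(transpose E ** gram (G y) ** E) $ i $ j = (\<Sum>l\<in>UNIV. (\<Sum>k\<in>UNIV. e i $ k * G y (axis k 1) (axis l 1)) * e j $ l)"
      by (simp add: matrix_matrix_mult_def transpose_def E_def gram_def)
    also have "\<dots> = (\<Sum>k\<in>UNIV. \<Sum>l\<in>UNIV. e i $ k * e j $ l * G y (axis k 1) (axis l 1))"
      by (rule sum_product_swap)
    also have "\<dots> = G y (e i) (e j)"
      by (rule bilinear_axis_sum[OF metric_on_facts(3)[OF that], symmetric])
    finally show ?thesis .
  qed
  have "((\<lambda>y. det (transpose E ** gram (G y) ** E)) has_derivative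
    (\<lambda>h. \<Sum>i\<in>UNIV. FD (\<lambda>y. G y (e i) (e i)) x h)) (at x)"
  proof (rule det_has_derivative_at_mat_1[where M'="\<lambda>i j. FD (\<lambda>y. G y (e i) (e j)) x"])
    show "transpose E ** gram (G x) ** E = mat 1" using frame_matrix[OF P e] by (simp add: E_def)
    show "((\<lambda>y. (transpose E ** gram (G y) ** E) $ i $ j) has_derivative FD (\<lambda>y. G y (e i) (e j)) x) (at x)" for i j
      by (rule has_derivative_transform_within_open[OF FD_has[OF metric_on_facts(6)[OF x]] metric_on_facts(1) x])
        (simp add: M)
  qed
  from has_derivative_mult_right[OF this, of "det (gram (G x))"]
  have 1: "((\<lambda>y. det (gram (G x)) * det (transpose E ** gram (G y) ** E)) has_derivative
    (\<lambda>h. det (gram (G x)) * (\<Sum>i\<in>UNIV. FD (\<lambda>y. G y (e i) (e i)) x h))) (at x)" .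
  have "det (gram (G x)) * det (transpose E ** M ** E) = det M" for M
    using det_frame[OF P e] by (simp add: det_mul det_transpose E_def power2_eq_square mult_ac)
  then show ?thesis using 1 by simp
qed

text \<open>The classical fact that the Euclidean divergence of \<open>sqrt(det g) X\<close> is
  \<open>sqrt(det g)\<close> times the covariant divergence of \<open>X\<close>. The derivative of
  the density along \<open>X\<close> accounts for the trace of the Christoffel term.\<close>

lemma divergence_covariant:
  assumes x: "x \<in> S" and e: "orthonormal_frame (G x) e" and X: "(X has_derivative X') (at x)"
  shows "((\<lambda>y. sqrt (det (gram (G y))) *\<^sub>R X y) has_derivative
      FD (\<lambda>y. sqrt (det (gram (G y))) *\<^sub>R X y) x) (at x)"
    and "(\<Sum>k\<in>UNIV. FD (\<lambda>y. sqrt (det (gram (G y))) *\<^sub>R X y) x (axis k 1) $ k) =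
      sqrt (det (gram (G x))) * (\<Sum>i\<in>UNIV. G x (X' (e i) + christoffel G x (e i) (X x)) (e i))"
proof -
  note P = metric_on_facts(2)[OF x]
  define r where "r = sqrt (det (gram (G x)))"
  define D where "D h = (\<Sum>i\<in>UNIV. FD (\<lambda>y. G y (e i) (e i)) x h)" for h
  have r: "r > 0" "det (gram (G x)) = r * r" using sqrt_det_pos[OF x] by (simp_all add: r_def)
  have "((\<lambda>y. sqrt (det (gram (G y)))) has_derivative (\<lambda>h. det (gram (G x)) * D h * (inverse r / 2))) (at x)"
    unfolding r_def D_def
    by (rule DERIV_compose_FDERIV[OF DERIV_real_sqrt[OF sqrt_det_pos[OF x]] det_gram_has_derivative[OF x e]])
  then have "((\<lambda>y. sqrt (det (gram (G y)))) has_derivative (\<lambda>h. r * D h / 2)) (at x)"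
    using r by (simp add: field_simps)
  from has_derivative_scaleR[OF this X]
  have d: "((\<lambda>y. sqrt (det (gram (G y))) *\<^sub>R X y) has_derivative (\<lambda>h. r *\<^sub>R X' h + (r * D h / 2) *\<^sub>R X x)) (at x)"
    by (simp add: r_def)
  note FD = FD_eq[OF d]
  show "((\<lambda>y. sqrt (det (gram (G y))) *\<^sub>R X y) has_derivative
      FD (\<lambda>y. sqrt (det (gram (G y))) *\<^sub>R X y) x) (at x)" using d FD by simp
  have linD: "linear D"
    unfolding D_def[abs_def] using metric_FD_linear[OF x] by (intro linear_compose_sum) auto
  have linX: "linear X'" using X has_derivative_linear by blast
  have "(\<Sum>k\<in>UNIV. FD (\<lambda>y. sqrt (det (gram (G y))) *\<^sub>R X y) x (axis k 1) $ k) =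
    r * ((\<Sum>k\<in>UNIV. X' (axis k 1) $ k) + (\<Sum>k\<in>UNIV. X x $ k * D (axis k 1)) / 2)"
    unfolding FD by (simp add: sum.distrib sum_distrib_left sum_divide_distrib algebra_simps)
  also have "(\<Sum>k\<in>UNIV. X x $ k * D (axis k 1)) = D (X x)"
    using linear_axis_sum[OF linD, of "X x"] by simp
  also have "(\<Sum>k\<in>UNIV. X' (axis k 1) $ k) = (\<Sum>i\<in>UNIV. G x (X' (e i)) (e i))"
    by (rule trace_frame[OF P e linX])
  also have "D (X x) / 2 = (\<Sum>i\<in>UNIV. G x (christoffel G x (e i) (X x)) (e i))"
  proof -
    \<comment> \<open>With the same vector in the first and last slot, two of the three Koszul terms
      cancel.\<close>
    have "FD (\<lambda>y. G y (e i) (e i)) x (X x) / 2 = G x (christoffel G x (e i) (X x)) (e i)" for i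
      using christoffel_koszul[OF x, of "e i" "X x" "e i"] metric_FD_sym[OF x, of "X x" "e i"] by simp
    then show ?thesis by (simp add: D_def sum_divide_distrib)
  qed
  finally show "(\<Sum>k\<in>UNIV. FD (\<lambda>y. sqrt (det (gram (G y))) *\<^sub>R X y) x (axis k 1) $ k) =
      sqrt (det (gram (G x))) * (\<Sum>i\<in>UNIV. G x (X' (e i) + christoffel G x (e i) (X x)) (e i))"
    unfolding bilinear_ladd[OF metric_on_facts(3)[OF x]] r_def[symmetric] sum.distrib .
qed

text \<open>Lowering an index commutes with covariant differentiation, by metric compatibility: the
  right side is the covariant derivative of the 1-form \<open>b\<close>, the left side that of its
  dual field \<open>Z\<close>.\<close>

lemma inner_sharp_covariant:
  assumes x: "x \<in> S" and b: "\<And>y. y \<in> S \<Longrightarrow> linear (b y)" "\<And>u. smooth_on S (\<lambda>y. b y u)"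
    and Z: "(Z has_derivative Z') (at x)" "\<And>y u. y \<in> S \<Longrightarrow> G y (Z y) u = b y u"
  shows "G x (Z' h + christoffel G x h (Z x)) w = FD (\<lambda>y. b y w) x h - b x (christoffel G x h w)"
proof -
  have "((\<lambda>y. G y (Z y) w) has_derivative (\<lambda>h. FD (\<lambda>y. G y (Z x) w) x h + G x (Z' h) w)) (at x)"
    by (rule has_derivative_linear_field[of S x "\<lambda>y u. G y u w", OF metric_on_facts(1) x _ _ Z(1)])
      (use metric_on_facts(3,6) x in \<open>auto simp: bilinear_def\<close>)
  then have "((\<lambda>y. b y w) has_derivative (\<lambda>h. FD (\<lambda>y. G y (Z x) w) x h + G x (Z' h) w)) (at x)"
    by (rule has_derivative_transform_within_open[OF _ metric_on_facts(1) x]) (rule Z(2))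
  then have "FD (\<lambda>y. b y w) x h = FD (\<lambda>y. G y (Z x) w) x h + G x (Z' h) w"
    by (simp add: FD_eq)
  then show ?thesis
    using metric_compatible[OF x, of "Z x" w h] Z(2)[OF x, of "christoffel G x h w"]
    by (simp add: bilinear_ladd[OF metric_on_facts(3)[OF x]])
qed

lemma cov_deriv2_trilinear:
  assumes x: "x \<in> S" and a: "\<And>y. y \<in> S \<Longrightarrow> bilinear (a y)" "\<And>u v. smooth_on S (\<lambda>y. a y u v)"
  shows "bilinear (\<lambda>w u. cov_deriv2 G a x w u v)" "linear (cov_deriv2 G a x w u)"
proof -
  note ba = a(1)[OF x] and cb = christoffel_bilinear[OF x]
  have d: "(\<lambda>y. a y u v) differentiable (at x)" for u v
    by (rule smooth_on_differentiable[OF a(2) x])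
  have f: "bilinear (\<lambda>u v. FD (\<lambda>y. a y u v) x h)" for h
    by (rule FD_bilinear_field[OF metric_on_facts(1) x a(1) d])
  note fl = FD_linear[OF d]
  note ss = bilinear_ladd[OF f] bilinear_radd[OF f] bilinear_lmul[OF f] bilinear_rmul[OF f]
    bilinear_ladd[OF ba] bilinear_radd[OF ba] bilinear_lmul[OF ba] bilinear_rmul[OF ba]
    bilinear_ladd[OF cb] bilinear_radd[OF cb] bilinear_lmul[OF cb] bilinear_rmul[OF cb]
    linear_add[OF fl] linear_cmul[OF fl]
  show "linear (cov_deriv2 G a x w u)"
    by (rule linearI) (simp_all add: cov_deriv2_def ss algebra_simps)
  show "bilinear (\<lambda>w u. cov_deriv2 G a x w u v)"
    unfolding bilinear_def by (intro conjI allI linearI) (simp_all add: cov_deriv2_def ss algebra_simps)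
qed

text \<open>For the dual vector field \<open>Z\<close> of \<open>b\<close>, the vector field \<open>X\<close> with
  \<open>G(X, w) = a(w, Z)\<close> has divergence \<open>\<langle>a, db\<rangle> - \<langle>\<delta>a, b\<rangle>\<close>.\<close>

lemma divergence_identity:
  assumes x: "x \<in> S" and e: "orthonormal_frame (G x) e"
    and a: "\<And>y. y \<in> S \<Longrightarrow> bilinear (a y)" "\<And>u v. smooth_on S (\<lambda>y. a y u v)"
      "\<And>y u v. y \<in> S \<Longrightarrow> a y u v = - a y v u"
    and b: "\<And>y. y \<in> S \<Longrightarrow> linear (b y)" "\<And>u. smooth_on S (\<lambda>y. b y u)"
  defines "X \<equiv> \<lambda>y. sharp (G y) (\<lambda>w. a y w (sharp (G y) (b y)))"
  shows "smooth_on S (\<lambda>y. sqrt (det (gram (G y))) *\<^sub>R X y)"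
    and "(\<Sum>k\<in>UNIV. FD (\<lambda>y. sqrt (det (gram (G y))) *\<^sub>R X y) x (axis k 1) $ k) =
      sqrt (det (gram (G x))) *
       (1 / 2 * (\<Sum>i\<in>UNIV. \<Sum>j\<in>UNIV. a x (e i) (e j) * ext_d1_eucl b x (e i) (e j))
        - (\<Sum>j\<in>UNIV. - (\<Sum>i\<in>UNIV. cov_deriv2 G a x (e i) (e i) (e j)) * b x (e j)))"
proof -
  note P = metric_on_facts(2) and O = metric_on_facts(1)
  note shp = sharp_inner[OF P orthonormal_some_frame[OF P]]
  define Z where "Z = (\<lambda>y. sharp (G y) (b y))"
  define c where "c = (\<lambda>y w. a y w (Z y))"
  have Z: "smooth_on S Z" unfolding Z_def by (rule smooth_sharp[OF b(2)])
  have Zb: "G y (Z y) u = b y u" if "y \<in> S" for y u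
    unfolding Z_def by (rule shp[OF that that b(1)[OF that]])
  have c: "linear (c y)" if "y \<in> S" for y
    using a(1)[OF that] by (simp add: c_def bilinear_def)
  have cs: "smooth_on S (\<lambda>y. c y w)" for w
    unfolding c_def by (rule smooth_on_bilinear_field[OF O a(1) a(2) smooth_on_const Z])
  have X: "X = (\<lambda>y. sharp (G y) (c y))" by (simp add: X_def c_def Z_def)
  have Xs: "smooth_on S X" unfolding X by (rule smooth_sharp[OF cs])
  have Xc: "G y (X y) u = c y u" if "y \<in> S" for y u
    unfolding X by (rule shp[OF that that c[OF that]])
  show "smooth_on S (\<lambda>y. sqrt (det (gram (G y))) *\<^sub>R X y)"
    by (rule smooth_on_scaleR[OF O smooth_sqrt_det Xs])
  note dZ = FD_has[OF smooth_on_differentiable[OF Z x]] and dX = FD_has[OF smooth_on_differentiable[OF Xs x]]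
  define N where "N h = FD Z x h + christoffel G x h (Z x)" for h
  have NZ: "G x (N h) w = FD (\<lambda>y. b y w) x h - b x (christoffel G x h w)" for h w
    unfolding N_def by (rule inner_sharp_covariant[OF x b dZ Zb])
  have dc: "FD (\<lambda>y. c y w) x h = FD (\<lambda>y. a y w (Z x)) x h + a x w (FD Z x h)" for w h
  proof -
    have "((\<lambda>y. a y w (Z y)) has_derivative (\<lambda>h. FD (\<lambda>y. a y w (Z x)) x h + a x w (FD Z x h))) (at x)"
      by (rule has_derivative_linear_field[of S x "\<lambda>y. a y w", OF O x _ _ dZ])
        (use a(1) smooth_on_differentiable[OF a(2) x] in \<open>auto simp: bilinear_def\<close>)
    then show ?thesis unfolding c_def by (simp add: FD_eq)
  qed
  \<comment> \<open>Product rule for the covariant derivative of the 1-form \<open>a(w, Z)\<close>: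
    one term differentiates \<open>a\<close>, the other contains \<open>N\<close>, the covariant
    derivative of \<open>Z\<close>.\<close>
  have NX: "G x (FD X x h + christoffel G x h (X x)) w = cov_deriv2 G a x h w (Z x) + a x w (N h)" for h w
    using inner_sharp_covariant[OF x c cs dX Xc, of h w]
    unfolding dc by (simp add: cov_deriv2_def N_def c_def bilinear_radd[OF a(1)[OF x]])
  \<comment> \<open>An antisymmetric \<open>a\<close> pairs only with the antisymmetric part of the
    covariant derivative of \<open>b\<close>, whence the factor 1/2. Since the connection has no
    torsion, antisymmetrizing that derivative gives the exterior derivative.\<close>
  have "(\<Sum>i\<in>UNIV. a x (e i) (N (e i))) =
      1 / 2 * (\<Sum>i\<in>UNIV. \<Sum>j\<in>UNIV. a x (e i) (e j) * ext_d1_eucl b x (e i) (e j))"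
  proof -
    define t where "t i j = G x (N (e i)) (e j)" for i j
    have "a x (e i) (N (e i)) = (\<Sum>j\<in>UNIV. a x (e i) (e j) * t i j)" for i
      using linear_frame_sum[OF P[OF x] e, of "a x (e i)" "N (e i)"] a(1)[OF x]
      by (simp add: bilinear_def t_def mult.commute)
    then have A: "(\<Sum>i\<in>UNIV. a x (e i) (N (e i))) = (\<Sum>i\<in>UNIV. \<Sum>j\<in>UNIV. a x (e i) (e j) * t i j)" by simp
    have B: "(\<Sum>i\<in>UNIV. \<Sum>j\<in>UNIV. a x (e i) (e j) * t i j) = - (\<Sum>i\<in>UNIV. \<Sum>j\<in>UNIV. a x (e i) (e j) * t j i)"
    proof -
      have "(\<Sum>i\<in>UNIV. \<Sum>j\<in>UNIV. a x (e i) (e j) * t i j) = (\<Sum>j\<in>UNIV. \<Sum>i\<in>UNIV. a x (e i) (e j) * t i j)"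
        by (rule sum.swap)
      also have "\<dots> = (\<Sum>j\<in>UNIV. \<Sum>i\<in>UNIV. - (a x (e j) (e i) * t i j))"
        using a(3)[OF x] by (intro sum.cong refl) (metis mult_minus_left)
      finally show ?thesis by (simp add: sum_negf)
    qed
    have C: "t i j - t j i = ext_d1_eucl b x (e i) (e j)" for i j
      unfolding t_def NZ ext_d1_eucl_def christoffel_sym[OF x, of "e i" "e j"] by simp
    have "(\<Sum>i\<in>UNIV. \<Sum>j\<in>UNIV. a x (e i) (e j) * ext_d1_eucl b x (e i) (e j)) =
      (\<Sum>i\<in>UNIV. \<Sum>j\<in>UNIV. a x (e i) (e j) * t i j) - (\<Sum>i\<in>UNIV. \<Sum>j\<in>UNIV. a x (e i) (e j) * t j i)"
      unfolding C[symmetric] by (simp add: right_diff_distrib sum_subtractf)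
    then show ?thesis using A B by simp
  qed
  moreover have "(\<Sum>i\<in>UNIV. cov_deriv2 G a x (e i) (e i) (Z x)) =
     (\<Sum>j\<in>UNIV. (\<Sum>i\<in>UNIV. cov_deriv2 G a x (e i) (e i) (e j)) * b x (e j))"
  proof -
    have "cov_deriv2 G a x (e i) (e i) (Z x) = (\<Sum>j\<in>UNIV. cov_deriv2 G a x (e i) (e i) (e j) * b x (e j))" for i
      using linear_frame_sum[OF P[OF x] e cov_deriv2_trilinear(2)[OF x a(1,2), of "e i" "e i"], of "Z x"] Zb[OF x]
      by (simp add: mult.commute)
    then have "(\<Sum>i\<in>UNIV. cov_deriv2 G a x (e i) (e i) (Z x)) =
      (\<Sum>i\<in>UNIV. \<Sum>j\<in>UNIV. cov_deriv2 G a x (e i) (e i) (e j) * b x (e j))" by simp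
    also have "\<dots> = (\<Sum>j\<in>UNIV. \<Sum>i\<in>UNIV. cov_deriv2 G a x (e i) (e i) (e j) * b x (e j))" by (rule sum.swap)
    finally show ?thesis by (simp add: sum_distrib_right)
  qed
  ultimately show "(\<Sum>k\<in>UNIV. FD (\<lambda>y. sqrt (det (gram (G y))) *\<^sub>R X y) x (axis k 1) $ k) =
      sqrt (det (gram (G x))) *
       (1 / 2 * (\<Sum>i\<in>UNIV. \<Sum>j\<in>UNIV. a x (e i) (e j) * ext_d1_eucl b x (e i) (e j))
        - (\<Sum>j\<in>UNIV. - (\<Sum>i\<in>UNIV. cov_deriv2 G a x (e i) (e i) (e j)) * b x (e j)))"
    unfolding divergence_covariant(2)[OF x e dX] NX sum.distrib by (simp add: sum_negf)
qed

end

section \<open>Naturality of the Levi-Civita connection\<close>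

context
  fixes S T :: "(real^'d::finite) set" and G H :: "(real^'d, 'd) field2" and F :: "real^'d \<Rightarrow> real^'d"
  assumes GS: "metric_on S G" and HT: "metric_on T H" and F: "smooth_on S F" "F ` S \<subseteq> T"
    and surj: "\<And>x. x \<in> S \<Longrightarrow> surj (FD F x)"
    and GH: "\<And>x u v. x \<in> S \<Longrightarrow> G x u v = H (F x) (FD F x u) (FD F x v)"
begin

lemma pullback_FD:
  fixes a a' :: "(real^'d, 'd) field2"
  assumes x: "x \<in> S" and a: "\<And>y. y \<in> T \<Longrightarrow> bilinear (a y)" "\<And>u v. smooth_on T (\<lambda>y. a y u v)"
    and a': "\<And>y u v. y \<in> S \<Longrightarrow> a' y u v = a (F y) (FD F y u) (FD F y v)"
  shows "FD (\<lambda>y. a' y u v) x w = FD (\<lambda>z. a z (FD F x u) (FD F x v)) (F x) (FD F x w)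
    + a (F x) (FD (\<lambda>y. FD F y u) x w) (FD F x v) + a (F x) (FD F x u) (FD (\<lambda>y. FD F y v) x w)"
proof -
  note O = metric_on_facts(1)[OF GS] metric_on_facts(1)[OF HT]
  have "FD (\<lambda>y. a (F y) (FD F y u) (FD F y v)) x = FD (\<lambda>y. a' y u v) x"
    by (rule FD_cong[OF O(1) x]) (use a' smooth_on_differentiable[OF smooth_on_pullback2[OF O F(2,1) a] x] in auto)
  then show ?thesis using FD_pullback2[OF O F(2,1) a x, of u v w] by simp
qed

text \<open>Transformation law of the Christoffel symbols, with the second derivative of
  \<open>F\<close> as inhomogeneous term. Testing against vectors \<open>FD F x w\<close> suffices
  because \<open>FD F x\<close> is surjective and \<open>H\<close> nondegenerate; the two Koszul
  formulas then differ only by second derivatives of \<open>F\<close>.\<close>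

lemma christoffel_natural:
  assumes x: "x \<in> S"
  shows "FD F x (christoffel G x u v) =
    christoffel H (F x) (FD F x u) (FD F x v) + FD (\<lambda>y. FD F y v) x u"
proof -
  have Fx: "F x \<in> T" using x F by auto
  show ?thesis
  proof (rule pos_inner_nondegenerate[OF HT Fx])
    fix w'
    obtain w where w': "w' = FD F x w" using surj[OF x] by auto
    have p: "FD (\<lambda>y. G y u v) x w = FD (\<lambda>z. H z (FD F x u) (FD F x v)) (F x) (FD F x w)
      + H (F x) (FD (\<lambda>y. FD F y u) x w) (FD F x v) + H (F x) (FD F x u) (FD (\<lambda>y. FD F y v) x w)" for u v w
      by (rule pullback_FD[OF x metric_on_facts(3,5)[OF HT] GH])
    note c = FD_commute[OF metric_on_facts(1)[OF GS] x F(1)]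
    note s = metric_on_facts(4)[OF HT Fx]
    have "2 * H (F x) (FD F x (christoffel G x u v)) w' = 2 * G x (christoffel G x u v) w"
      by (simp add: w' GH[OF x])
    also have "\<dots> = 2 * (H (F x) (christoffel H (F x) (FD F x u) (FD F x v)) w' + H (F x) (FD (\<lambda>y. FD F y v) x u) w')"
      unfolding distrib_left christoffel_koszul[OF GS x] christoffel_koszul[OF HT Fx] p w'
      using c[of u v] c[of u w] c[of v w] s[of "FD F x v" "FD (\<lambda>y. FD F y w) x u"]
        s[of "FD F x u" "FD (\<lambda>y. FD F y w) x v"] by simp
    finally show "H (F x) (FD F x (christoffel G x u v)) w' =
      H (F x) (christoffel H (F x) (FD F x u) (FD F x v) + FD (\<lambda>y. FD F y v) x u) w'"
      by (simp add: bilinear_ladd[OF metric_on_facts(3)[OF HT Fx]])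
  qed
qed

text \<open>The second derivatives of \<open>F\<close> that arise from differentiating the pullback
  are exactly those in the transformation law of the Christoffel symbols, and they cancel.\<close>

lemma cov_deriv2_natural:
  assumes x: "x \<in> S" and a: "\<And>y. y \<in> T \<Longrightarrow> bilinear (a y)" "\<And>u v. smooth_on T (\<lambda>y. a y u v)"
    and a': "\<And>y u v. y \<in> S \<Longrightarrow> a' y u v = a (F y) (FD F y u) (FD F y v)"
  shows "cov_deriv2 G a' x w u v = cov_deriv2 H a (F x) (FD F x w) (FD F x u) (FD F x v)"
proof -
  have Fx: "F x \<in> T" using x F by auto
  have p: "FD (\<lambda>y. a' y u v) x w = FD (\<lambda>z. a z (FD F x u) (FD F x v)) (F x) (FD F x w)
    + a (F x) (FD (\<lambda>y. FD F y u) x w) (FD F x v) + a (F x) (FD F x u) (FD (\<lambda>y. FD F y v) x w)"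
    by (rule pullback_FD[OF x a a'])
  show ?thesis
    unfolding cov_deriv2_def p a'[OF x] christoffel_natural[OF x]
    by (simp add: bilinear_ladd[OF a(1)[OF Fx]] bilinear_radd[OF a(1)[OF Fx]])
qed

end

lemma smooth_christoffel:
  assumes "metric_on S G"
  shows "smooth_on S (\<lambda>x. christoffel G x u v)"
proof -
  define K where "K x w = (FD (\<lambda>y. G y v w) x u + FD (\<lambda>y. G y u w) x v - FD (\<lambda>y. G y u v) x w) / 2" for x w
  note m = metric_on_facts[OF assms]
  have "christoffel G x u v = sharp (G x) (K x)" if x: "x \<in> S" for x
  proof (rule pos_inner_nondegenerate[OF assms x])
    fix w
    have K: "K x w = G x (christoffel G x u v) w" for w
      using christoffel_koszul[OF assms x, of u v w] by (simp add: K_def)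
    have "linear (\<lambda>w. G x (christoffel G x u v) w)" using m(3)[OF x] by (simp add: bilinear_def)
    then have "linear (K x)" using K by (simp add: linear_iff)
    then show "G x (christoffel G x u v) w = G x (sharp (G x) (K x)) w"
      using sharp_inner[OF m(2)[OF x] orthonormal_some_frame[OF m(2)[OF x]]] K by simp
  qed
  moreover have "smooth_on S (\<lambda>x. K x w)" for w
  proof -
    have "smooth_on S (\<lambda>x. FD (\<lambda>y. G y v w) x u + FD (\<lambda>y. G y u w) x v - FD (\<lambda>y. G y u v) x w)"
      by (rule smooth_on_diff[OF m(1) smooth_on_add[OF m(1) smooth_on_FD[OF m(5)] smooth_on_FD[OF m(5)]] smooth_on_FD[OF m(5)]])
    then show ?thesis unfolding K_def by (rule smooth_on_bounded_linear[OF bounded_linear_divide m(1)])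
  qed
  then have "smooth_on S (\<lambda>x. sharp (G x) (K x))" by (rule smooth_sharp[OF assms])
  ultimately show ?thesis
    by (intro smooth_on_cong[OF m(1), of "\<lambda>x. sharp (G x) (K x)" "\<lambda>x. christoffel G x u v"]) auto
qed

lemma smooth_cov_deriv2:
  assumes "metric_on S G" "\<And>y. y \<in> S \<Longrightarrow> bilinear (a y)" "\<And>u v. smooth_on S (\<lambda>y. a y u v)"
  shows "smooth_on S (\<lambda>x. cov_deriv2 G a x w u v)"
proof -
  note o = metric_on_facts(1)[OF assms(1)]
  have 1: "smooth_on S (\<lambda>x. a x (christoffel G x w u) v)"
    by (rule smooth_on_bilinear_field[of S a "\<lambda>x. christoffel G x w u" "\<lambda>_. v",
          OF o assms(2,3) smooth_christoffel[OF assms(1)] smooth_on_const])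
  have 2: "smooth_on S (\<lambda>x. a x u (christoffel G x w v))"
    by (rule smooth_on_bilinear_field[of S a "\<lambda>_. u" "\<lambda>x. christoffel G x w v",
          OF o assms(2,3) smooth_on_const smooth_christoffel[OF assms(1)]])
  show ?thesis
    unfolding cov_deriv2_def
    by (rule smooth_on_diff[OF o smooth_on_diff[OF o smooth_on_FD[OF assms(3)] 1] 2])
qed

lemma FD_local_compose:
  assumes "open S" "x \<in> S" "\<And>y. y \<in> S \<Longrightarrow> k y = g (f y)" "f differentiable (at x)" "g differentiable (at (f x))"
  shows "FD k x v = FD g (f x) (FD f x v)"
proof -
  have 1: "((\<lambda>y. g (f y)) has_derivative (\<lambda>v. FD g (f x) (FD f x v))) (at x)"
    by (rule has_derivative_compose[OF FD_has FD_has]) (rule assms)+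
  have "FD (\<lambda>y. g (f y)) x = FD k x"
    by (rule FD_cong[OF assms(1,2)]) (use assms(3) 1 differentiableI in auto)
  then show ?thesis using FD_eq[OF 1] by metis
qed

section \<open>Charts and tangent vectors\<close>

lemma is_chart_facts:
  fixes c :: "('m::t2_space, 'd::finite) chart"
  assumes "is_chart c"
  shows "open (dom_c c)" "open (img_c c)" "\<And>p. p \<in> dom_c c \<Longrightarrow> inv_c c (snd c p) = p"
    "\<And>x. x \<in> img_c c \<Longrightarrow> inv_c c x \<in> dom_c c" "\<And>x. x \<in> img_c c \<Longrightarrow> snd c (inv_c c x) = x"
    "continuous_on (dom_c c) (snd c)" "continuous_on (img_c c) (inv_c c)"
    "\<And>U. open U \<Longrightarrow> open (snd c ` (dom_c c \<inter> U))"
    "\<And>p. p \<in> dom_c c \<Longrightarrow> snd c p \<in> img_c c"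
proof -
  have h: "homeomorphism (dom_c c) (img_c c) (snd c) (inv_c c)" using assms by (simp add: is_chart_def)
  show o: "open (dom_c c)" "open (img_c c)" using assms by (auto simp: is_chart_def)
  show "p \<in> dom_c c \<Longrightarrow> inv_c c (snd c p) = p" for p using h by (simp add: homeomorphism_def)
  show "x \<in> img_c c \<Longrightarrow> inv_c c x \<in> dom_c c" for x by (rule inv_into_into)
  show "x \<in> img_c c \<Longrightarrow> snd c (inv_c c x) = x" for x by (rule f_inv_into_f)
  show "continuous_on (dom_c c) (snd c)" "continuous_on (img_c c) (inv_c c)"
    using h by (auto simp: homeomorphism_def)
  show "p \<in> dom_c c \<Longrightarrow> snd c p \<in> img_c c" for p by simp
  show "open (snd c ` (dom_c c \<inter> U))" if "open U" for U
  proof -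
    have "openin (top_of_set (dom_c c)) (dom_c c \<inter> U)" using that by auto
    from homeomorphism_imp_open_map[OF h this] show ?thesis
      using o openin_open_trans by blast
  qed
qed

abbreviation overlap :: "('m, 'd) chart \<Rightarrow> ('m, 'd) chart \<Rightarrow> (real^'d) set" where
  "overlap c d \<equiv> snd c ` (dom_c c \<inter> dom_c d)"

lemma transition_facts:
  fixes c d :: "('m::t2_space, 'd::finite) chart"
  assumes "is_chart c" "is_chart d" "compatible c d"
  shows "open (overlap c d)" "smooth_on (overlap c d) (transition c d)"
    "\<And>x. x \<in> overlap c d \<Longrightarrow> transition c d x = snd d (inv_c c x)"
    "transition c d ` overlap c d = overlap d c"
    "\<And>x. x \<in> overlap c d \<Longrightarrow> transition d c (transition c d x) = x"
    "\<And>x. x \<in> overlap c d \<Longrightarrow> inv_c d (transition c d x) = inv_c c x"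
    "\<And>p. p \<in> dom_c c \<Longrightarrow> p \<in> dom_c d \<Longrightarrow> transition c d (snd c p) = snd d p"
    "\<And>x. x \<in> overlap c d \<longleftrightarrow> x \<in> img_c c \<and> inv_c c x \<in> dom_c d"
proof -
  note C = is_chart_facts[OF assms(1)] and D = is_chart_facts[OF assms(2)]
  show "open (overlap c d)" by (rule C(8)[OF D(1)])
  show "smooth_on (overlap c d) (transition c d)" using assms by (simp add: compatible_def)
  show "transition c d x = snd d (inv_c c x)" for x by (simp add: transition_def)
  show t: "p \<in> dom_c c \<Longrightarrow> p \<in> dom_c d \<Longrightarrow> transition c d (snd c p) = snd d p" for p
    using C(3) by (simp add: transition_def)
  show "transition c d ` overlap c d = overlap d c" using t by (force simp: image_iff)
  show "x \<in> overlap c d \<Longrightarrow> transition d c (transition c d x) = x" for x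
    using t D(3) by (auto simp: transition_def C(3))
  show "x \<in> overlap c d \<Longrightarrow> inv_c d (transition c d x) = inv_c c x" for x
    using D(3) by (auto simp: transition_def C(3))
  show "x \<in> overlap c d \<longleftrightarrow> x \<in> img_c c \<and> inv_c c x \<in> dom_c d" for x
    using C(3,4,5) by (auto simp: image_iff)
qed

lemma compatible_sym: "compatible c d \<Longrightarrow> compatible d c"
  by (simp add: compatible_def Int_commute)

lemma FD_transition_inverse:
  assumes "is_chart c" "is_chart d" "compatible c d" "x \<in> overlap c d"
  shows "FD (transition d c) (transition c d x) (FD (transition c d) x u) = u"
proof -
  note t = transition_facts[OF assms(1-3)] and t' = transition_facts[OF assms(2,1) compatible_sym[OF assms(3)]]
  have "transition c d x \<in> overlap d c" using t(4) assms(4) by blast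
  then have "FD (\<lambda>y. y) x u = FD (transition d c) (transition c d x) (FD (transition c d) x u)"
    by (intro FD_local_compose[OF t(1) assms(4)] smooth_on_differentiable[OF t(2) assms(4)]
        smooth_on_differentiable[OF t'(2)]) (use t(5) in auto)
  then show ?thesis by simp
qed

text \<open>Admits charts outside the atlas, as long as they are compatible with it. The charts in
  which a complex structure is constant are of this kind.\<close>

definition adapted_chart :: "('m::t2_space, 'd::finite) chart set \<Rightarrow> ('m, 'd) chart \<Rightarrow> bool" where
  "adapted_chart A c \<longleftrightarrow> is_chart c \<and> (\<forall>d\<in>A. compatible c d)"

context
  fixes A :: "('m::t2_space, 'd::finite) chart set"
  assumes A: "smooth_atlas A"
begin

lemma atlas_facts:
  shows "\<And>c. c \<in> A \<Longrightarrow> is_chart c" "\<And>c. c \<in> A \<Longrightarrow> adapted_chart A c" "\<And>p. \<exists>c\<in>A. p \<in> dom_c c"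
    "\<And>c d. c \<in> A \<Longrightarrow> d \<in> A \<Longrightarrow> compatible c d"
    "\<And>p. chart_at A p \<in> A" "\<And>p. p \<in> dom_c (chart_at A p)"
proof -
  show "c \<in> A \<Longrightarrow> is_chart c" "c \<in> A \<Longrightarrow> adapted_chart A c"
    "c \<in> A \<Longrightarrow> d \<in> A \<Longrightarrow> compatible c d" for c d
    using A by (auto simp: smooth_atlas_def adapted_chart_def)
  show ex: "\<exists>c\<in>A. p \<in> dom_c c" for p using A unfolding smooth_atlas_def by blast
  show "chart_at A p \<in> A" "p \<in> dom_c (chart_at A p)" for p
    using someI_ex[of "\<lambda>c. c \<in> A \<and> p \<in> dom_c c"] ex[of p] unfolding chart_at_def by blast+
qed

lemma adapted_chart_facts:
  assumes "adapted_chart A c"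
  shows "is_chart c" "\<And>d. d \<in> A \<Longrightarrow> compatible c d" "\<And>p. p \<in> dom_c c \<Longrightarrow> snd c p \<in> overlap c (chart_at A p)"
    "\<And>p. compatible c (chart_at A p)"
  using assms atlas_facts(5,6) by (auto simp: adapted_chart_def)

lemma from_coord_linear:
  assumes "adapted_chart A c" "p \<in> dom_c c"
  shows "linear (from_coord A c p)"
proof -
  note a = adapted_chart_facts[OF assms(1)]
  show ?thesis
    unfolding from_coord_def
    by (rule FD_linear[OF smooth_on_differentiable[OF
          transition_facts(2)[OF a(1) atlas_facts(1)[OF atlas_facts(5)] a(4)] a(3)[OF assms(2)]]])
qed

lemma from_coord_change:
  assumes "adapted_chart A c" "adapted_chart A d" "compatible c d" "p \<in> dom_c c" "p \<in> dom_c d"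
  shows "from_coord A c p u = from_coord A d p (FD (transition c d) (snd c p) u)"
proof -
  note a = adapted_chart_facts[OF assms(1)] and b = adapted_chart_facts[OF assms(2)]
  let ?e = "chart_at A p"
  have e: "is_chart ?e" by (rule atlas_facts(1)[OF atlas_facts(5)])
  note tcd = transition_facts[OF a(1) b(1) assms(3)] and tce = transition_facts[OF a(1) e a(4)]
    and tde = transition_facts[OF b(1) e b(4)]
  have o: "open (overlap c d \<inter> overlap c ?e)" using tcd(1) tce(1) by blast
  have x: "snd c p \<in> overlap c d \<inter> overlap c ?e" using assms(4,5) a(3)[OF assms(4)] by blast
  have T: "transition c d (snd c p) = snd d p" by (rule tcd(7)[OF assms(4,5)])
  have 1: "transition c ?e y = transition d ?e (transition c d y)" if "y \<in> overlap c d \<inter> overlap c ?e" for y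
  proof -
    have "inv_c d (transition c d y) = inv_c c y" using that by (intro tcd(6)) blast
    then show ?thesis by (simp add: transition_def)
  qed
  have d1: "transition c d differentiable (at (snd c p))"
    by (rule smooth_on_differentiable[OF tcd(2)]) (use assms(4,5) in blast)
  have d2: "transition d ?e differentiable (at (transition c d (snd c p)))"
    unfolding T by (rule smooth_on_differentiable[OF tde(2) b(3)[OF assms(5)]])
  show ?thesis
    unfolding from_coord_def using FD_local_compose[OF o x 1 d1 d2] T by simp
qed

lemma from_coord_chart_at: "from_coord A (chart_at A p) p u = u"
proof -
  let ?e = "chart_at A p"
  have e: "is_chart ?e" by (rule atlas_facts(1)[OF atlas_facts(5)])
  note t = transition_facts[OF e e atlas_facts(4)[OF atlas_facts(5) atlas_facts(5)]]
  have x: "snd ?e p \<in> overlap ?e ?e" using atlas_facts(6) by blast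
  have "FD (\<lambda>y. y) (snd ?e p) = FD (transition ?e ?e) (snd ?e p)"
    by (rule FD_cong[OF t(1) x]) (use is_chart_facts(3)[OF e] in \<open>auto simp: transition_def\<close>)
  then show ?thesis by (metis from_coord_def frechet_derivative_ident)
qed

lemma from_coord_inverse:
  assumes "adapted_chart A c" "p \<in> dom_c c"
  shows "from_coord A c p (FD (transition (chart_at A p) c) (snd (chart_at A p) p) u) = u"
    "FD (transition (chart_at A p) c) (snd (chart_at A p) p) (from_coord A c p u) = u"
proof -
  note a = adapted_chart_facts[OF assms(1)]
  let ?e = "chart_at A p"
  have e: "is_chart ?e" "adapted_chart A ?e" by (rule atlas_facts(1,2)[OF atlas_facts(5)])+
  show "from_coord A c p (FD (transition ?e c) (snd ?e p) u) = u"
    using from_coord_change[OF e(2) assms(1) compatible_sym[OF a(4)] atlas_facts(6) assms(2), of u]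
    by (simp add: from_coord_chart_at)
  have "transition c ?e (snd c p) = snd ?e p"
    by (rule transition_facts(7)[OF a(1) e(1) a(4) assms(2) atlas_facts(6)])
  then show "FD (transition ?e c) (snd ?e p) (from_coord A c p u) = u"
    using FD_transition_inverse[OF a(1) e(1) a(4) a(3)[OF assms(2)], of u] by (simp add: from_coord_def)
qed

lemma bij_from_coord:
  assumes "adapted_chart A c" "p \<in> dom_c c"
  shows "bij (from_coord A c p)"
  by (rule o_bij[of "FD (transition (chart_at A p) c) (snd (chart_at A p) p)"])
    (use from_coord_inverse[OF assms] in \<open>auto simp: fun_eq_iff\<close>)

text \<open>Two local representations of one tensor are pullbacks of each other under the transition
  map; through this fact the naturality results on Euclidean domains reach the manifold.\<close>

lemma loc_change:
  assumes "adapted_chart A c" "adapted_chart A d" "compatible c d" "x \<in> overlap c d"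
  shows "loc1 A c \<beta> x u = loc1 A d \<beta> (transition c d x) (FD (transition c d) x u)"
    and "loc2 A c \<alpha> x u v = loc2 A d \<alpha> (transition c d x) (FD (transition c d) x u) (FD (transition c d) x v)"
proof -
  note a = adapted_chart_facts[OF assms(1)] and b = adapted_chart_facts[OF assms(2)]
  note t = transition_facts[OF a(1) b(1) assms(3)]
  have p: "inv_c c x \<in> dom_c c" "inv_c c x \<in> dom_c d" and x: "snd c (inv_c c x) = x"
    using assms(4) t(8) is_chart_facts(4,5)[OF a(1)] by auto
  have "from_coord A c (inv_c c x) u = from_coord A d (inv_c c x) (FD (transition c d) x u)" for u
    using from_coord_change[OF assms(1-3) p, of u] x by simp
  then show "loc1 A c \<beta> x u = loc1 A d \<beta> (transition c d x) (FD (transition c d) x u)"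
    "loc2 A c \<alpha> x u v = loc2 A d \<alpha> (transition c d x) (FD (transition c d) x u) (FD (transition c d) x v)"
    unfolding loc1_def loc2_def t(6)[OF assms(4)] by simp_all
qed

lemma loc1_linear:
  assumes "adapted_chart A c" "x \<in> img_c c" "\<And>p. linear (\<beta> p)"
  shows "linear (loc1 A c \<beta> x)"
proof -
  have "inv_c c x \<in> dom_c c" using assms(2) by (rule inv_into_into)
  from linear_compose[OF from_coord_linear[OF assms(1) this] assms(3)] show ?thesis
    by (simp add: loc1_def[abs_def] o_def)
qed

lemma loc2_bilinear:
  assumes "adapted_chart A c" "x \<in> img_c c" "\<And>p. bilinear (\<alpha> p)"
  shows "bilinear (loc2 A c \<alpha> x)"
proof -
  have "inv_c c x \<in> dom_c c" using assms(2) by (rule inv_into_into)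
  note l = from_coord_linear[OF assms(1) this]
  show ?thesis
    unfolding bilinear_def loc2_def[abs_def]
    using linear_compose[OF l, of "\<alpha> (inv_c c x) _"] linear_compose[OF l, of "\<lambda>u. \<alpha> (inv_c c x) u _"] assms(3)
    by (auto simp: bilinear_def o_def)
qed

lemma riemannian_metric_on:
  assumes "riemannian_metric A g" "c \<in> A"
  shows "metric_on (img_c c) (loc2 A c g)"
  unfolding metric_on_def
proof (intro conjI ballI allI)
  note c = atlas_facts(1,2)[OF assms(2)]
  show "open (img_c c)" by (rule is_chart_facts(2)[OF c(1)])
  show "smooth_on (img_c c) (\<lambda>x. loc2 A c g x u v)" for u v
    using assms by (auto simp: riemannian_metric_def smooth_bilinear_field_def)
  fix x assume x: "x \<in> img_c c"
  have "inv_c c x \<in> dom_c c" using x by (rule inv_into_into)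
  note b = bij_from_coord[OF c(2) this] and l = from_coord_linear[OF c(2) this]
  have "from_coord A c (inv_c c x) u \<noteq> 0" if "u \<noteq> 0" for u
    using linear_0[OF l] bij_is_inj[OF b] that by (metis injD)
  then show "pos_inner (loc2 A c g x)"
    using assms(1) loc2_bilinear[OF c(2) x, of g]
    unfolding pos_inner_def by (auto simp: riemannian_metric_def smooth_bilinear_field_def loc2_def)
qed

lemma riemannian_pos_inner: "riemannian_metric A g \<Longrightarrow> pos_inner (g p)"
  by (auto simp: riemannian_metric_def smooth_bilinear_field_def pos_inner_def)

end

section \<open>Local expressions of tensor operations\<close>

lemma ext_d1_eucl_pullback:
  fixes b b' :: "(real^'d::finite, 'd) field1"
  assumes S: "open S" "x \<in> S" and T: "open T" "F ` S \<subseteq> T" "smooth_on S F"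
    and b: "\<And>y. y \<in> T \<Longrightarrow> linear (b y)" "\<And>u. smooth_on T (\<lambda>y. b y u)"
    and b': "\<And>y u. y \<in> S \<Longrightarrow> b' y u = b (F y) (FD F y u)"
  shows "ext_d1_eucl b' x u v = ext_d1_eucl b (F x) (FD F x u) (FD F x v)"
proof -
  have Fx: "F x \<in> T" using assms by blast
  have 1: "(\<lambda>y. b (F y) (FD F y u)) differentiable (at x)" for u
  proof -
    have "smooth_on S (\<lambda>y. b (F y) (FD F y u))"
      by (rule smooth_on_linear_field[of S "\<lambda>y. b (F y)" "\<lambda>y. FD F y u", OF S(1) _
            smooth_on_compose[OF S(1) T b(2)] smooth_on_FD[OF T(3)]]) (use b(1) T(2) in blast)
    then show ?thesis by (rule smooth_on_differentiable[OF _ S(2)])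
  qed
  have "FD (\<lambda>y. b (F y) (FD F y u)) x = FD (\<lambda>y. b' y u) x" for u
    by (rule FD_cong[OF S _ 1]) (simp add: b')
  then show ?thesis
    using ext_d1_pullback[OF S(1) T b S(2), of v u] by (simp add: ext_d1_eucl_def)
qed

text \<open>\<open>F\<close> may change the dimension, so the lemma serves for transition maps, for
  a map between manifolds read in charts, and for a variation as a map on space-time.
  \<open>a'\<close> stands for a local representation known to agree with the pullback on
  \<open>S\<close>.\<close>

lemma ext_d2_general_pullback:
  fixes F :: "'a::euclidean_space \<Rightarrow> 'b::euclidean_space"
    and a :: "'b \<Rightarrow> 'b \<Rightarrow> 'b \<Rightarrow> real" and a' :: "'a \<Rightarrow> 'a \<Rightarrow> 'a \<Rightarrow> real"
  assumes S: "open S" "x \<in> S" and T: "open T" "F ` S \<subseteq> T" "smooth_on S F"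
    and a: "\<And>y. y \<in> T \<Longrightarrow> bilinear (a y)" "\<And>u v. smooth_on T (\<lambda>y. a y u v)"
      "\<And>y u v. y \<in> T \<Longrightarrow> a y u v = - a y v u"
    and a': "\<And>y u v. y \<in> S \<Longrightarrow> a' y u v = a (F y) (FD F y u) (FD F y v)"
  shows "FD (\<lambda>y. a' y v w) x u - FD (\<lambda>y. a' y u w) x v + FD (\<lambda>y. a' y u v) x w =
    FD (\<lambda>z. a z (FD F x v) (FD F x w)) (F x) (FD F x u)
      - FD (\<lambda>z. a z (FD F x u) (FD F x w)) (F x) (FD F x v)
      + FD (\<lambda>z. a z (FD F x u) (FD F x v)) (F x) (FD F x w)"
proof -
  have "FD (\<lambda>y. a (F y) (FD F y u) (FD F y v)) x = FD (\<lambda>y. a' y u v) x" for u v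
    by (rule FD_cong[OF S _ smooth_on_differentiable[OF smooth_on_pullback2[OF S(1) T a(1,2)] S(2)]]) (simp add: a')
  then show ?thesis using ext_d2_pullback[OF S(1) T a(1,2) S(2) a(3), of v w u] by simp
qed

lemma alternating_anti:
  fixes a :: "'a::real_vector \<Rightarrow> 'a \<Rightarrow> real"
  assumes b: "bilinear a" and z: "\<And>u. a u u = 0"
  shows "a u v = - a v u"
proof -
  have "a (u + v) (u + v) = 0" by (rule z)
  then have "a u v + a v u = 0" by (simp add: bilinear_ladd[OF b] bilinear_radd[OF b] z[of u] z[of v])
  then show ?thesis by linarith
qed

lemma bilinear_ext_d1_eucl:
  assumes "open S" "x \<in> S" "\<And>y. y \<in> S \<Longrightarrow> linear (b y)" "\<And>u. smooth_on S (\<lambda>y. b y u)"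
  shows "bilinear (ext_d1_eucl b x)"
proof -
  note d = smooth_on_differentiable[OF assms(4,2)]
  note l1 = FD_linear[OF d] and l2 = FD_linear_field[OF assms(1,2,3) d]
  show ?thesis
    unfolding bilinear_def ext_d1_eucl_def[abs_def]
    by (intro conjI allI linearI) (simp_all add: linear_add[OF l1] linear_add[OF l2] linear_cmul[OF l1]
        linear_cmul[OF l2] algebra_simps)
qed

lemma smooth_ext_d1_eucl:
  assumes "open S" "\<And>u. smooth_on S (\<lambda>y. b y u)"
  shows "smooth_on S (\<lambda>x. ext_d1_eucl b x u v)"
  unfolding ext_d1_eucl_def by (intro smooth_on_diff smooth_on_FD assms)

text \<open>Frame-free form of the inner product of 2-forms,
  \<open>1/2 g^{kk'} g^{ll'} a_{kl} b_{k'l'}\<close>, hence smooth in a parameter even though the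
  chosen frames need not be.\<close>

definition inner2 ::
  "(real^'d \<Rightarrow> real^'d \<Rightarrow> real) \<Rightarrow> (real^'d \<Rightarrow> real^'d \<Rightarrow> real) \<Rightarrow> (real^'d \<Rightarrow> real^'d \<Rightarrow> real) \<Rightarrow> real" where
  "inner2 G a b = 1 / 2 * metric_trace G (\<lambda>u u'. metric_trace G (\<lambda>v v'. a u v * b u' v'))"

lemma inner_form2_frame:
  assumes G: "pos_inner G" "orthonormal_frame G e" and a: "bilinear a" "bilinear b"
  shows "inner2 G a b = 1 / 2 * (\<Sum>i\<in>UNIV. \<Sum>j\<in>UNIV. a (e i) (e j) * b (e i) (e j))"
proof -
  note al = bilinear_ladd[OF a(1)] bilinear_radd[OF a(1)] bilinear_lmul[OF a(1)] bilinear_rmul[OF a(1)]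
    bilinear_ladd[OF a(2)] bilinear_radd[OF a(2)] bilinear_lmul[OF a(2)] bilinear_rmul[OF a(2)]
  have b1: "bilinear (\<lambda>v v'. a u v * b u' v')" for u u'
    unfolding bilinear_def by (intro conjI allI linearI) (simp_all add: al algebra_simps)
  have m: "metric_trace G (\<lambda>v v'. a u v * b u' v') = (\<Sum>j\<in>UNIV. a u (e j) * b u' (e j))" for u u'
    by (rule metric_trace_frame[OF G b1, symmetric])
  have "bilinear (\<lambda>u u'. \<Sum>j\<in>UNIV. a u (e j) * b u' (e j))"
    unfolding bilinear_def
    by (intro conjI allI linearI) (simp_all add: al algebra_simps sum.distrib sum_distrib_left)
  from metric_trace_frame[OF G this] show ?thesis by (simp add: inner2_def m)
qed

lemma smooth_inner2:
  assumes G: "metric_on S G" and a: "\<And>u v. smooth_on S (\<lambda>x. a x u v)" "\<And>u v. smooth_on S (\<lambda>x. b x u v)"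
  shows "smooth_on S (\<lambda>x. inner2 (G x) (a x) (b x))"
proof -
  note o = metric_on_facts(1)[OF G]
  have "smooth_on S (\<lambda>x. metric_trace (G x) (\<lambda>v v'. a x u v * b x u' v'))" for u u'
    by (rule smooth_metric_trace[OF G, of "\<lambda>x v v'. a x u v * b x u' v'"]) (rule smooth_on_mult[OF o a])
  then have "smooth_on S (\<lambda>x. metric_trace (G x) (\<lambda>u u'. metric_trace (G x) (\<lambda>v v'. a x u v * b x u' v')))"
    by (rule smooth_metric_trace[OF G, of "\<lambda>x u u'. metric_trace (G x) (\<lambda>v v'. a x u v * b x u' v')"])
  then show ?thesis unfolding inner2_def by (rule smooth_on_mult[OF o smooth_on_const])
qed

context
  fixes A :: "('m::t2_space, 'd::finite) chart set"
  assumes A: "smooth_atlas A"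
begin

lemma form1_facts:
  assumes "form1 A \<beta>" "c \<in> A"
  shows "\<And>x. x \<in> img_c c \<Longrightarrow> linear (loc1 A c \<beta> x)" "\<And>u. smooth_on (img_c c) (\<lambda>x. loc1 A c \<beta> x u)"
  using assms loc1_linear[OF A atlas_facts(2)[OF A assms(2)], of _ \<beta>] by (auto simp: form1_def)

lemma form2_facts:
  assumes "form2 A \<alpha>" "c \<in> A"
  shows "\<And>x. x \<in> img_c c \<Longrightarrow> bilinear (loc2 A c \<alpha> x)"
    "\<And>u v. smooth_on (img_c c) (\<lambda>x. loc2 A c \<alpha> x u v)"
    "\<And>x u v. x \<in> img_c c \<Longrightarrow> loc2 A c \<alpha> x u v = - loc2 A c \<alpha> x v u"
    "\<And>p. bilinear (\<alpha> p)"
proof -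
  show b: "x \<in> img_c c \<Longrightarrow> bilinear (loc2 A c \<alpha> x)" "bilinear (\<alpha> p)"
    "smooth_on (img_c c) (\<lambda>x. loc2 A c \<alpha> x u v)" for x u v p
    using assms loc2_bilinear[OF A atlas_facts(2)[OF A assms(2)], of _ \<alpha>]
    by (auto simp: form2_def smooth_bilinear_field_def)
  show "x \<in> img_c c \<Longrightarrow> loc2 A c \<alpha> x u v = - loc2 A c \<alpha> x v u" for x u v
    by (rule alternating_anti[OF b(1)]) (use assms in \<open>auto simp: form2_def loc2_def\<close>)
qed

text \<open>Collects what is needed to pass from a chart \<open>c\<close> to the preferred chart at
  one of its points, where the global operators are defined. The derivative of this transition at
  the point is \<open>from_coord\<close>.\<close>

lemma transition_at:
  assumes c: "c \<in> A" and x: "x \<in> img_c c"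
  defines "e \<equiv> chart_at A (inv_c c x)"
  shows "e \<in> A" "x \<in> overlap c e" "open (overlap c e)" "smooth_on (overlap c e) (transition c e)"
    "transition c e ` overlap c e \<subseteq> img_c e" "transition c e x = snd e (inv_c c x)"
    "FD (transition c e) x u = from_coord A c (inv_c c x) u"
    "adapted_chart A c" "adapted_chart A e" "compatible c e" "open (img_c e)" "inv_c c x \<in> dom_c c"
    "snd c (inv_c c x) = x"
proof -
  note f = atlas_facts[OF A]
  show e: "e \<in> A" unfolding e_def by (rule f(5))
  show a: "adapted_chart A c" "adapted_chart A e" "compatible c e" using f(2,4) c e by auto
  note t = transition_facts[OF f(1)[OF c] f(1)[OF e] a(3)]
  show p: "inv_c c x \<in> dom_c c" using x by (rule inv_into_into)
  show s: "snd c (inv_c c x) = x" using x by (rule f_inv_into_f)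
  show xo: "x \<in> overlap c e" unfolding t(8) using x f(6) by (simp add: e_def)
  show "open (overlap c e)" "smooth_on (overlap c e) (transition c e)" by (rule t)+
  show "transition c e ` overlap c e \<subseteq> img_c e" unfolding t(4) by auto
  show "transition c e x = snd e (inv_c c x)" by (rule t(3)[OF xo])
  show "FD (transition c e) x u = from_coord A c (inv_c c x) u"
    unfolding from_coord_def e_def s ..
  show "open (img_c e)" by (rule is_chart_facts(2)[OF f(1)[OF e]])
qed

text \<open>\<open>ext_d1\<close> differentiates in a chart that changes with the point. By
  naturality under the transition to that chart, one fixed chart gives the same result at all its
  points.\<close>

lemma loc_ext_d1:
  assumes b: "form1 A \<beta>" and c: "c \<in> A" and x: "x \<in> img_c c"
  shows "loc2 A c (ext_d1 A \<beta>) x u v = ext_d1_eucl (loc1 A c \<beta>) x u v"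
proof -
  define e where "e = chart_at A (inv_c c x)"
  note t = transition_at[OF c x, folded e_def]
  have "ext_d1_eucl (loc1 A c \<beta>) x u v =
      ext_d1_eucl (loc1 A e \<beta>) (transition c e x) (FD (transition c e) x u) (FD (transition c e) x v)"
    by (rule ext_d1_eucl_pullback[OF t(3,2,11,5,4)])
      (use form1_facts[OF b t(1)] loc_change(1)[OF A t(8-10)] in auto)
  then show ?thesis unfolding loc2_def ext_d1_def e_def[symmetric] t(6,7) by simp
qed

lemma bilinear_ext_d1:
  assumes b: "form1 A \<beta>"
  shows "bilinear (ext_d1 A \<beta> p)"
proof -
  let ?e = "chart_at A p"
  note e = atlas_facts(5,6)[OF A, of p]
  show ?thesis
    unfolding ext_d1_def
    by (rule bilinear_ext_d1_eucl[OF is_chart_facts(2)[OF atlas_facts(1)[OF A e(1)]] _ form1_facts[OF b e(1)]])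
      (use e(2) in auto)
qed

lemma closed_form2_local:
  assumes a: "form2 A \<alpha>" and cl: "closed_form2 A \<alpha>" and c: "c \<in> A" and x: "x \<in> img_c c"
  shows "ext_d2_eucl (loc2 A c \<alpha>) x u v w = 0"
proof -
  define e where "e = chart_at A (inv_c c x)"
  note t = transition_at[OF c x, folded e_def]
  have "ext_d2_eucl (loc2 A c \<alpha>) x u v w = ext_d2_eucl (loc2 A e \<alpha>) (transition c e x)
      (FD (transition c e) x u) (FD (transition c e) x v) (FD (transition c e) x w)"
    unfolding ext_d2_eucl_def
    by (rule ext_d2_general_pullback[OF t(3,2,11,5,4) form2_facts(1-3)[OF a t(1)] loc_change(2)[OF A t(8-10)]])
  then show ?thesis using cl unfolding closed_form2_def ext_d2_def t(6) e_def[symmetric] by (simp add: e_def)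
qed

section \<open>Traces and the codifferential in charts\<close>

lemma frame_in_chart:
  assumes g: "riemannian_metric A g" and c: "c \<in> A" and x: "x \<in> img_c c"
  obtains f where "orthonormal_frame (loc2 A c g x) f"
    "\<And>i. from_coord A c (inv_c c x) (f i) = some_frame (g (inv_c c x)) i"
proof -
  have p: "inv_c c x \<in> dom_c c" using x by (rule inv_into_into)
  let ?L = "from_coord A c (inv_c c x)"
  have "surj ?L" using bij_from_coord[OF A atlas_facts(2)[OF A c] p] by (rule bij_is_surj)
  then have f: "?L (inv ?L (some_frame (g (inv_c c x)) i)) = some_frame (g (inv_c c x)) i" for i
    by (rule surj_f_inv_f)
  have "orthonormal_frame (g (inv_c c x)) (some_frame (g (inv_c c x)))"
    by (rule orthonormal_some_frame[OF riemannian_pos_inner[OF A g]])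
  then have "orthonormal_frame (loc2 A c g x) (\<lambda>i. inv ?L (some_frame (g (inv_c c x)) i))"
    by (simp add: orthonormal_frame_def loc2_def f)
  then show ?thesis using that f by blast
qed

text \<open>The chosen frame at a point, carried to a chart, is an orthonormal frame of the local
  metric; the trace over it is therefore a metric trace, with no memory of the choice.\<close>

lemma trace_in_chart:
  assumes g: "riemannian_metric A g" and c: "c \<in> A" and x: "x \<in> img_c c" and b: "bilinear b"
    and b': "\<And>u v. b' u v = b (from_coord A c (inv_c c x) u) (from_coord A c (inv_c c x) v)"
  shows "(\<Sum>i\<in>UNIV. b (some_frame (g (inv_c c x)) i) (some_frame (g (inv_c c x)) i)) = metric_trace (loc2 A c g x) b'"
proof -
  obtain f where f: "orthonormal_frame (loc2 A c g x) f"
    "\<And>i. from_coord A c (inv_c c x) (f i) = some_frame (g (inv_c c x)) i"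
    using frame_in_chart[OF g c x] by blast
  have p: "inv_c c x \<in> dom_c c" using x by (rule inv_into_into)
  note L = from_coord_linear[OF A atlas_facts(2)[OF A c] p]
  have bl: "linear (\<lambda>u. b u v)" "linear (b u)" for u v using b by (auto simp: bilinear_def)
  have "bilinear b'"
    unfolding bilinear_def b'
    by (intro conjI allI linearI) (simp_all add: linear_add[OF L] linear_cmul[OF L] linear_add[OF bl(1)]
        linear_add[OF bl(2)] linear_cmul[OF bl(1)] linear_cmul[OF bl(2)])
  from metric_trace_frame[OF metric_on_facts(2)[OF riemannian_metric_on[OF A g c] x] f(1) this]
  show ?thesis by (simp add: b' f(2))
qed

lemma inner_form2_in_chart:
  assumes g: "riemannian_metric A g" and c: "c \<in> A" and x: "x \<in> img_c c"
    and a: "\<And>p. bilinear (\<alpha> p)" "\<And>p. bilinear (\<beta> p)"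
  shows "inner_form2 (g (inv_c c x)) (\<alpha> (inv_c c x)) (\<beta> (inv_c c x)) =
    inner2 (loc2 A c g x) (loc2 A c \<alpha> x) (loc2 A c \<beta> x)"
proof -
  obtain f where f: "orthonormal_frame (loc2 A c g x) f"
    "\<And>i. from_coord A c (inv_c c x) (f i) = some_frame (g (inv_c c x)) i"
    using frame_in_chart[OF g c x] by blast
  note b = loc2_bilinear[OF A atlas_facts(2)[OF A c] x]
  show ?thesis
    unfolding inner_form2_def Let_def
      inner_form2_frame[OF metric_on_facts(2)[OF riemannian_metric_on[OF A g c] x] f(1) b[OF a(1)] b[OF a(2)]]
    by (simp add: loc2_def f(2))
qed

text \<open>Naturality of the covariant derivative moves the definition from the preferred chart to
  \<open>c\<close>, and invariance of the trace removes the chosen frame. The trace form yields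
  smoothness, the frame form matches the divergence identity.\<close>

lemma codiff_in_chart:
  assumes g: "riemannian_metric A g" and a: "form2 A \<alpha>" and c: "c \<in> A" and x: "x \<in> img_c c"
  shows "loc1 A c (codiff2 A g \<alpha>) x v =
      - metric_trace (loc2 A c g x) (\<lambda>w w'. cov_deriv2 (loc2 A c g) (loc2 A c \<alpha>) x w w' v)"
    and "orthonormal_frame (loc2 A c g x) f \<Longrightarrow> loc1 A c (codiff2 A g \<alpha>) x v =
      - (\<Sum>i\<in>UNIV. cov_deriv2 (loc2 A c g) (loc2 A c \<alpha>) x (f i) (f i) v)"
proof -
  define e where "e = chart_at A (inv_c c x)"
  note t = transition_at[OF c x, folded e_def]
  let ?T = "transition c e" and ?L = "from_coord A c (inv_c c x)"
  note G = riemannian_metric_on[OF A g c] and H = riemannian_metric_on[OF A g t(1)]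
  obtain f' where f': "orthonormal_frame (loc2 A c g x) f'" "\<And>i. ?L (f' i) = some_frame (g (inv_c c x)) i"
    using frame_in_chart[OF g c x] by blast
  have GS: "metric_on (overlap c e) (loc2 A c g)"
    using G t(3) by (auto simp: metric_on_def intro: smooth_on_subset)
  have surj: "surj (FD ?T y)" if y: "y \<in> overlap c e" for y
  proof -
    note at = atlas_facts(1)[OF A]
    have "FD ?T y (FD (transition e c) (?T y) u) = u" for u
    proof -
      note tf = transition_facts[OF at[OF c] at[OF t(1)] t(10)]
      have "?T y \<in> overlap e c" using tf(4) y by blast
      from FD_transition_inverse[OF at[OF t(1)] at[OF c] compatible_sym[OF t(10)] this, of u]
      show ?thesis unfolding tf(5)[OF y] .
    qed
    then show ?thesis by (metis surjI)
  qed
  have nat: "cov_deriv2 (loc2 A c g) (loc2 A c \<alpha>) x w u v =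
      cov_deriv2 (loc2 A e g) (loc2 A e \<alpha>) (?T x) (FD ?T x w) (FD ?T x u) (FD ?T x v)" for w u v
    by (rule cov_deriv2_natural[OF GS H t(4,5) surj _ t(2) form2_facts(1,2)[OF a t(1)]])
      (use loc_change(2)[OF A t(8-10)] in auto)
  have "loc1 A c (codiff2 A g \<alpha>) x v =
      - (\<Sum>i\<in>UNIV. cov_deriv2 (loc2 A c g) (loc2 A c \<alpha>) x (f' i) (f' i) v)"
    unfolding loc1_def codiff2_def Let_def nat e_def[symmetric] t(6,7) f'(2) ..
  also have "(\<Sum>i\<in>UNIV. cov_deriv2 (loc2 A c g) (loc2 A c \<alpha>) x (f' i) (f' i) v) =
      metric_trace (loc2 A c g x) (\<lambda>w w'. cov_deriv2 (loc2 A c g) (loc2 A c \<alpha>) x w w' v)"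
    by (rule metric_trace_frame[OF metric_on_facts(2)[OF G x] f'(1)
        cov_deriv2_trilinear(1)[OF G x form2_facts(1,2)[OF a c]]])
  finally show 1: "loc1 A c (codiff2 A g \<alpha>) x v =
      - metric_trace (loc2 A c g x) (\<lambda>w w'. cov_deriv2 (loc2 A c g) (loc2 A c \<alpha>) x w w' v)" .
  show "loc1 A c (codiff2 A g \<alpha>) x v =
      - (\<Sum>i\<in>UNIV. cov_deriv2 (loc2 A c g) (loc2 A c \<alpha>) x (f i) (f i) v)"
    if f: "orthonormal_frame (loc2 A c g x) f"
    using 1 metric_trace_frame[OF metric_on_facts(2)[OF G x] f
        cov_deriv2_trilinear(1)[OF G x form2_facts(1,2)[OF a c], where v=v]] by simp
qed

lemma smooth_codiff:
  assumes g: "riemannian_metric A g" and a: "form2 A \<alpha>" and c: "c \<in> A"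
  shows "smooth_on (img_c c) (\<lambda>x. loc1 A c (codiff2 A g \<alpha>) x v)"
proof -
  note G = riemannian_metric_on[OF A g c]
  have "smooth_on (img_c c) (\<lambda>x. - metric_trace (loc2 A c g x)
      (\<lambda>w w'. cov_deriv2 (loc2 A c g) (loc2 A c \<alpha>) x w w' v))"
    by (rule smooth_on_minus[OF metric_on_facts(1)[OF G] smooth_metric_trace[OF G smooth_cov_deriv2[OF G form2_facts(1,2)[OF a c]]]])
  then show ?thesis
    by (rule smooth_on_cong[OF metric_on_facts(1)[OF G], rotated]) (rule codiff_in_chart(1)[OF g a c, symmetric])
qed

lemma linear_codiff:
  assumes g: "riemannian_metric A g" and a: "form2 A \<alpha>"
  shows "linear (codiff2 A g \<alpha> p)"
proof -
  let ?e = "chart_at A p"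
  note e = atlas_facts(5,6)[OF A, of p]
  have x: "snd ?e p \<in> img_c ?e" using e(2) by auto
  have "linear (\<lambda>v. cov_deriv2 (loc2 A ?e g) (loc2 A ?e \<alpha>) (snd ?e p) w w v)" for w
    using cov_deriv2_trilinear(2)[OF riemannian_metric_on[OF A g e(1)] x form2_facts(1,2)[OF a e(1)]] .
  then show ?thesis
    unfolding codiff2_def[abs_def] Let_def by (intro linear_compose_neg linear_compose_sum) auto
qed

end

section \<open>Pullback of forms\<close>

context
  fixes A :: "('m::t2_space, 'd::finite) chart set" and B :: "('n::t2_space, 'k::finite) chart set"
    and \<phi> :: "'m \<Rightarrow> 'n"
  assumes A: "smooth_atlas A" and B: "smooth_atlas B" and \<phi>: "smooth_map A B \<phi>"
begin

lemma map_in_charts: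
  assumes "c \<in> A" "d \<in> B"
  defines "W \<equiv> snd c ` (dom_c c \<inter> \<phi> -` dom_c d)" and "f \<equiv> snd d \<circ> \<phi> \<circ> inv_c c"
  shows "open W" "smooth_on W f" "f ` W \<subseteq> img_c d" "W \<subseteq> img_c c"
    "\<And>x. x \<in> W \<longleftrightarrow> x \<in> img_c c \<and> \<phi> (inv_c c x) \<in> dom_c d"
proof -
  note c = is_chart_facts[OF atlas_facts(1)[OF A assms(1)]] and d = is_chart_facts[OF atlas_facts(1)[OF B assms(2)]]
  have "open (\<phi> -` dom_c d)" using \<phi> d(1) by (simp add: smooth_map_def open_vimage)
  then show "open W" unfolding W_def by (rule c(8))
  show "smooth_on W f" using \<phi> assms by (auto simp: smooth_map_def)
  show "f ` W \<subseteq> img_c d" unfolding W_def f_def by (auto simp: c(3))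
  show "W \<subseteq> img_c c" by (auto simp: W_def)
  show "x \<in> W \<longleftrightarrow> x \<in> img_c c \<and> \<phi> (inv_c c x) \<in> dom_c d" for x
    unfolding W_def using c(3,4,5) by (auto simp: image_iff)
qed

lemma differential_in_charts:
  assumes c: "c \<in> A" and d: "d \<in> B" and p: "p \<in> dom_c c" "\<phi> p \<in> dom_c d"
  shows "differential A B \<phi> p (from_coord A c p u) =
    from_coord B d (\<phi> p) (FD (snd d \<circ> \<phi> \<circ> inv_c c) (snd c p) u)"
proof -
  define e where "e = chart_at A p"
  define e' where "e' = chart_at B (\<phi> p)"
  define f where "f = snd d \<circ> \<phi> \<circ> inv_c c"
  define h where "h = snd e' \<circ> \<phi> \<circ> inv_c e"
  have e: "e \<in> A" "p \<in> dom_c e" and e': "e' \<in> B" "\<phi> p \<in> dom_c e'"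
    using atlas_facts(5,6)[OF A] atlas_facts(5,6)[OF B] by (auto simp: e_def e'_def)
  note at = atlas_facts(1)[OF A] and bt = atlas_facts(1)[OF B]
  note cc = is_chart_facts[OF at[OF c]]
  note tce = transition_facts[OF at[OF c] at[OF e(1)] atlas_facts(4)[OF A c e(1)]]
  note tde = transition_facts[OF bt[OF d] bt[OF e'(1)] atlas_facts(4)[OF B d e'(1)]]
  note mf = map_in_charts[OF c d, folded f_def] and mh = map_in_charts[OF e(1) e'(1), folded h_def]
    and mce = map_in_charts[OF c e'(1)]
  \<comment> \<open>On \<open>V\<close> all four charts are available, so the map into
    \<open>e'\<close> can be computed through \<open>e\<close> or through \<open>d\<close>; the
    chain rule along both routes gives the claim.\<close>
  define V where "V = overlap c e \<inter> snd c ` (dom_c c \<inter> \<phi> -` dom_c d) \<inter> snd c ` (dom_c c \<inter> \<phi> -` dom_c e')"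
  have V: "open V" unfolding V_def using tce(1) mf(1) mce(1) by blast
  have x: "snd c p \<in> V" unfolding V_def using p e e' by auto
  have px: "inv_c c (snd c p) = p" by (rule cc(3)[OF p(1)])
  have T: "transition c e (snd c p) = snd e p" by (rule tce(7)[OF p(1) e(2)])
  have fx: "f (snd c p) = snd d (\<phi> p)" by (simp add: f_def px)
  have eq: "h (transition c e y) = transition d e' (f y)" if y: "y \<in> V" for y
  proof -
    have "inv_c e (transition c e y) = inv_c c y" using y unfolding V_def by (intro tce(6)) blast
    moreover have "\<phi> (inv_c c y) \<in> dom_c d" using y mf(5)[of y] unfolding V_def by blast
    then have "inv_c d (snd d (\<phi> (inv_c c y))) = \<phi> (inv_c c y)" by (rule is_chart_facts(3)[OF bt[OF d]])
    ultimately show ?thesis by (simp add: h_def f_def transition_def)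
  qed
  have 1: "transition c e differentiable (at (snd c p))"
    by (rule smooth_on_differentiable[OF tce(2)]) (use p e in blast)
  have 2: "h differentiable (at (transition c e (snd c p)))"
    unfolding T by (rule smooth_on_differentiable[OF mh(2)]) (use e e' in auto)
  have 3: "f differentiable (at (snd c p))"
    by (rule smooth_on_differentiable[OF mf(2)]) (use p in auto)
  have 4: "transition d e' differentiable (at (f (snd c p)))"
    unfolding fx by (rule smooth_on_differentiable[OF tde(2)]) (use p e' in blast)
  have "FD (\<lambda>y. h (transition c e y)) (snd c p) u = FD h (snd e p) (FD (transition c e) (snd c p) u)"
    using FD_local_compose[OF V x refl 1 2] T by simp
  moreover have "FD (\<lambda>y. h (transition c e y)) (snd c p) u =
      FD (transition d e') (snd d (\<phi> p)) (FD f (snd c p) u)"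
    using FD_local_compose[OF V x eq 3 4, of u] fx by simp
  ultimately show ?thesis
    unfolding differential_def from_coord_def e_def[symmetric] e'_def[symmetric] h_def[symmetric] f_def[symmetric]
    by simp
qed

lemma linear_differential: "linear (differential A B \<phi> p)"
proof -
  note e = atlas_facts(5,6)[OF A, of p] and e' = atlas_facts(5,6)[OF B, of "\<phi> p"]
  show ?thesis
    unfolding differential_def
    by (rule FD_linear[OF smooth_on_differentiable[OF map_in_charts(2)[OF e(1) e'(1)]]]) (use e e' in auto)
qed

lemma pullback2_in_charts:
  assumes c: "c \<in> A" and d: "d \<in> B" and x: "x \<in> snd c ` (dom_c c \<inter> \<phi> -` dom_c d)"
  defines "f \<equiv> snd d \<circ> \<phi> \<circ> inv_c c"
  shows "loc2 A c (pullback2 A B \<phi> \<omega>) x u v = loc2 B d \<omega> (f x) (FD f x u) (FD f x v)"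
proof -
  note m = map_in_charts(5)[OF c d, THEN iffD1, OF x]
  have p: "inv_c c x \<in> dom_c c" "\<phi> (inv_c c x) \<in> dom_c d" "snd c (inv_c c x) = x"
    using m is_chart_facts(4,5)[OF atlas_facts(1)[OF A c]] by auto
  have "inv_c d (f x) = \<phi> (inv_c c x)"
    using is_chart_facts(3)[OF atlas_facts(1)[OF B d] p(2)] by (simp add: f_def)
  then show ?thesis
    unfolding loc2_def pullback2_def differential_in_charts[OF c d p(1,2)] p(3) f_def by simp
qed

lemma bilinear_pullback2:
  assumes "\<And>q. bilinear (\<omega> q)"
  shows "bilinear (pullback2 A B \<phi> \<omega> p)"
proof -
  note l = linear_differential[of p]
  show ?thesis
    using assms linear_compose[OF l, of "\<omega> (\<phi> p) u" for u] linear_compose[OF l, of "\<lambda>u. \<omega> (\<phi> p) u v" for v]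
    by (auto simp: bilinear_def pullback2_def[abs_def] o_def)
qed

lemma form2_pullback2:
  assumes w: "form2 B \<omega>"
  shows "form2 A (pullback2 A B \<phi> \<omega>)"
  unfolding form2_def smooth_bilinear_field_def
proof (intro conjI allI ballI)
  show "bilinear (pullback2 A B \<phi> \<omega> p)" for p
    by (rule bilinear_pullback2) (use w in \<open>auto simp: form2_def smooth_bilinear_field_def\<close>)
  show "pullback2 A B \<phi> \<omega> p u u = 0" for p u using w by (simp add: pullback2_def form2_def)
  fix c u v assume c: "c \<in> A"
  show "smooth_on (img_c c) (\<lambda>x. loc2 A c (pullback2 A B \<phi> \<omega>) x u v)"
  proof (rule smooth_on_local)
    fix x assume x: "x \<in> img_c c"
    obtain d where d: "d \<in> B" "\<phi> (inv_c c x) \<in> dom_c d" using atlas_facts(3)[OF B] by blast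
    note m = map_in_charts[OF c d(1)]
    let ?f = "snd d \<circ> \<phi> \<circ> inv_c c"
    have "smooth_on (snd c ` (dom_c c \<inter> \<phi> -` dom_c d)) (\<lambda>y. loc2 B d \<omega> (?f y) (FD ?f y u) (FD ?f y v))"
      by (rule smooth_on_pullback2[OF m(1) is_chart_facts(2)[OF atlas_facts(1)[OF B d(1)]] m(3,2) form2_facts(1,2)[OF B w d(1)]])
    moreover have "x \<in> snd c ` (dom_c c \<inter> \<phi> -` dom_c d)" using m(5) x d(2) by blast
    ultimately show "\<exists>T g. open T \<and> x \<in> T \<and> (\<forall>y\<in>T. loc2 A c (pullback2 A B \<phi> \<omega>) y u v = g y) \<and> smooth_on T g"
      by (intro exI[of _ "snd c ` (dom_c c \<inter> \<phi> -` dom_c d)"]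
          exI[of _ "\<lambda>y. loc2 B d \<omega> (?f y) (FD ?f y u) (FD ?f y v)"] conjI m(1) ballI pullback2_in_charts[OF c d(1)])
  qed
qed

lemma closed_pullback2:
  assumes w: "form2 B \<omega>" "closed_form2 B \<omega>"
  shows "closed_form2 A (pullback2 A B \<phi> \<omega>)"
  unfolding closed_form2_def
proof (intro allI)
  fix p u v w
  define c where "c = chart_at A p"
  define x where "x = snd c p"
  have c: "c \<in> A" "p \<in> dom_c c" using atlas_facts(5,6)[OF A] by (auto simp: c_def)
  obtain d where d: "d \<in> B" "\<phi> p \<in> dom_c d" using atlas_facts(3)[OF B] by blast
  note m = map_in_charts[OF c(1) d(1)]
  let ?f = "snd d \<circ> \<phi> \<circ> inv_c c"
  have x: "x \<in> snd c ` (dom_c c \<inter> \<phi> -` dom_c d)" using c d by (auto simp: x_def)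
  have "ext_d2_eucl (loc2 A c (pullback2 A B \<phi> \<omega>)) x u v w =
      ext_d2_eucl (loc2 B d \<omega>) (?f x) (FD ?f x u) (FD ?f x v) (FD ?f x w)"
    unfolding ext_d2_eucl_def
    by (rule ext_d2_general_pullback[OF m(1) x is_chart_facts(2)[OF atlas_facts(1)[OF B d(1)]] m(3,2)
          form2_facts(1-3)[OF B w(1) d(1)] pullback2_in_charts[OF c(1) d(1)]])
  also have "\<dots> = 0" by (rule closed_form2_local[OF B w d(1)]) (use m(3) x in blast)
  finally show "ext_d2 A (pullback2 A B \<phi> \<omega>) p u v w = 0" by (simp add: ext_d2_def c_def x_def)
qed

end

section \<open>The Kaehler form\<close>

text \<open>The issue is smoothness: \<open>J\<close> is only known to be constant in the charts of
  the complex structure. In a chart of the atlas it becomes this constant conjugated by the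
  derivative of a transition map, which is smooth.\<close>

lemma form2_kaehler_form:
  fixes B :: "('n::t2_space, 'k::finite) chart set"
  assumes "kaehler B h J"
  shows "form2 B (kaehler_form h J)"
proof -
  have B: "smooth_atlas B" and h: "riemannian_metric B h" and J: "complex_structure B J"
    and hJ: "\<And>q u v. h q (J q u) (J q v) = h q u v"
    using assms by (auto simp: kaehler_def)
  have lJ: "linear (J q)" and JJ: "J q (J q u) = - u" for q u
    using J by (auto simp: complex_structure_def)
  have bh: "bilinear (h q)" and sh: "h q u v = h q v u" for q u v
    using h by (auto simp: riemannian_metric_def smooth_bilinear_field_def)
  have b: "bilinear (kaehler_form h J q)" for q
    unfolding bilinear_def kaehler_form_def
    by (intro conjI allI linearI) (simp_all add: linear_add[OF lJ] linear_cmul[OF lJ] bilinear_ladd[OF bh]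
        bilinear_radd[OF bh] bilinear_lmul[OF bh] bilinear_rmul[OF bh])
  have z: "kaehler_form h J q u u = 0" for q u
  proof -
    \<comment> \<open>Invariance of \<open>h\<close> under \<open>J\<close>, with \<open>J\<close>
      squared equal to -1, shows that \<open>h(J u, u)\<close> equals its own negative.\<close>
    have "h q (J q u) u = h q (- u) (J q u)" using hJ[of q "J q u" u] by (simp add: JJ)
    then show ?thesis using sh[of q u "J q u"] by (simp add: kaehler_form_def bilinear_lneg[OF bh])
  qed
  have "smooth_on (img_c d) (\<lambda>y. loc2 B d (kaehler_form h J) y u v)" if d: "d \<in> B" for d u v
  proof (rule smooth_on_local)
    fix x assume x: "x \<in> img_c d"
    note dc = atlas_facts(1)[OF B d] and da = atlas_facts(2)[OF B d]
    have q: "inv_c d x \<in> dom_c d" using x by (rule inv_into_into)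
    obtain c J0 where c: "is_chart c" "\<forall>d\<in>B. compatible c d" "inv_c d x \<in> dom_c c"
      and J0: "\<And>r u. r \<in> dom_c c \<Longrightarrow> J r (from_coord B c r u) = from_coord B c r (J0 u)"
      using J unfolding complex_structure_def by metis
    have ca: "adapted_chart B c" and cd: "compatible c d" "compatible d c"
      using c d compatible_sym[of c d] unfolding adapted_chart_def by blast+
    note t = transition_facts[OF dc c(1) cd(2)] and t' = transition_facts[OF c(1) dc cd(1)]
    \<comment> \<open>The complex structure supplies \<open>J0\<close> as a mere function; linearity
      is inherited from \<open>J\<close> through the injective \<open>from_coord\<close>.\<close>
    have lJ0: "linear J0"
    proof -
      have inj: "inj (from_coord B c (inv_c d x))" by (rule bij_is_inj[OF bij_from_coord[OF B ca c(3)]])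
      note lf = from_coord_linear[OF B ca c(3)]
      show ?thesis
      proof (rule linearI; rule injD[OF inj])
        fix u v :: "real^'k" and r :: real
        show "from_coord B c (inv_c d x) (J0 (u + v)) = from_coord B c (inv_c d x) (J0 u + J0 v)"
          by (simp add: J0[OF c(3), symmetric] linear_add[OF lf] linear_add[OF lJ])
        show "from_coord B c (inv_c d x) (J0 (r *\<^sub>R u)) = from_coord B c (inv_c d x) (r *\<^sub>R J0 u)"
          by (simp add: J0[OF c(3), symmetric] linear_cmul[OF lf] linear_cmul[OF lJ])
      qed
    qed
    \<comment> \<open>The value of \<open>J\<close> on the fixed vector \<open>u\<close> in the
      chart \<open>d\<close>: pass to \<open>c\<close>, apply the constant \<open>J0\<close>, return
      to \<open>d\<close>.\<close>
    define Jd where "Jd y = FD (transition c d) (transition d c y) (J0 (FD (transition d c) y u))" for y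
    have eq: "loc2 B d (kaehler_form h J) y u v = loc2 B d h y (Jd y) v" if y: "y \<in> overlap d c" for y
    proof -
      define r where "r = inv_c d y"
      have r: "r \<in> dom_c d" "r \<in> dom_c c" "snd d r = y" "snd c r = transition d c y"
        using y t(3,8) is_chart_facts(4,5)[OF dc] unfolding r_def by auto
      have "J r (from_coord B d r u) = J r (from_coord B c r (FD (transition d c) y u))"
        using from_coord_change[OF B da ca cd(2) r(1,2), of u] r(3) by simp
      also have "\<dots> = from_coord B c r (J0 (FD (transition d c) y u))" by (rule J0[OF r(2)])
      also have "\<dots> = from_coord B d r (Jd y)"
        using from_coord_change[OF B ca da cd(1) r(2,1)] r(4) by (simp add: Jd_def)
      finally show ?thesis by (simp add: loc2_def kaehler_form_def r_def)
    qed
    have "smooth_on (overlap d c) (\<lambda>y. J0 (FD (transition d c) y u))"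
      by (rule smooth_on_bounded_linear[OF _ t(1) smooth_on_FD[OF t(2)]]) (use lJ0 in \<open>simp add: linear_conv_bounded_linear\<close>)
    moreover have "linear (FD (transition c d) (transition d c y))" if "y \<in> overlap d c" for y
      using t(4) that by (intro FD_linear smooth_on_differentiable[OF t'(2)]) blast
    moreover have "smooth_on (overlap d c) (\<lambda>y. FD (transition c d) (transition d c y) w)" for w
      by (rule smooth_on_compose[OF t(1) t'(1) _ t(2) smooth_on_FD[OF t'(2)]]) (use t(4) in blast)
    ultimately have Jd: "smooth_on (overlap d c) Jd"
      unfolding Jd_def[abs_def]
      using smooth_on_linear_field[of "overlap d c" "\<lambda>y. FD (transition c d) (transition d c y)" "\<lambda>y. J0 (FD (transition d c) y u)"]
        t(1) by blast
    note H = riemannian_metric_on[OF B h d]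
    have "overlap d c \<subseteq> img_c d" by auto
    then have "smooth_on (overlap d c) (\<lambda>y. loc2 B d h y (Jd y) v)"
      using metric_on_facts(3)[OF H] smooth_on_subset[OF metric_on_facts(5)[OF H]]
      by (intro smooth_on_bilinear_field[of "overlap d c" "loc2 B d h" Jd "\<lambda>_. v", OF t(1) _ _ Jd smooth_on_const]) auto
    moreover have "x \<in> overlap d c" using t(8)[of x] x c(3) by blast
    ultimately show "\<exists>T g. open T \<and> x \<in> T \<and> (\<forall>y\<in>T. loc2 B d (kaehler_form h J) y u v = g y) \<and> smooth_on T g"
      by (intro exI[of _ "overlap d c"] exI[of _ "\<lambda>y. loc2 B d h y (Jd y) v"] conjI t(1) ballI eq)
  qed
  then show ?thesis using b z by (simp add: form2_def smooth_bilinear_field_def)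
qed

section \<open>Bump functions and partitions of unity\<close>

text \<open>The family containing \<open>exp(-1/s)\<close>, extended by zero, and closed under
  differentiation; the polynomial in \<open>1/s\<close> is what makes an induction over the order
  possible.\<close>

definition flat :: "real poly \<Rightarrow> real \<Rightarrow> real" where
  "flat p s = (if s > 0 then poly p (1 / s) * exp (- (1 / s)) else 0)"

lemma poly_exp_tendsto_0: "((\<lambda>x. poly p x * exp (- x)) \<longlongrightarrow> 0) at_top" for p :: "real poly"
proof -
  have "((\<lambda>x. \<Sum>i\<le>degree p. coeff p i * (x ^ i / exp x)) \<longlongrightarrow> (\<Sum>i\<le>degree p. coeff p i * 0)) at_top"
    by (intro tendsto_sum tendsto_mult tendsto_const tendsto_power_div_exp_0)
  then show ?thesis by (simp add: poly_altdef sum_distrib_right exp_minus divide_inverse mult.assoc)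
qed

lemma flat_tendsto_0: "((\<lambda>s. flat p s) \<longlongrightarrow> 0) (at 0)"
proof (rule filterlim_split_at)
  have "((\<lambda>s. poly p (inverse s) * exp (- inverse s)) \<longlongrightarrow> 0) (at_right 0)"
    by (rule filterlim_compose[OF poly_exp_tendsto_0 filterlim_inverse_at_top_right])
  then show "(flat p \<longlongrightarrow> 0) (at_right 0)"
    by (rule Lim_transform_eventually)
      (auto simp: flat_def eventually_at_right_field inverse_eq_divide intro!: exI[of _ 1])
  show "(flat p \<longlongrightarrow> 0) (at_left 0)"
    by (rule Lim_transform_eventually[OF tendsto_const])
      (auto simp: flat_def eventually_at_left_field intro!: exI[of _ "-1"])
qed

text \<open>With \<open>t = 1/s\<close>, so that \<open>dt/ds = - t^2\<close>, the derivative of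
  \<open>p(t) exp(-t)\<close> is \<open>t^2 (p(t) - p'(t)) exp(-t)\<close>.\<close>

lemma flat_has_derivative:
  "(flat p has_field_derivative flat ([:0, 0, 1:] * (p - pderiv p)) s) (at s)"
proof -
  consider "s > 0" | "s < 0" | "s = 0" by linarith
  then show ?thesis
  proof cases
    case 1
    have "((\<lambda>s. poly p (1 / s) * exp (- (1 / s))) has_field_derivative
        poly ([:0, 0, 1:] * (p - pderiv p)) (1 / s) * exp (- (1 / s))) (at s)"
      using 1 by (auto intro!: derivative_eq_intros simp: field_simps power2_eq_square)
    then have d: "(flat p has_field_derivative poly ([:0, 0, 1:] * (p - pderiv p)) (1 / s) * exp (- (1 / s))) (at s)"
      by (rule has_field_derivative_transform_within_open[of _ _ _ "{0<..}"]) (use 1 in \<open>auto simp: flat_def\<close>)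
    have eq: "poly ([:0, 0, 1:] * (p - pderiv p)) (1 / s) * exp (- (1 / s)) = flat ([:0, 0, 1:] * (p - pderiv p)) s"
      using 1 by (simp only: flat_def if_True)
    show ?thesis using d unfolding eq .
  next
    case 2
    have "(flat p has_field_derivative 0) (at s)"
      by (rule has_field_derivative_transform_within_open[of "\<lambda>_. 0" 0 s "{..<0}" "flat p"])
        (use 2 in \<open>auto simp: flat_def\<close>)
    moreover have "flat ([:0, 0, 1:] * (p - pderiv p)) s = 0" using 2 by (simp only: flat_def) simp
    ultimately show ?thesis by metis
  next
    case 3
    \<comment> \<open>The difference quotient at 0 is again of this family, with polynomial
      \<open>t p(t)\<close>, and therefore tends to 0.\<close>
    have "(\<lambda>h. (flat p (0 + h) - flat p 0) / h) = flat ([:0, 1:] * p)"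
      by (auto simp: flat_def fun_eq_iff)
    then show ?thesis using 3 flat_tendsto_0[of "[:0, 1:] * p"] by (simp add: DERIV_def flat_def[of _ 0])
  qed
qed

lemma Ck_on_flat: "Ck_on k UNIV (flat p)"
proof (induction k arbitrary: p)
  case 0
  show ?case using DERIV_isCont[OF flat_has_derivative] by (auto intro!: continuous_at_imp_continuous_on)
next
  case (Suc k)
  let ?q = "[:0, 0, 1:] * (p - pderiv p)"
  have d: "(flat p has_derivative (\<lambda>v. flat ?q s * v)) (at s)" for s
    using flat_has_derivative[of p s] by (simp add: has_field_derivative_def mult_commute_abs)
  have "Ck_on k UNIV (\<lambda>s. flat ?q s * v)" for v
    by (rule Ck_on_mult[OF open_UNIV Suc.IH Ck_on_const])
  then have "Ck_on k UNIV (\<lambda>s. FD (flat p) s v)" for v using FD_eq[OF d] by simp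
  then show ?case using differentiableI[OF d] by auto
qed

lemma smooth_on_flat: "smooth_on UNIV (flat p)"
  using Ck_on_flat by (simp add: smooth_on_def)

lemma flat_one:
  "flat 1 s \<ge> 0" "flat 1 s \<le> 1" "s > 0 \<Longrightarrow> flat 1 s > 0" "s \<le> 0 \<Longrightarrow> flat 1 s = 0"
  by (auto simp: flat_def)

section \<open>Bump functions on a manifold\<close>

context
  fixes A :: "('m::t2_space, 'd::finite) chart set"
  assumes A: "smooth_atlas A"
begin

lemma smooth_fun_local:
  assumes "\<And>c x. c \<in> A \<Longrightarrow> x \<in> img_c c \<Longrightarrow>
    \<exists>T g. open T \<and> x \<in> T \<and> (\<forall>y\<in>T. f (inv_c c y) = g y) \<and> smooth_on T g"
  shows "smooth_fun A f"
  unfolding smooth_fun_def by (intro ballI smooth_on_local) (use assms in auto)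

text \<open>In coordinates the function is \<open>exp(-1/s)\<close> with \<open>s\<close> the
  squared radius minus the squared distance to the centre. The closed coordinate ball
  \<open>K\<close> is compact, hence closed in the Hausdorff manifold, so extension by zero stays
  smooth at the edge of the chart domain.\<close>

lemma bump_function:
  assumes c: "c \<in> A" and p: "p \<in> dom_c c" "p \<in> U" and U: "open U"
  obtains \<eta> K V where "smooth_fun A \<eta>" "compact K" "K \<subseteq> dom_c c \<inter> U" "\<And>q. 0 \<le> \<eta> q" "\<And>q. \<eta> q \<le> 1"
    "\<And>q. q \<notin> K \<Longrightarrow> \<eta> q = (0::real)" "open V" "p \<in> V" "\<And>q. q \<in> V \<Longrightarrow> \<eta> q > 0"
proof -
  note cc = is_chart_facts[OF atlas_facts(1)[OF A c]]
  define x where "x = snd c p"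
  have "open (snd c ` (dom_c c \<inter> U))" "x \<in> snd c ` (dom_c c \<inter> U)" using cc(8)[OF U] p by (auto simp: x_def)
  then obtain r where r: "r > 0" "cball x r \<subseteq> snd c ` (dom_c c \<inter> U)" using open_contains_cball by blast
  define \<psi> where "\<psi> y = flat 1 (r\<^sup>2 - (y - x) \<bullet> (y - x))" for y
  define \<eta> where "\<eta> q = (if q \<in> dom_c c then \<psi> (snd c q) else 0)" for q
  define K where "K = inv_c c ` cball x r"
  have sub: "cball x r \<subseteq> img_c c" using r by auto
  have K: "compact K" unfolding K_def
    by (rule compact_continuous_image[OF continuous_on_subset[OF cc(7) sub]]) simp
  have KU: "K \<subseteq> dom_c c \<inter> U"
  proof
    fix q assume "q \<in> K"
    then obtain y where y: "y \<in> cball x r" "q = inv_c c y" by (auto simp: K_def)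
    then obtain q' where "q' \<in> dom_c c \<inter> U" "y = snd c q'" using r by blast
    then show "q \<in> dom_c c \<inter> U" using y cc(3) by auto
  qed
  have sq: "(y - x) \<bullet> (y - x) = (dist x y)\<^sup>2" for y

    by (simp add: dist_norm power2_norm_eq_inner inner_diff_left inner_diff_right inner_commute)
  have \<psi>: "smooth_on UNIV \<psi>"
    unfolding \<psi>_def
    by (rule smooth_on_compose[OF open_UNIV open_UNIV _ _ smooth_on_flat])
      (auto intro!: smooth_on_diff smooth_on_inner smooth_on_const smooth_on_id)
  have z: "\<eta> q = 0" if "q \<notin> K" for q
  proof (cases "q \<in> dom_c c")
    case True
    have "snd c q \<notin> cball x r"
    proof
      assume "snd c q \<in> cball x r"
      then have "inv_c c (snd c q) \<in> K" unfolding K_def by blast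
      then show False using that cc(3)[OF True] by simp
    qed
    then have "dist x (snd c q) > r" by simp
    then have "r\<^sup>2 \<le> (dist x (snd c q))\<^sup>2" using r by (intro power_mono) auto
    then show ?thesis using True by (simp add: \<eta>_def \<psi>_def sq flat_one(4))
  qed (simp add: \<eta>_def)
  have s: "smooth_fun A \<eta>"
  proof (rule smooth_fun_local)
    fix d y assume d: "d \<in> A" and y: "y \<in> img_c d"
    note dd = is_chart_facts[OF atlas_facts(1)[OF A d]]
    note t = transition_facts[OF atlas_facts(1)[OF A d] atlas_facts(1)[OF A c] atlas_facts(4)[OF A d c]]
    show "\<exists>T g. open T \<and> y \<in> T \<and> (\<forall>z\<in>T. \<eta> (inv_c d z) = g z) \<and> smooth_on T g"
    proof (cases "inv_c d y \<in> dom_c c")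
      case True
      have "smooth_on (overlap d c) (\<lambda>z. \<psi> (transition d c z))"
        by (rule smooth_on_compose[OF t(1) open_UNIV _ t(2) \<psi>]) simp
      moreover have "\<eta> (inv_c d z) = \<psi> (transition d c z)" if "z \<in> overlap d c" for z
        using that t(8)[of z] t(3)[of z] by (simp add: \<eta>_def)
      moreover have "y \<in> overlap d c" using t(8)[of y] y True by blast
      ultimately show ?thesis
        using t(1) by (intro exI[of _ "overlap d c"] exI[of _ "\<lambda>z. \<psi> (transition d c z)"]) auto
    next
      case False
      \<comment> \<open>Outside the domain of \<open>c\<close> the point has a neighbourhood that
        misses \<open>K\<close>, where the function is identically zero.\<close>
      then have nK: "inv_c d y \<notin> K" using KU by blast
      have "open (- K)" using K compact_imp_closed by blast
      note o = dd(8)[OF this]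
      have "inv_c d z \<notin> K" if "z \<in> snd d ` (dom_c d \<inter> - K)" for z
        using that dd(3) by auto
      then have "\<forall>z\<in>snd d ` (dom_c d \<inter> - K). \<eta> (inv_c d z) = 0" using z by blast
      moreover have "y \<in> snd d ` (dom_c d \<inter> - K)"
        using nK dd(4,5)[OF y] by (metis ComplI IntI image_eqI)
      ultimately show ?thesis
        by (intro exI[of _ "snd d ` (dom_c d \<inter> - K)"] exI[of _ "\<lambda>_. 0"] conjI o smooth_on_const)
    qed
  qed
  define V where "V = inv_c c ` ball x r"
  have "V = dom_c c \<inter> snd c -` ball x r"
  proof -
    have "q \<in> V \<longleftrightarrow> q \<in> dom_c c \<and> snd c q \<in> ball x r" for q
    proof
      assume "q \<in> V"
      then obtain y where y: "y \<in> ball x r" "q = inv_c c y" by (auto simp: V_def)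
      then have "y \<in> img_c c" using sub by auto
      then show "q \<in> dom_c c \<and> snd c q \<in> ball x r" using y cc(4,5) by auto
    next
      assume q: "q \<in> dom_c c \<and> snd c q \<in> ball x r"
      then have "q = inv_c c (snd c q)" using cc(3) by simp
      then show "q \<in> V" unfolding V_def using q by blast
    qed
    then show ?thesis by blast
  qed
  then have V: "open V" using continuous_open_preimage[OF cc(6,1) open_ball] by simp
  have pV: "p \<in> V" unfolding \<open>V = dom_c c \<inter> snd c -` ball x r\<close> using p r by (simp add: x_def)
  have pos: "\<eta> q > 0" if "q \<in> V" for q
  proof -
    have "dist x (snd c q) < r" "q \<in> dom_c c" using that unfolding \<open>V = dom_c c \<inter> snd c -` ball x r\<close> by auto
    moreover have "(dist x (snd c q))\<^sup>2 < r\<^sup>2" using calculation r by (intro power_strict_mono) auto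
    ultimately show ?thesis by (simp add: \<eta>_def \<psi>_def sq flat_one(3))
  qed
  show ?thesis
    by (rule that[OF s K KU _ _ z V pV pos]) (auto simp: \<eta>_def \<psi>_def flat_one)
qed

lemma smooth_fun_D: "smooth_fun A f \<Longrightarrow> c \<in> A \<Longrightarrow> smooth_on (img_c c) (\<lambda>x. f (inv_c c x))"
  by (auto simp: smooth_fun_def o_def)

lemma smooth_fun_sum:
  assumes "\<And>i. i \<in> I \<Longrightarrow> smooth_fun A (f i)"
  shows "smooth_fun A (\<lambda>q. \<Sum>i\<in>I. f i q)"
  unfolding smooth_fun_def o_def
  by (intro ballI smooth_on_sum is_chart_facts(2) atlas_facts(1)[OF A] smooth_fun_D assms)

lemma smooth_fun_divide:
  assumes "smooth_fun A f" "smooth_fun A h" "\<And>q. h q \<noteq> 0"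
  shows "smooth_fun A (\<lambda>q. f q / h q)"
  unfolding smooth_fun_def o_def
  by (intro ballI smooth_on_divide is_chart_facts(2) atlas_facts(1)[OF A] smooth_fun_D assms)

lemma partition_of_unity_exists:
  assumes "compact (UNIV :: 'm set)"
  shows "\<exists>C \<rho>. partition_of_unity A C \<rho>"
proof -
  define Q where "Q p \<eta> K V \<longleftrightarrow> smooth_fun A \<eta> \<and> compact K \<and> K \<subseteq> dom_c (chart_at A p) \<and> (\<forall>q. 0 \<le> \<eta> q) \<and>
      (\<forall>q. q \<notin> K \<longrightarrow> \<eta> q = (0::real)) \<and> open V \<and> p \<in> V \<and> (\<forall>q\<in>V. \<eta> q > 0)" for p \<eta> K V
  have "\<exists>\<eta> K V. Q p \<eta> K V" for p
  proof -
    obtain \<eta> K V where "smooth_fun A \<eta>" "compact K" "K \<subseteq> dom_c (chart_at A p) \<inter> UNIV" "\<And>q. 0 \<le> \<eta> q" "\<And>q. \<eta> q \<le> 1"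
      "\<And>q. q \<notin> K \<Longrightarrow> \<eta> q = (0::real)" "open V" "p \<in> V" "\<And>q. q \<in> V \<Longrightarrow> \<eta> q > 0"
      using bump_function[OF atlas_facts(5,6)[OF A] UNIV_I open_UNIV] by blast
    then show ?thesis unfolding Q_def by (intro exI[of _ \<eta>] exI[of _ K] exI[of _ V]) auto
  qed
  then obtain \<eta> K V where "\<And>p. Q p (\<eta> p) (K p) (V p)" by metis
  then have s: "\<And>p. smooth_fun A (\<eta> p)" and K: "\<And>p. compact (K p)" "\<And>p. K p \<subseteq> dom_c (chart_at A p)"
    and nn: "\<And>p q. (0::real) \<le> \<eta> p q" and z: "\<And>p q. q \<notin> K p \<Longrightarrow> \<eta> p q = 0"
    and V: "\<And>p. open (V p)" "\<And>p. p \<in> V p" "\<And>p q. q \<in> V p \<Longrightarrow> \<eta> p q > 0"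
    unfolding Q_def by auto
  obtain P where P: "finite P" "(UNIV :: 'm set) \<subseteq> (\<Union>p\<in>P. V p)"
  proof -
    have "(UNIV :: 'm set) \<subseteq> (\<Union>p\<in>UNIV. V p)" using V(2) by blast
    from compactE_image[OF assms, of UNIV V, OF V(1) this] show ?thesis using that by metis
  qed
  define \<sigma> where "\<sigma> q = (\<Sum>p\<in>P. \<eta> p q)" for q
  have pos: "\<sigma> q > 0" for q
  proof -
    obtain p where "p \<in> P" "q \<in> V p" using P by blast
    then show ?thesis unfolding \<sigma>_def using V(3) nn by (intro sum_pos2[OF P(1)]) auto
  qed
  define C where "C = chart_at A ` P"
  \<comment> \<open>The weights are indexed by charts, whereas the covering is indexed by points;
    bumps whose centres share a preferred chart are added up before normalizing by \<sigma>.\<close>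
  define \<rho> where "\<rho> c q = (\<Sum>p\<in>{p\<in>P. chart_at A p = c}. \<eta> p q) / \<sigma> q" for c q
  have "partition_of_unity A C \<rho>"
    unfolding partition_of_unity_def
  proof (intro conjI ballI allI)
    show "finite C" using P by (simp add: C_def)
    show "C \<subseteq> A" using atlas_facts(5)[OF A] by (auto simp: C_def)
    show "(\<Sum>c\<in>C. \<rho> c q) = 1" for q
    proof -
      have "(\<Sum>c\<in>C. \<Sum>p\<in>{p\<in>P. chart_at A p = c}. \<eta> p q) = \<sigma> q"
        unfolding \<sigma>_def C_def by (rule sum.group[OF P(1)]) (use P in auto)
      then show ?thesis using pos[of q] unfolding \<rho>_def by (simp add: sum_divide_distrib[symmetric])
    qed
    fix c assume "c \<in> C"
    show "smooth_fun A (\<rho> c)"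
      unfolding \<rho>_def using pos by (intro smooth_fun_divide smooth_fun_sum s) (auto simp: \<sigma>_def less_imp_neq[symmetric] intro: smooth_fun_sum s)
    show "\<rho> c q \<ge> 0" for q
      unfolding \<rho>_def using pos[of q] nn by (intro divide_nonneg_nonneg sum_nonneg) auto
    have cl: "closed (\<Union>p\<in>{p\<in>P. chart_at A p = c}. K p)"
      using P K by (intro closed_UN) (auto intro: compact_imp_closed)
    have "{q. \<rho> c q \<noteq> 0} \<subseteq> (\<Union>p\<in>{p\<in>P. chart_at A p = c}. K p)"
    proof
      fix q assume "q \<in> {q. \<rho> c q \<noteq> 0}"
      then have "(\<Sum>p\<in>{p\<in>P. chart_at A p = c}. \<eta> p q) \<noteq> 0" by (auto simp: \<rho>_def)
      then obtain p where "p \<in> {p\<in>P. chart_at A p = c}" "\<eta> p q \<noteq> 0" by (meson sum.neutral)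
      then show "q \<in> (\<Union>p\<in>{p\<in>P. chart_at A p = c}. K p)" using z by blast
    qed
    then have "closure {q. \<rho> c q \<noteq> 0} \<subseteq> (\<Union>p\<in>{p\<in>P. chart_at A p = c}. K p)"
      by (rule closure_minimal[OF _ cl])
    then show "closure {q. \<rho> c q \<noteq> 0} \<subseteq> dom_c c" using K(2) by fastforce
  qed
  then show ?thesis by blast
qed

end

section \<open>The integral of a function\<close>

lemma gram_pullback:
  assumes L: "linear L" and G: "bilinear G"
  shows "det (gram (\<lambda>u v. G (L u) (L v))) = (det (matrix L))\<^sup>2 * det (gram G :: real^'d::finite^'d)"
proof -
  have "gram (\<lambda>u v. G (L u) (L v)) $ i $ j = (transpose (matrix L) ** gram G ** matrix L) $ i $ j" for i j
  proof -
    have "(transpose (matrix L) ** gram G ** matrix L) $ i $ j =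
        (\<Sum>l\<in>UNIV. (\<Sum>k\<in>UNIV. L (axis i 1) $ k * G (axis k 1) (axis l 1)) * L (axis j 1) $ l)"
      by (simp add: matrix_matrix_mult_def transpose_def matrix_def gram_def)
    also have "\<dots> = (\<Sum>k\<in>UNIV. \<Sum>l\<in>UNIV. L (axis i 1) $ k * L (axis j 1) $ l * G (axis k 1) (axis l 1))"
      by (rule sum_product_swap)
    also have "\<dots> = G (L (axis i 1)) (L (axis j 1))" by (rule bilinear_axis_sum[OF G, symmetric])
    finally show ?thesis by (simp add: gram_def)
  qed
  then have "gram (\<lambda>u v. G (L u) (L v)) = transpose (matrix L) ** gram G ** matrix L" by (simp add: vec_eq_iff)
  then show ?thesis by (simp add: det_mul det_transpose power2_eq_square mult_ac)
qed

lemma integral_eq_subset: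
  assumes "T \<subseteq> S" "\<And>x. x \<in> S - T \<Longrightarrow> f x = 0"
  shows "integral S f = integral T (f :: 'a::euclidean_space \<Rightarrow> real)"
proof -
  have "(\<lambda>x. if x \<in> S then f x else 0) = (\<lambda>x. if x \<in> T then f x else 0)"
    using assms by (auto simp: fun_eq_iff)
  then show ?thesis using integral_restrict_UNIV[of S f] integral_restrict_UNIV[of T f] by simp
qed

definition chart_continuous :: "('m, 'd::finite) chart set \<Rightarrow> ('m \<Rightarrow> real) \<Rightarrow> bool" where
  "chart_continuous A f \<longleftrightarrow> (\<forall>c\<in>A. continuous_on (img_c c) (\<lambda>x. f (inv_c c x)))"

definition vol_density :: "('m, 'd::finite) chart set \<Rightarrow> ('m, 'd) field2 \<Rightarrow> ('m, 'd) chart \<Rightarrow> real^'d \<Rightarrow> real" where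
  "vol_density A g c x = sqrt (det (gram (loc2 A c g x)))"

definition volume_integral :: "('m::t2_space, 'd::finite) chart set \<Rightarrow> ('m, 'd) field2 \<Rightarrow> ('m \<Rightarrow> real) \<Rightarrow> real" where
  "volume_integral A g f = integral_top A (\<lambda>p v. f p * volume_form g p v)"

text \<open>Names the very choice made inside \<open>integral_top\<close>, so that the integral
  unfolds to a sum with a fixed partition of unity.\<close>

definition pou_of :: "('m::t2_space, 'd::finite) chart set \<Rightarrow> ('m, 'd) chart set \<times> (('m, 'd) chart \<Rightarrow> 'm \<Rightarrow> real)" where
  "pou_of A = (SOME (C, \<rho>). partition_of_unity A C \<rho>)"

definition pou_charts :: "('m::t2_space, 'd::finite) chart set \<Rightarrow> ('m, 'd) chart set" where
  "pou_charts A = fst (pou_of A)"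

definition pou_weight :: "('m::t2_space, 'd::finite) chart set \<Rightarrow> ('m, 'd) chart \<Rightarrow> 'm \<Rightarrow> real" where
  "pou_weight A = snd (pou_of A)"

definition pou_support :: "('m::t2_space, 'd::finite) chart set \<Rightarrow> ('m, 'd) chart \<Rightarrow> 'm set" where
  "pou_support A c = closure {p. pou_weight A c p \<noteq> 0}"

context
  fixes A :: "('m::t2_space, 'd::finite) chart set" and g :: "('m, 'd) field2"
  assumes cpt: "compact (UNIV :: 'm set)" and OA: "oriented_atlas A" and g: "riemannian_metric A g"
begin

lemma smooth_A: "smooth_atlas A" using OA by (simp add: oriented_atlas_def)

lemma vol_density_facts:
  assumes "c \<in> A"
  shows "smooth_on (img_c c) (vol_density A g c)" "\<And>x. x \<in> img_c c \<Longrightarrow> vol_density A g c x > 0"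
  using smooth_sqrt_det[OF riemannian_metric_on[OF smooth_A g assms]] sqrt_det_pos[OF riemannian_metric_on[OF smooth_A g assms]]
  by (auto simp: vol_density_def[abs_def])

lemma volume_form_coord:
  assumes c: "c \<in> A" and x: "x \<in> img_c c"
  shows "volume_form g (inv_c c x) (\<chi> i. from_coord A c (inv_c c x) (axis i 1)) = vol_density A g c x"
proof -
  define e where "e = chart_at A (inv_c c x)"
  note t = transition_at[OF smooth_A c x, folded e_def]
  let ?L = "from_coord A c (inv_c c x)"
  have L: "linear ?L" by (rule from_coord_linear[OF smooth_A t(8,12)])
  have Leq: "?L = FD (transition c e) x" using t(7) by (simp add: fun_eq_iff)
  have pos: "det (matrix ?L) > 0" unfolding Leq using OA c t(1,2) unfolding oriented_atlas_def by blast
  have M: "(\<chi> i. ?L (axis i 1)) = transpose (matrix ?L)" by (simp add: vec_eq_iff transpose_def matrix_def)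
  have bg: "bilinear (g (inv_c c x))" using riemannian_pos_inner[OF smooth_A g] by (simp add: pos_inner_def)
  have "vol_density A g c x = sqrt ((det (matrix ?L))\<^sup>2 * det (gram (g (inv_c c x))))"
    unfolding vol_density_def gram_pullback[OF L bg, symmetric] loc2_def[abs_def] ..
  then show ?thesis using pos
    by (simp add: volume_form_def M det_transpose real_sqrt_mult gram_def)
qed

lemma vol_density_change:
  assumes c: "c \<in> A" and d: "d \<in> A" and x: "x \<in> overlap c d"
  shows "\<bar>det (matrix (FD (transition c d) x))\<bar> * vol_density A g d (transition c d x) = vol_density A g c x"
proof -
  note at = atlas_facts[OF smooth_A]
  note t = transition_facts[OF at(1)[OF c] at(1)[OF d] at(4)[OF c d]]
  have L: "linear (FD (transition c d) x)" by (rule FD_linear[OF smooth_on_differentiable[OF t(2) x]])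
  have "transition c d x \<in> img_c d" using t(4) x by blast
  note b = metric_on_facts(3)[OF riemannian_metric_on[OF smooth_A g d] this]
  have "loc2 A c g x = (\<lambda>u v. loc2 A d g (transition c d x) (FD (transition c d) x u) (FD (transition c d) x v))"
    using loc_change(2)[OF smooth_A at(2)[OF c] at(2)[OF d] at(4)[OF c d] x] by (simp add: fun_eq_iff)
  then show ?thesis unfolding vol_density_def using gram_pullback[OF L b] by (simp add: real_sqrt_mult)
qed


lemma pou: "partition_of_unity A (pou_charts A) (pou_weight A)"
proof -
  have "\<exists>z. case z of (C, \<rho>) \<Rightarrow> partition_of_unity A C \<rho>"
    using partition_of_unity_exists[OF smooth_A cpt] by auto
  then have "case pou_of A of (C, \<rho>) \<Rightarrow> partition_of_unity A C \<rho>"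
    unfolding pou_of_def by (rule someI_ex)
  then show ?thesis by (simp add: case_prod_beta pou_charts_def pou_weight_def)
qed

lemma pou_facts:
  shows "finite (pou_charts A)" "pou_charts A \<subseteq> A" "\<And>c. c \<in> pou_charts A \<Longrightarrow> smooth_fun A (pou_weight A c)" "\<And>c p. c \<in> pou_charts A \<Longrightarrow> pou_weight A c p \<ge> 0"
    "\<And>c. c \<in> pou_charts A \<Longrightarrow> pou_support A c \<subseteq> dom_c c" "\<And>c. compact (pou_support A c)"
    "\<And>p. (\<Sum>c\<in>pou_charts A. pou_weight A c p) = 1" "\<And>c p. p \<notin> pou_support A c \<Longrightarrow> pou_weight A c p = 0"
proof -
  show "finite (pou_charts A)" "pou_charts A \<subseteq> A" "\<And>c. c \<in> pou_charts A \<Longrightarrow> smooth_fun A (pou_weight A c)" "\<And>c p. c \<in> pou_charts A \<Longrightarrow> pou_weight A c p \<ge> 0"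
    "\<And>c. c \<in> pou_charts A \<Longrightarrow> pou_support A c \<subseteq> dom_c c" "\<And>p. (\<Sum>c\<in>pou_charts A. pou_weight A c p) = 1"
    using pou by (auto simp: partition_of_unity_def pou_support_def)
  show "compact (pou_support A c)" for c
    using compact_Int_closed[OF cpt, of "pou_support A c"] by (simp add: pou_support_def)
  show "p \<notin> pou_support A c \<Longrightarrow> pou_weight A c p = 0" for c p
    using closure_subset[of "{p. pou_weight A c p \<noteq> 0}"] by (auto simp: pou_support_def)
qed

lemma volume_integral_eq:
  "volume_integral A g f = (\<Sum>c\<in>pou_charts A. integral (img_c c) (\<lambda>x. pou_weight A c (inv_c c x) * f (inv_c c x) * vol_density A g c x))"
proof -
  have "volume_integral A g f = (\<Sum>c\<in>pou_charts A. integral (img_c c) (\<lambda>x. pou_weight A c (inv_c c x) *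
    (f (inv_c c x) * volume_form g (inv_c c x) (\<chi> i. from_coord A c (inv_c c x) (axis i 1)))))"
    unfolding volume_integral_def integral_top_def pou_of_def[symmetric] Let_def pou_charts_def pou_weight_def by (simp add: case_prod_beta)
  also have "\<dots> = (\<Sum>c\<in>pou_charts A. integral (img_c c) (\<lambda>x. pou_weight A c (inv_c c x) * f (inv_c c x) * vol_density A g c x))"
  proof (rule sum.cong[OF refl], rule Henstock_Kurzweil_Integration.integral_cong)
    fix c x assume "c \<in> pou_charts A" "x \<in> img_c c"
    then have "volume_form g (inv_c c x) (\<chi> i. from_coord A c (inv_c c x) (axis i 1)) = vol_density A g c x"
      using pou_facts(2) volume_form_coord by blast
    then show "pou_weight A c (inv_c c x) * (f (inv_c c x) * volume_form g (inv_c c x) (\<chi> i. from_coord A c (inv_c c x) (axis i 1)))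
      = pou_weight A c (inv_c c x) * f (inv_c c x) * vol_density A g c x" by simp
  qed
  finally show ?thesis .
qed

lemma chart_compact:
  assumes "c \<in> A" "compact K" "K \<subseteq> dom_c c"
  shows "compact (snd c ` K)" "snd c ` K \<subseteq> img_c c" "\<And>x. x \<in> img_c c - snd c ` K \<Longrightarrow> inv_c c x \<notin> K"
proof -
  note c = is_chart_facts[OF atlas_facts(1)[OF smooth_A assms(1)]]
  show "compact (snd c ` K)" by (rule compact_continuous_image[OF continuous_on_subset[OF c(6) assms(3)] assms(2)])
  show "snd c ` K \<subseteq> img_c c" using assms(3) by auto
  show "x \<in> img_c c - snd c ` K \<Longrightarrow> inv_c c x \<notin> K" for x
    using c(5)[of x] by (metis DiffD1 DiffD2 image_eqI)
qed

lemma pou_term: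
  assumes c: "c \<in> pou_charts A" and f: "chart_continuous A f"
  shows "continuous_on (img_c c) (\<lambda>x. pou_weight A c (inv_c c x) * f (inv_c c x) * vol_density A g c x)"
    "compact (snd c ` pou_support A c)" "snd c ` pou_support A c \<subseteq> img_c c" "open (img_c c)" "c \<in> A"
    "\<And>x. x \<in> img_c c - snd c ` pou_support A c \<Longrightarrow> pou_weight A c (inv_c c x) * f (inv_c c x) * vol_density A g c x = 0"
proof -
  show cA: "c \<in> A" using c pou_facts(2) by blast
  note k = chart_compact[OF cA pou_facts(6) pou_facts(5)[OF c]]
  show "compact (snd c ` pou_support A c)" "snd c ` pou_support A c \<subseteq> img_c c" by (rule k)+
  show "open (img_c c)" by (rule is_chart_facts(2)[OF atlas_facts(1)[OF smooth_A cA]])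
  show "continuous_on (img_c c) (\<lambda>x. pou_weight A c (inv_c c x) * f (inv_c c x) * vol_density A g c x)"
    using f cA smooth_on_imp_continuous_on[OF smooth_fun_D[OF smooth_A pou_facts(3)[OF c] cA]]
      smooth_on_imp_continuous_on[OF vol_density_facts(1)[OF cA]]
    by (intro continuous_on_mult) (auto simp: chart_continuous_def)
  show "pou_weight A c (inv_c c x) * f (inv_c c x) * vol_density A g c x = 0" if "x \<in> img_c c - snd c ` pou_support A c" for x
    using k(3)[OF that] pou_facts(8) by simp
qed

lemma pou_term_integrable:
  assumes c: "c \<in> pou_charts A" and f: "chart_continuous A f"
  shows "(\<lambda>x. pou_weight A c (inv_c c x) * f (inv_c c x) * vol_density A g c x) integrable_on img_c c"
  using compactly_supported_absolutely_integrable[OF pou_term(4,2,3,1,6)[OF c f]] set_lebesgue_integral_eq_integral(1) by blast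

lemma volume_integral_diff:
  assumes "chart_continuous A f" "chart_continuous A k"
  shows "volume_integral A g (\<lambda>p. f p - k p) = volume_integral A g f - volume_integral A g k"
proof -
  have "integral (img_c c) (\<lambda>x. pou_weight A c (inv_c c x) * (f (inv_c c x) - k (inv_c c x)) * vol_density A g c x) =
    integral (img_c c) (\<lambda>x. pou_weight A c (inv_c c x) * f (inv_c c x) * vol_density A g c x)
    - integral (img_c c) (\<lambda>x. pou_weight A c (inv_c c x) * k (inv_c c x) * vol_density A g c x)" if "c \<in> pou_charts A" for c
    using Henstock_Kurzweil_Integration.integral_diff[OF pou_term_integrable[OF that assms(1)] pou_term_integrable[OF that assms(2)]]
    by (simp add: left_diff_distrib right_diff_distrib)
  then show ?thesis unfolding volume_integral_eq by (simp add: sum_subtractf)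
qed

lemma volume_integral_sum:
  assumes "finite I" "\<And>i. i \<in> I \<Longrightarrow> chart_continuous A (f i)"
  shows "volume_integral A g (\<lambda>p. \<Sum>i\<in>I. f i p) = (\<Sum>i\<in>I. volume_integral A g (f i))"
proof -
  have "integral (img_c c) (\<lambda>x. pou_weight A c (inv_c c x) * (\<Sum>i\<in>I. f i (inv_c c x)) * vol_density A g c x) =
    (\<Sum>i\<in>I. integral (img_c c) (\<lambda>x. pou_weight A c (inv_c c x) * f i (inv_c c x) * vol_density A g c x))" if "c \<in> pou_charts A" for c
    using Henstock_Kurzweil_Integration.integral_sum[OF assms(1) pou_term_integrable[OF that assms(2)]]
    by (simp add: sum_distrib_left sum_distrib_right)
  then show ?thesis unfolding volume_integral_eq by (simp add: sum.swap[of _ I])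
qed

text \<open>All charts contribute nonnegative terms, so each contribution vanishes, and some weight
  is nonzero at \<open>p\<close>. In that chart a continuous nonnegative function with zero integral
  over a box vanishes, and the density is positive.\<close>

lemma volume_integral_eq_0_imp:
  assumes f: "chart_continuous A f" and nn: "\<And>p. f p \<ge> 0" and 0: "volume_integral A g f = 0"
  shows "f p = 0"
proof -
  have tn: "pou_weight A c (inv_c c x) * f (inv_c c x) * vol_density A g c x \<ge> 0" if "c \<in> pou_charts A" "x \<in> img_c c" for c x
    using pou_facts(4)[OF that(1)] nn vol_density_facts(2)[OF _ that(2)] that pou_facts(2)
    by (intro mult_nonneg_nonneg) (auto intro: less_imp_le)
  have "integral (img_c c) (\<lambda>x. pou_weight A c (inv_c c x) * f (inv_c c x) * vol_density A g c x) = 0" if "c \<in> pou_charts A" for c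
  proof -
    have "\<forall>c\<in>pou_charts A. integral (img_c c) (\<lambda>x. pou_weight A c (inv_c c x) * f (inv_c c x) * vol_density A g c x) = 0"
      using 0 unfolding volume_integral_eq
      by (subst (asm) sum_nonneg_eq_0_iff[OF pou_facts(1)])
        (auto intro!: integral_nonneg pou_term_integrable f tn simp del: mult_eq_0_iff)
    then show ?thesis using that by blast
  qed note int0 = this
  have "\<exists>c\<in>pou_charts A. pou_weight A c p \<noteq> 0"
  proof (rule ccontr)
    assume "\<not> ?thesis"
    then have "(\<Sum>c\<in>pou_charts A. pou_weight A c p) = 0" by (intro sum.neutral) auto
    then show False using pou_facts(7) by simp
  qed
  then obtain c where c: "c \<in> pou_charts A" "pou_weight A c p \<noteq> 0" by blast
  note t = pou_term[OF c(1) f]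
  have p: "p \<in> dom_c c" using c pou_facts(5,8) by blast
  let ?w = "\<lambda>x. pou_weight A c (inv_c c x) * f (inv_c c x) * vol_density A g c x"
  let ?e = "\<lambda>x. if x \<in> img_c c then ?w x else 0"
  define x where "x = snd c p"
  have x: "x \<in> img_c c" "inv_c c x = p"
    using p is_chart_facts(3)[OF atlas_facts(1)[OF smooth_A t(5)]] by (auto simp: x_def)
  have "bounded (insert x (snd c ` pou_support A c))" using t(2) compact_imp_bounded by simp
  then obtain b where b: "insert x (snd c ` pou_support A c) \<subseteq> box (- b) b" by (rule bounded_subset_box_symmetric)
  have bb: "box (- b) b \<subseteq> cbox (- b) b" by (rule box_subset_cbox)
  have "Ck_on 0 UNIV ?e"
    by (rule Ck_on_zero_extension[OF t(4) compact_imp_closed[OF t(2)]]) (use t in auto)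
  then have cont: "continuous_on (cbox (- b) b) ?e" by (auto intro: continuous_on_subset)
  have "integral (cbox (- b) b) ?e = 0"
    using compactly_supported_integral_cbox[OF t(4,2,3,1,6), of "- b" b] b bb int0[OF c(1)] by auto
  then have "(?e has_integral 0) (cbox (- b) b)"
    using integrable_integral[OF integrable_continuous[OF cont]] by simp
  then have "?e x = 0"
  proof (rule has_integral_0_cbox_imp_0[where f="?e", OF cont, rotated])
    show "box (- b) b \<noteq> {}" "x \<in> cbox (- b) b" using b bb by auto
    show "?e y \<ge> 0" for y using tn[OF c(1)] by simp
  qed
  then show ?thesis using x c(2) vol_density_facts(2)[OF t(5) x(1)] by simp
qed

text \<open>A function supported in one chart can be integrated there: the term of each chart of the
  partition is moved to \<open>c0\<close> by the change of variables, whose determinant is absorbed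
  by the density, and the weights add up to 1.\<close>

lemma volume_integral_local:
  assumes c0: "c0 \<in> A" and K: "compact K" "K \<subseteq> dom_c c0" and f: "chart_continuous A f" "\<And>p. p \<notin> K \<Longrightarrow> f p = 0"
  shows "volume_integral A g f = integral (img_c c0) (\<lambda>x. f (inv_c c0 x) * vol_density A g c0 x)"
proof -
  note at = atlas_facts[OF smooth_A]
  note ch = is_chart_facts[OF at(1)]
  have te: "integral (img_c c) (\<lambda>x. pou_weight A c (inv_c c x) * f (inv_c c x) * vol_density A g c x) =
      integral (img_c c0) (\<lambda>x. pou_weight A c (inv_c c0 x) * f (inv_c c0 x) * vol_density A g c0 x)" if c: "c \<in> pou_charts A" for c
  proof -
    note t = pou_term[OF c f(1)]
    note cA = t(5)
    note tr = transition_facts[OF at(1)[OF c0] at(1)[OF cA] at(4)[OF c0 cA]]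
    note tr' = transition_facts[OF at(1)[OF cA] at(1)[OF c0] at(4)[OF cA c0]]
    let ?w = "\<lambda>x. pou_weight A c (inv_c c x) * f (inv_c c x) * vol_density A g c x"
    let ?T = "transition c0 c" and ?S = "overlap c0 c"
    let ?v = "\<lambda>x. pou_weight A c (inv_c c0 x) * f (inv_c c0 x) * vol_density A g c0 x"
    have F: "?T ` ?S = overlap c c0" by (rule tr(4))
    have w0: "\<bar>det (matrix (FD ?T x))\<bar> * ?w (?T x) = ?v x" if x: "x \<in> ?S" for x
      using vol_density_change[OF c0 cA x] tr(6)[OF x] by (simp add: mult_ac)
    \<comment> \<open>The common support lies in both chart domains, so its image is a compact
      subset of the overlap, as the change of variables requires.\<close>
    define K' where "K' = K \<inter> pou_support A c"
    have K': "compact K'" "K' \<subseteq> dom_c c"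
      using K pou_facts(5,6)[of c] c by (auto simp: K'_def intro: compact_Int)
    have K'': "snd c ` K' \<subseteq> overlap c c0" using K(2) K'(2) by (auto simp: K'_def)
    have cont0: "continuous_on (img_c c0) ?v"
      using f c0 smooth_on_imp_continuous_on[OF smooth_fun_D[OF smooth_A pou_facts(3)[OF c] c0]]
        smooth_on_imp_continuous_on[OF vol_density_facts(1)[OF c0]]
      by (intro continuous_on_mult) (auto simp: chart_continuous_def)
    have "integral (img_c c) ?w = integral (overlap c c0) ?w"
    proof (rule integral_eq_subset)
      show "overlap c c0 \<subseteq> img_c c" by auto
      fix x assume x: "x \<in> img_c c - overlap c c0"
      then have "inv_c c x \<notin> dom_c c0" using tr'(8) by blast
      then show "?w x = 0" using f(2) K(2) by auto
    qed
    also have "\<dots> = integral ?S (\<lambda>x. \<bar>det (matrix (FD ?T x))\<bar> * ?w (?T x))"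
      unfolding F[symmetric]
    proof (rule integral_change_of_variables[where K="snd c ` K'" and G="transition c c0", symmetric])
      show "open ?S" by (rule tr(1))
      show "(?T has_derivative FD ?T x) (at x)" if "x \<in> ?S" for x
        by (rule FD_has[OF smooth_on_differentiable[OF tr(2) that]])
      show "inj_on ?T ?S" by (rule inj_on_inverseI[of _ "transition c c0"]) (rule tr(5))
      show "open (?T ` ?S)" unfolding F by (rule tr'(1))
      show "compact (snd c ` K')" by (rule chart_compact(1)[OF cA K'])
      show "snd c ` K' \<subseteq> ?T ` ?S" unfolding F by (rule K'')
      show "continuous_on (?T ` ?S) ?w" unfolding F by (rule continuous_on_subset[OF t(1)]) auto
      show "continuous_on (?T ` ?S) (transition c c0)"
        unfolding F by (rule smooth_on_imp_continuous_on[OF tr'(2)])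
      show "transition c c0 (?T x) = x" if "x \<in> ?S" for x by (rule tr(5)[OF that])
      show "?w x = 0" if "x \<in> ?T ` ?S - snd c ` K'" for x
      proof -
        have "x \<in> img_c c - snd c ` K'" using that unfolding F by auto
        from chart_compact(3)[OF cA K' this] have "inv_c c x \<notin> K \<or> inv_c c x \<notin> pou_support A c" by (auto simp: K'_def)
        then show ?thesis using f(2)[of "inv_c c x"] pou_facts(8)[of "inv_c c x" c] by auto
      qed
      have "continuous_on ?S ?v" by (rule continuous_on_subset[OF cont0]) auto
      then show "continuous_on ?S (\<lambda>x. \<bar>det (matrix (FD ?T x))\<bar> * ?w (?T x))"
        using continuous_on_cong[of ?S ?S "\<lambda>x. \<bar>det (matrix (FD ?T x))\<bar> * ?w (?T x)" ?v] w0 by auto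
    qed
    also have "\<dots> = integral ?S ?v"
      by (rule Henstock_Kurzweil_Integration.integral_cong) (rule w0)
    also have "\<dots> = integral (img_c c0) ?v"
    proof (rule integral_eq_subset[symmetric])
      show "?S \<subseteq> img_c c0" by auto
      fix x assume x: "x \<in> img_c c0 - ?S"
      then have "inv_c c0 x \<notin> dom_c c" using tr(8) by blast
      then have "inv_c c0 x \<notin> pou_support A c" using pou_facts(5)[OF c] by blast
      then show "?v x = 0" using pou_facts(8)[of "inv_c c0 x" c] by simp
    qed
    finally show ?thesis .
  qed
  have int: "(\<lambda>x. pou_weight A c (inv_c c0 x) * f (inv_c c0 x) * vol_density A g c0 x) integrable_on img_c c0" if c: "c \<in> pou_charts A" for c
  proof -
    have "continuous_on (img_c c0) (\<lambda>x. pou_weight A c (inv_c c0 x) * f (inv_c c0 x) * vol_density A g c0 x)"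
      using f c0 smooth_on_imp_continuous_on[OF smooth_fun_D[OF smooth_A pou_facts(3)[OF c] c0]]
        smooth_on_imp_continuous_on[OF vol_density_facts(1)[OF c0]]
      by (intro continuous_on_mult) (auto simp: chart_continuous_def)
    from compactly_supported_absolutely_integrable[OF ch(2)[OF c0] chart_compact(1,2)[OF c0 K] this]
    show ?thesis using chart_compact(3)[OF c0 K] f(2) set_lebesgue_integral_eq_integral(1) by (simp add: Ball_def)
  qed
  have "volume_integral A g f = (\<Sum>c\<in>pou_charts A. integral (img_c c0) (\<lambda>x. pou_weight A c (inv_c c0 x) * f (inv_c c0 x) * vol_density A g c0 x))"
    unfolding volume_integral_eq using te by simp
  also have "\<dots> = integral (img_c c0) (\<lambda>x. \<Sum>c\<in>pou_charts A. pou_weight A c (inv_c c0 x) * f (inv_c c0 x) * vol_density A g c0 x)"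
    by (rule Henstock_Kurzweil_Integration.integral_sum[OF pou_facts(1) int, symmetric])
  also have "\<dots> = integral (img_c c0) (\<lambda>x. f (inv_c c0 x) * vol_density A g c0 x)"
    by (simp add: sum_distrib_right[symmetric] pou_facts(7))
  finally show ?thesis .
qed

end

section \<open>Stokes' theorem for the codifferential\<close>

definition ext_d1_pairing ::
  "('m::t2_space, 'd::finite) chart set \<Rightarrow> ('m, 'd) field2 \<Rightarrow> ('m, 'd) field2 \<Rightarrow> ('m, 'd) field1 \<Rightarrow> 'm \<Rightarrow> real" where
  "ext_d1_pairing A g \<alpha> \<beta> p = inner_form2 (g p) (\<alpha> p) (ext_d1 A \<beta> p)"

definition codiff_pairing ::
  "('m::t2_space, 'd::finite) chart set \<Rightarrow> ('m, 'd) field2 \<Rightarrow> ('m, 'd) field2 \<Rightarrow> ('m, 'd) field1 \<Rightarrow> 'm \<Rightarrow> real" where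
  "codiff_pairing A g \<alpha> \<beta> p =
    (\<Sum>i\<in>UNIV. codiff2 A g \<alpha> p (some_frame (g p) i) * \<beta> p (some_frame (g p) i))"

lemma inner_form2_add: "inner_form2 G a (\<lambda>u v. b u v + b' u v) = inner_form2 G a b + inner_form2 G a b'"
  by (simp add: inner_form2_def Let_def distrib_left sum.distrib add_divide_distrib)

lemma inner_form2_zero: "inner_form2 G a (\<lambda>u v. 0) = 0"
  by (simp add: inner_form2_def Let_def)

lemma inner_form2_sum: "inner_form2 G a (\<lambda>u v. \<Sum>c\<in>C. b c u v) = (\<Sum>c\<in>C. inner_form2 G a (b c))"
  by (induction C rule: infinite_finite_induct) (simp_all add: inner_form2_add inner_form2_zero)

lemma linear_mult_bilinear:
  assumes "linear f" "linear h"
  shows "bilinear (\<lambda>u v. f u * h v :: real)"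
  unfolding bilinear_def
  by (intro conjI allI linearI)
    (simp_all add: linear_add[OF assms(1)] linear_add[OF assms(2)] linear_cmul[OF assms(1)] linear_cmul[OF assms(2)] algebra_simps)

context
  fixes A :: "('m::t2_space, 'd::finite) chart set" and g :: "('m, 'd) field2"
  assumes cpt: "compact (UNIV :: 'm set)" and OA: "oriented_atlas A" and g: "riemannian_metric A g"
begin

lemma pairings_in_chart:
  assumes a: "form2 A \<alpha>" and b: "form1 A \<beta>" and c: "c \<in> A" and x: "x \<in> img_c c"
  shows "ext_d1_pairing A g \<alpha> \<beta> (inv_c c x) = inner2 (loc2 A c g x) (loc2 A c \<alpha> x) (ext_d1_eucl (loc1 A c \<beta>) x)"
    and "codiff_pairing A g \<alpha> \<beta> (inv_c c x) =
      metric_trace (loc2 A c g x) (\<lambda>u v. loc1 A c (codiff2 A g \<alpha>) x u * loc1 A c \<beta> x v)"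
proof -
  note SA = smooth_A[OF cpt OA g]
  have "loc2 A c (ext_d1 A \<beta>) x = ext_d1_eucl (loc1 A c \<beta>) x"
    using loc_ext_d1[OF SA b c x] by (simp add: fun_eq_iff)
  moreover have "ext_d1_pairing A g \<alpha> \<beta> (inv_c c x) =
      inner2 (loc2 A c g x) (loc2 A c \<alpha> x) (loc2 A c (ext_d1 A \<beta>) x)"
    unfolding ext_d1_pairing_def
    by (rule inner_form2_in_chart[OF SA g c x form2_facts(4)[OF SA a c] bilinear_ext_d1[OF SA b]])
  ultimately show "ext_d1_pairing A g \<alpha> \<beta> (inv_c c x) = inner2 (loc2 A c g x) (loc2 A c \<alpha> x) (ext_d1_eucl (loc1 A c \<beta>) x)"
    by simp
  have "linear (\<beta> (inv_c c x))" using b by (simp add: form1_def)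
  from linear_mult_bilinear[OF linear_codiff[OF SA g a] this]
  show "codiff_pairing A g \<alpha> \<beta> (inv_c c x) =
      metric_trace (loc2 A c g x) (\<lambda>u v. loc1 A c (codiff2 A g \<alpha>) x u * loc1 A c \<beta> x v)"
    unfolding codiff_pairing_def by (rule trace_in_chart[OF SA g c x]) (simp add: loc1_def)
qed

lemma chart_continuous_pairings:
  assumes a: "form2 A \<alpha>" and b: "form1 A \<beta>"
  shows "chart_continuous A (ext_d1_pairing A g \<alpha> \<beta>)" "chart_continuous A (codiff_pairing A g \<alpha> \<beta>)"
proof -
  note SA = smooth_A[OF cpt OA g]
  have "continuous_on (img_c c) (\<lambda>x. ext_d1_pairing A g \<alpha> \<beta> (inv_c c x))"
    "continuous_on (img_c c) (\<lambda>x. codiff_pairing A g \<alpha> \<beta> (inv_c c x))" if c: "c \<in> A" for c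
  proof -
    note G = riemannian_metric_on[OF SA g c]
    note o = metric_on_facts(1)[OF G]
    have "smooth_on (img_c c) (\<lambda>x. inner2 (loc2 A c g x) (loc2 A c \<alpha> x) (ext_d1_eucl (loc1 A c \<beta>) x))"
      by (rule smooth_inner2[OF G form2_facts(2)[OF SA a c] smooth_ext_d1_eucl[OF o form1_facts(2)[OF SA b c]]])
    from smooth_on_imp_continuous_on[OF this]
    show "continuous_on (img_c c) (\<lambda>x. ext_d1_pairing A g \<alpha> \<beta> (inv_c c x))"
      using pairings_in_chart(1)[OF a b c] by (simp cong: continuous_on_cong)
    have "smooth_on (img_c c) (\<lambda>x. metric_trace (loc2 A c g x) (\<lambda>u v. loc1 A c (codiff2 A g \<alpha>) x u * loc1 A c \<beta> x v))"
      by (rule smooth_metric_trace[OF G, of "\<lambda>x u v. loc1 A c (codiff2 A g \<alpha>) x u * loc1 A c \<beta> x v",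
            OF smooth_on_mult[OF o smooth_codiff[OF SA g a c] form1_facts(2)[OF SA b c]]])
    from smooth_on_imp_continuous_on[OF this]
    show "continuous_on (img_c c) (\<lambda>x. codiff_pairing A g \<alpha> \<beta> (inv_c c x))"
      using pairings_in_chart(2)[OF a b c] by (simp cong: continuous_on_cong)
  qed
  then show "chart_continuous A (ext_d1_pairing A g \<alpha> \<beta>)" "chart_continuous A (codiff_pairing A g \<alpha> \<beta>)"
    unfolding chart_continuous_def by blast+
qed

lemma ext_d1_outside_support:
  assumes K: "compact K" and z: "\<And>p u. p \<notin> K \<Longrightarrow> \<beta> p u = (0::real)" and p: "p \<notin> K"
  shows "ext_d1 A \<beta> p = (\<lambda>u v. 0)"
proof -
  note SA = smooth_A[OF cpt OA g]
  let ?e = "chart_at A p"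
  note e = is_chart_facts[OF atlas_facts(1)[OF SA atlas_facts(5)[OF SA, of p]]]
  have "open (- K)" using K compact_imp_closed by blast
  note o = e(8)[OF this]
  have x: "snd ?e p \<in> snd ?e ` (dom_c ?e \<inter> - K)" using p atlas_facts(6)[OF SA] by blast
  have "FD (\<lambda>y. 0) (snd ?e p) = FD (\<lambda>y. loc1 A ?e \<beta> y u) (snd ?e p)" for u
    by (rule FD_cong[OF o x]) (use e(3) z in \<open>auto simp: loc1_def\<close>)
  then have "FD (\<lambda>y. loc1 A ?e \<beta> y u) (snd ?e p) = (\<lambda>h. 0)" for u by (metis frechet_derivative_const)
  then show ?thesis by (simp add: ext_d1_def ext_d1_eucl_def fun_eq_iff)
qed

text \<open>In the chart, the difference of the pairings times the density is the Euclidean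
  divergence of the compactly supported field \<open>Y\<close>, each term of which integrates to
  zero.\<close>

lemma stokes_local:
  assumes a: "form2 A \<alpha>" and b: "form1 A \<beta>" and c: "c \<in> A" and K: "compact K" "K \<subseteq> dom_c c"
    and z: "\<And>p u. p \<notin> K \<Longrightarrow> \<beta> p u = 0"
  shows "volume_integral A g (\<lambda>p. ext_d1_pairing A g \<alpha> \<beta> p - codiff_pairing A g \<alpha> \<beta> p) = 0"
proof -
  note SA = smooth_A[OF cpt OA g]
  let ?D = "\<lambda>p. ext_d1_pairing A g \<alpha> \<beta> p - codiff_pairing A g \<alpha> \<beta> p"
  let ?G = "loc2 A c g" and ?a = "loc2 A c \<alpha>" and ?b = "loc1 A c \<beta>"
  note G = riemannian_metric_on[OF SA g c]
  note fa = form2_facts[OF SA a c] and fb = form1_facts[OF SA b c]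
  note ch = chart_compact[OF cpt OA g c K]
  have cont: "chart_continuous A ?D"
    using chart_continuous_pairings[OF a b] unfolding chart_continuous_def by (intro ballI continuous_on_diff) auto
  have D0: "?D p = 0" if p: "p \<notin> K" for p
    using ext_d1_outside_support[OF K(1) z p] z[OF p]
    by (simp add: ext_d1_pairing_def codiff_pairing_def inner_form2_zero)
  define X where "X y = sharp (?G y) (\<lambda>w. ?a y w (sharp (?G y) (?b y)))" for y
  define Y where "Y y = sqrt (det (gram (?G y))) *\<^sub>R X y" for y
  have Ys: "smooth_on (img_c c) Y"
  \<comment> \<open>The divergence identity is stated at a point with a frame, which an empty chart
    cannot provide.\<close>
  proof (cases "img_c c = {}")
    case False
    then obtain x where x: "x \<in> img_c c" by blast
    show ?thesis unfolding Y_def[abs_def] X_def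
      by (rule divergence_identity(1)[OF G x orthonormal_some_frame[OF metric_on_facts(2)[OF G x]] fa(1-3) fb])
  next
    case True
    show ?thesis unfolding True by (rule smooth_on_local) simp
  qed
  have eq: "?D (inv_c c x) * vol_density A g c x = (\<Sum>k\<in>UNIV. FD Y x (axis k 1) $ k)" if x: "x \<in> img_c c" for x
  proof -
    note P = metric_on_facts(2)[OF G x]
    define e where "e = some_frame (?G x)"
    have e: "orthonormal_frame (?G x) e" unfolding e_def by (rule orthonormal_some_frame[OF P])
    have 1: "ext_d1_pairing A g \<alpha> \<beta> (inv_c c x) =
        1 / 2 * (\<Sum>i\<in>UNIV. \<Sum>j\<in>UNIV. ?a x (e i) (e j) * ext_d1_eucl ?b x (e i) (e j))"
      unfolding pairings_in_chart(1)[OF a b c x]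
      by (rule inner_form2_frame[OF P e fa(1)[OF x] bilinear_ext_d1_eucl[OF metric_on_facts(1)[OF G] x fb]])
    have "linear (loc1 A c (codiff2 A g \<alpha>) x)"
      by (rule loc1_linear[OF SA atlas_facts(2)[OF SA c] x linear_codiff[OF SA g a]])
    from metric_trace_frame[OF P e linear_mult_bilinear[OF this fb(1)[OF x]]]
    have 2: "codiff_pairing A g \<alpha> \<beta> (inv_c c x) =
        (\<Sum>j\<in>UNIV. - (\<Sum>i\<in>UNIV. cov_deriv2 ?G ?a x (e i) (e i) (e j)) * ?b x (e j))"
      unfolding pairings_in_chart(2)[OF a b c x] codiff_in_chart(2)[OF SA g a c x e] by simp
    have "vol_density A g c x *
       (1 / 2 * (\<Sum>i\<in>UNIV. \<Sum>j\<in>UNIV. ?a x (e i) (e j) * ext_d1_eucl ?b x (e i) (e j))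
        - (\<Sum>j\<in>UNIV. - (\<Sum>i\<in>UNIV. cov_deriv2 ?G ?a x (e i) (e i) (e j)) * ?b x (e j)))
      = (\<Sum>k\<in>UNIV. FD Y x (axis k 1) $ k)"
      unfolding vol_density_def Y_def[abs_def] X_def
      by (rule divergence_identity(2)[OF G x e fa(1-3) fb, symmetric])
    then show ?thesis unfolding 1 2 by (subst mult.commute)
  qed
  have Y0: "Y x = 0" if x: "x \<in> img_c c - snd c ` K" for x
  proof -
    have "?b x u = 0" for u using z[OF ch(3)[OF x]] by (simp add: loc1_def)
    then have "sharp (?G x) (?b x) = 0" by (simp add: sharp_def)
    moreover have "?a x w 0 = 0" for w using x by (intro bilinear_rzero[OF fa(1)]) blast
    ultimately show ?thesis by (simp add: Y_def X_def sharp_def)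
  qed
  have comp: "((\<lambda>x. FD Y x (axis k 1) $ k) has_integral 0) (img_c c)" for k
  proof -
    have Yk: "smooth_on (img_c c) (\<lambda>x. Y x $ k)" by (rule smooth_on_vec_nth[OF metric_on_facts(1)[OF G] Ys])
    have "((\<lambda>x. FD (\<lambda>x. Y x $ k) x (axis k 1)) has_integral 0) (img_c c)"
      by (rule integral_FD_zero[OF metric_on_facts(1)[OF G] ch(1,2)]) (use Yk Y0 in \<open>auto simp: smooth_on_def\<close>)
    moreover have "FD (\<lambda>x. Y x $ k) x (axis k 1) = FD Y x (axis k 1) $ k" if "x \<in> img_c c" for x
      using FD_eq[OF bounded_linear.has_derivative[OF bounded_linear_vec_nth[of k] FD_has[OF smooth_on_differentiable[OF Ys that]]]]
      by simp
    ultimately show ?thesis by (simp cong: has_integral_cong)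
  qed
  have "volume_integral A g ?D = integral (img_c c) (\<lambda>x. ?D (inv_c c x) * vol_density A g c x)"
    by (rule volume_integral_local[OF cpt OA g c K cont D0])
  also have "\<dots> = integral (img_c c) (\<lambda>x. \<Sum>k\<in>UNIV. FD Y x (axis k 1) $ k)"
    by (rule Henstock_Kurzweil_Integration.integral_cong) (rule eq)
  also have "\<dots> = 0"
  proof -
    have "((\<lambda>x. \<Sum>k\<in>UNIV. FD Y x (axis k 1) $ k) has_integral (\<Sum>k\<in>(UNIV :: 'd set). 0)) (img_c c)"
      by (rule has_integral_sum[OF finite_class.finite_UNIV]) (rule comp)
    then show ?thesis by (simp add: integral_unique)
  qed
  finally show ?thesis .
qed

lemma form1_weighted:
  assumes b: "form1 A \<beta>" and r: "smooth_fun A r"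
  shows "form1 A (\<lambda>p u. r p * \<beta> p u)"
  unfolding form1_def
proof (intro conjI allI ballI)
  note SA = smooth_A[OF cpt OA g]
  have "linear (\<beta> p)" for p using b by (simp add: form1_def)
  then show "linear (\<lambda>u. r p * \<beta> p u)" for p by (simp add: linear_iff algebra_simps)
  fix c u assume c: "c \<in> A"
  show "smooth_on (img_c c) (\<lambda>x. loc1 A c (\<lambda>p u. r p * \<beta> p u) x u)"
    using smooth_on_mult[OF is_chart_facts(2)[OF atlas_facts(1)[OF SA c]] smooth_fun_D[OF SA r c] form1_facts(2)[OF SA b c, of u]]
    by (simp add: loc1_def)
qed

text \<open>Splitting \<beta> rather than the integrand makes each piece a form supported in one
  chart. The derivatives of the weights are absorbed in the exterior derivatives of the pieces, and
  both pairings are additive in \<beta>.\<close>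

theorem stokes_codifferential:
  assumes a: "form2 A \<alpha>" and b: "form1 A \<beta>"
  shows "volume_integral A g (ext_d1_pairing A g \<alpha> \<beta>) = volume_integral A g (codiff_pairing A g \<alpha> \<beta>)"
proof -
  note SA = smooth_A[OF cpt OA g] and pf = pou_facts[OF cpt OA g]
  define \<beta>' where "\<beta>' c = (\<lambda>p u. pou_weight A c p * \<beta> p u)" for c
  have b': "form1 A (\<beta>' c)" if "c \<in> pou_charts A" for c
    unfolding \<beta>'_def by (rule form1_weighted[OF b pf(3)[OF that]])
  have sum: "\<beta> p u = (\<Sum>c\<in>pou_charts A. \<beta>' c p u)" for p u
    by (simp add: \<beta>'_def sum_distrib_right[symmetric] pf(7))
  have d: "ext_d1 A \<beta> p = (\<lambda>u v. \<Sum>c\<in>pou_charts A. ext_d1 A (\<beta>' c) p u v)" for p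
  proof -
    let ?e = "chart_at A p"
    note e = atlas_facts(5,6)[OF SA, of p]
    have x: "snd ?e p \<in> img_c ?e" using e(2) by blast
    have "((\<lambda>y. \<Sum>c\<in>pou_charts A. loc1 A ?e (\<beta>' c) y u) has_derivative
        (\<lambda>h. \<Sum>c\<in>pou_charts A. FD (\<lambda>y. loc1 A ?e (\<beta>' c) y u) (snd ?e p) h)) (at (snd ?e p))" for u
      by (rule has_derivative_sum[OF FD_has[OF smooth_on_differentiable[OF form1_facts(2)[OF SA b' e(1)] x]]])
    moreover have "(\<lambda>y. loc1 A ?e \<beta> y u) = (\<lambda>y. \<Sum>c\<in>pou_charts A. loc1 A ?e (\<beta>' c) y u)" for u
      unfolding loc1_def by (rule ext) (rule sum)
    ultimately have "FD (\<lambda>y. loc1 A ?e \<beta> y u) (snd ?e p) =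
        (\<lambda>h. \<Sum>c\<in>pou_charts A. FD (\<lambda>y. loc1 A ?e (\<beta>' c) y u) (snd ?e p) h)" for u
      by (simp add: FD_eq)
    then show ?thesis by (simp add: ext_d1_def ext_d1_eucl_def fun_eq_iff sum_subtractf)
  qed
  have cc: "chart_continuous A (\<lambda>p. ext_d1_pairing A g \<alpha> (\<beta>' c) p - codiff_pairing A g \<alpha> (\<beta>' c) p)"
    if "c \<in> pou_charts A" for c
    using chart_continuous_pairings[OF a b'[OF that]] unfolding chart_continuous_def
    by (intro ballI continuous_on_diff) auto
  have D: "ext_d1_pairing A g \<alpha> \<beta> p - codiff_pairing A g \<alpha> \<beta> p =
      (\<Sum>c\<in>pou_charts A. ext_d1_pairing A g \<alpha> (\<beta>' c) p - codiff_pairing A g \<alpha> (\<beta>' c) p)" for p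
  proof -
    have "ext_d1_pairing A g \<alpha> \<beta> p = (\<Sum>c\<in>pou_charts A. ext_d1_pairing A g \<alpha> (\<beta>' c) p)"
      unfolding ext_d1_pairing_def d inner_form2_sum ..
    moreover have "codiff_pairing A g \<alpha> \<beta> p = (\<Sum>c\<in>pou_charts A. codiff_pairing A g \<alpha> (\<beta>' c) p)"
      unfolding codiff_pairing_def sum[of p] sum_distrib_left by (rule sum.swap)
    ultimately show ?thesis by (simp add: sum_subtractf)
  qed
  have "volume_integral A g (ext_d1_pairing A g \<alpha> \<beta>) - volume_integral A g (codiff_pairing A g \<alpha> \<beta>) =
      volume_integral A g (\<lambda>p. ext_d1_pairing A g \<alpha> \<beta> p - codiff_pairing A g \<alpha> \<beta> p)"
    by (rule volume_integral_diff[OF cpt OA g chart_continuous_pairings[OF a b], symmetric])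
  also have "\<dots> = (\<Sum>c\<in>pou_charts A. volume_integral A g
      (\<lambda>p. ext_d1_pairing A g \<alpha> (\<beta>' c) p - codiff_pairing A g \<alpha> (\<beta>' c) p))"
    unfolding D by (rule volume_integral_sum[OF cpt OA g pf(1) cc])
  also have "\<dots> = 0"
  proof (rule sum.neutral, rule ballI)
    fix c assume c: "c \<in> pou_charts A"
    have cA: "c \<in> A" using c pf(2) by blast
    show "volume_integral A g (\<lambda>p. ext_d1_pairing A g \<alpha> (\<beta>' c) p - codiff_pairing A g \<alpha> (\<beta>' c) p) = 0"
    proof (rule stokes_local[OF a b'[OF c] cA pf(6) pf(5)[OF c]])
      fix p u assume "p \<notin> pou_support A c"
      then show "\<beta>' c p u = 0" using pf(8)[of p c] by (simp add: \<beta>'_def)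
    qed
  qed
  finally show ?thesis by simp
qed

end

section \<open>Differentiation under the integral sign\<close>

lemma smooth_on_bounded_linear_id: "bounded_linear L \<Longrightarrow> open S \<Longrightarrow> smooth_on S L"
  by (rule smooth_on_bounded_linear[of L S "\<lambda>x. x", OF _ _ smooth_on_id])

lemma smooth_on_Pair_right: "open S \<Longrightarrow> smooth_on S (\<lambda>x. (t, x))"
proof -
  assume S: "open S"
  have "smooth_on S (\<lambda>x. (t, 0) + (0, x))"
    by (rule smooth_on_add[OF S smooth_on_const smooth_on_bounded_linear_id[OF
          bounded_linear_Pair[OF bounded_linear_zero bounded_linear_ident] S]])
  then show ?thesis by simp
qed

lemma FD_slice_right:
  fixes f :: "'a::euclidean_space \<times> 'b::euclidean_space \<Rightarrow> 'c::euclidean_space"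
  assumes "f differentiable (at (t, x))"
  shows "((\<lambda>y. f (t, y)) has_derivative (\<lambda>u. FD f (t, x) (0, u))) (at x)"
proof -
  have "((\<lambda>y. (t, y)) has_derivative (\<lambda>u. (0, u))) (at x)"
    by (rule has_derivative_Pair[OF has_derivative_const has_derivative_ident])
  from has_derivative_compose[OF this FD_has[OF assms]] show ?thesis .
qed

lemma FD_slice_left:
  fixes f :: "'a::euclidean_space \<times> 'b::euclidean_space \<Rightarrow> 'c::euclidean_space"
  assumes "f differentiable (at (t, x))"
  shows "((\<lambda>s. f (s, x)) has_derivative (\<lambda>s. FD f (t, x) (s, 0))) (at t)"
proof -
  have "((\<lambda>s. (s, x)) has_derivative (\<lambda>s. (s, 0))) (at t)"
    by (rule has_derivative_Pair[OF has_derivative_ident has_derivative_const])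
  from has_derivative_compose[OF this FD_has[OF assms]] show ?thesis .
qed

text \<open>Because the support lies in one compact set at all times, extension by zero gives a
  continuously differentiable function of time and the whole space. The integral becomes one over a
  fixed box, where the Leibniz rule applies.\<close>

lemma derivative_of_compactly_supported_integral:
  fixes k :: "real \<times> 'a::euclidean_space \<Rightarrow> real"
  assumes e: "\<epsilon> > 0" and S: "open S" and K: "compact K" "K \<subseteq> S"
    and k: "smooth_on ({-\<epsilon><..<\<epsilon>} \<times> S) k" and z: "\<And>t x. t \<in> {-\<epsilon><..<\<epsilon>} \<Longrightarrow> x \<in> S - K \<Longrightarrow> k (t, x) = 0"
  shows "((\<lambda>t. integral S (\<lambda>x. k (t, x))) has_field_derivative integral S (\<lambda>x. FD k (0, x) (1, 0))) (at 0)"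
proof -
  let ?I = "{-\<epsilon><..<\<epsilon>}"
  define E where "E = (\<lambda>z. if z \<in> ?I \<times> S then k z else 0)"
  have o: "open (?I \<times> S)" using S by (intro open_Times) auto
  have cK: "closed K" using K compact_imp_closed by blast
  have z': "k p = 0" if "p \<in> ?I \<times> S - UNIV \<times> K" for p
    using that by (cases p) (simp add: z)
  have e1: "Ck_on 1 (?I \<times> UNIV) E"
    unfolding E_def by (rule Ck_on_zero_extension[OF o, of "UNIV \<times> K"]) (use cK K k z' in \<open>auto simp: closed_Times smooth_on_def\<close>)
  obtain a b where ab: "K \<subseteq> cbox a b"
    using K compact_imp_bounded bounded_subset_cbox_symmetric by metis
  have ced: "continuous_on (?I \<times> UNIV) (\<lambda>z. FD E z (1, 0))" using e1 by simp
  have de: "E differentiable (at (t, x))" if "t \<in> ?I" for t x using e1 that by auto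
  have ce: "continuous_on (?I \<times> UNIV) E" by (rule Ck_on_imp_continuous_on[OF e1])
  have ft: "integral S (\<lambda>x. k (t, x)) = integral (cbox a b) (\<lambda>x. E (t, x))" if t: "t \<in> ?I" for t
  proof -
    have "continuous_on S (\<lambda>x. k (t, x))"
      by (rule continuous_on_compose2[OF smooth_on_imp_continuous_on[OF k]]) (use t in \<open>auto intro!: continuous_on_Pair continuous_on_const continuous_on_id\<close>)
    from compactly_supported_integral_cbox[OF S K this z[OF t] ab] show ?thesis using t by (simp add: E_def)
  qed
  have slice: "(\<lambda>x. E (t, x)) integrable_on cbox a b" if t: "t \<in> ?I" for t
    by (intro integrable_continuous continuous_on_compose2[OF ce])
      (use t in \<open>auto intro!: continuous_on_Pair continuous_on_const continuous_on_id\<close>)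
  have "((\<lambda>t. integral (cbox a b) (\<lambda>x. E (t, x))) has_field_derivative
      integral (cbox a b) (\<lambda>x. FD E (0, x) (1, 0))) (at 0 within ?I)"
  proof (rule leibniz_rule_field_derivative)
    fix t x assume t: "t \<in> ?I"
    have "((\<lambda>s. E (s, x)) has_derivative (\<lambda>s. FD E (t, x) (s, 0))) (at t)"
      by (rule FD_slice_left[OF de[OF t]])
    moreover have "(\<lambda>s. FD E (t, x) (s, 0)) = (*) (FD E (t, x) (1, 0))"
    proof
      fix s
      show "FD E (t, x) (s, 0) = FD E (t, x) (1, 0) * s"
        using linear_cmul[OF FD_linear[OF de[OF t, of x]], of s "(1, 0)"] by (simp add: mult.commute)
    qed
    ultimately show "((\<lambda>s. E (s, x)) has_field_derivative FD E (t, x) (1, 0)) (at t within ?I)"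
      by (simp add: has_field_derivative_def has_derivative_at_withinI)
  next
    show "continuous_on (?I \<times> cbox a b) (\<lambda>(t, x). FD E (t, x) (1, 0))"
      using continuous_on_subset[OF ced, of "?I \<times> cbox a b"] by (simp add: case_prod_beta' Sigma_mono)
  qed (use e slice in auto)
  then have "((\<lambda>t. integral (cbox a b) (\<lambda>x. E (t, x))) has_field_derivative
      integral (cbox a b) (\<lambda>x. FD E (0, x) (1, 0))) (at 0)"
    using e by (simp add: at_within_open[of 0 ?I])
  then have 1: "((\<lambda>t. integral S (\<lambda>x. k (t, x))) has_field_derivative
      integral (cbox a b) (\<lambda>x. FD E (0, x) (1, 0))) (at 0)"
    by (rule has_field_derivative_transform_within_open[of _ _ _ ?I]) (use e ft in auto)
  have in0: "(0::real) \<in> ?I" using e by simp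
  have zK: "FD k (0, x) (1, 0) = 0" if x: "x \<in> S - K" for x
  proof -
    have "open (?I \<times> (S - K))" using S cK by (intro open_Times open_Diff) auto
    then have "FD (\<lambda>z. 0) (0, x) = FD k (0, x)" by (rule FD_cong) (use x z in0 in auto)
    then show ?thesis by (metis frechet_derivative_const)
  qed
  have ek: "FD E (0, x) (1, 0) = (if x \<in> S then FD k (0, x) (1, 0) else 0)" for x
  proof (cases "x \<in> S")
    case True
    have "FD k (0, x) = FD E (0, x)"
      by (rule FD_cong[OF o]) (use True in0 smooth_on_differentiable[OF k] in \<open>auto simp: E_def\<close>)
    then show ?thesis using True by simp
  next
    case False
    have "open (?I \<times> (- K))" using cK by (intro open_Times) auto
    then have "FD (\<lambda>z. 0) (0, x) = FD E (0, x)" by (rule FD_cong) (use False z in0 K in \<open>auto simp: E_def\<close>)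
    then show ?thesis using False by (metis frechet_derivative_const)
  qed
  have "continuous_on S (\<lambda>x. FD k (0, x) (1, 0))"
    by (rule continuous_on_compose2[OF smooth_on_imp_continuous_on[OF smooth_on_FD[OF k]]])
      (use in0 in \<open>auto intro!: continuous_on_Pair continuous_on_const continuous_on_id\<close>)
  from compactly_supported_integral_cbox[OF S K this zK ab]
  have "integral S (\<lambda>x. FD k (0, x) (1, 0)) = integral (cbox a b) (\<lambda>x. FD E (0, x) (1, 0))"
    unfolding ek .
  then show ?thesis using 1 by simp
qed

section \<open>The first variation of the energy\<close>

text \<open>The part of space-time on which the variation has an expression in the charts
  \<open>c\<close> and \<open>d\<close>; with \<open>var_rep\<close> it abbreviates the smoothness
  clause of \<open>smooth_variation\<close> for a fixed \<epsilon>.\<close>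

definition var_dom :: "('m::t2_space, 'd::finite) chart \<Rightarrow> ('n::t2_space, 'k::finite) chart \<Rightarrow>
    real \<Rightarrow> (real \<Rightarrow> 'm \<Rightarrow> 'n) \<Rightarrow> (real \<times> (real^'d)) set" where
  "var_dom c d \<epsilon> \<Phi> = {(t, x). t \<in> {-\<epsilon><..<\<epsilon>} \<and> x \<in> img_c c \<and> \<Phi> t (inv_c c x) \<in> dom_c d}"

definition var_rep :: "('m::t2_space, 'd::finite) chart \<Rightarrow> ('n::t2_space, 'k::finite) chart \<Rightarrow>
    (real \<Rightarrow> 'm \<Rightarrow> 'n) \<Rightarrow> real \<times> (real^'d) \<Rightarrow> real^'k" where
  "var_rep c d \<Phi> = (\<lambda>(t, x). snd d (\<Phi> t (inv_c c x)))"

text \<open>The variation field \<open>V\<close>, its components taken in the preferred chart at the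
  initial point, as the representation of tangent vectors of the target demands.\<close>

definition var_field :: "('n::t2_space, 'k::finite) chart set \<Rightarrow> (real \<Rightarrow> 'm \<Rightarrow> 'n) \<Rightarrow> 'm \<Rightarrow> real^'k" where
  "var_field B \<Phi> p = FD (\<lambda>t. snd (chart_at B (\<Phi> 0 p)) (\<Phi> t p)) 0 1"

definition var_form :: "('m::t2_space, 'd::finite) chart set \<Rightarrow> ('n::t2_space, 'k::finite) chart set \<Rightarrow>
    ('n, 'k) field2 \<Rightarrow> (real \<Rightarrow> 'm \<Rightarrow> 'n) \<Rightarrow> ('m, 'd) field1" where
  "var_form A B \<omega> \<Phi> p u = \<omega> (\<Phi> 0 p) (var_field B \<Phi> p) (differential A B (\<Phi> 0) p u)"

text \<open>The pullback of \<open>\<omega>\<close> under the whole variation, a closed 2-form on space-time.\<close>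

definition var_omega :: "('n::t2_space, 'k::finite) chart set \<Rightarrow> ('n, 'k) field2 \<Rightarrow>
    ('m::t2_space, 'd::finite) chart \<Rightarrow> ('n, 'k) chart \<Rightarrow> (real \<Rightarrow> 'm \<Rightarrow> 'n) \<Rightarrow>
    real \<times> (real^'d) \<Rightarrow> real \<times> (real^'d) \<Rightarrow> real \<times> (real^'d) \<Rightarrow> real" where
  "var_omega B \<omega> c d \<Phi> z U V =
    loc2 B d \<omega> (var_rep c d \<Phi> z) (FD (var_rep c d \<Phi>) z U) (FD (var_rep c d \<Phi>) z V)"

section \<open>A smooth variation read in charts\<close>

context
  fixes A :: "('m::t2_space, 'd::finite) chart set" and B :: "('n::t2_space, 'k::finite) chart set"
    and \<omega> :: "('n, 'k) field2" and \<Phi> :: "real \<Rightarrow> 'm \<Rightarrow> 'n" and \<epsilon> :: real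
  assumes SA: "smooth_atlas A" and SB: "smooth_atlas B" and w: "form2 B \<omega>" "closed_form2 B \<omega>"
    and e: "\<epsilon> > 0" and cont: "continuous_on ({-\<epsilon><..<\<epsilon>} \<times> UNIV) (\<lambda>(t, p). \<Phi> t p)"
    and sm: "\<forall>c\<in>A. \<forall>d\<in>B. smooth_on (var_dom c d \<epsilon> \<Phi>) (var_rep c d \<Phi>)"
begin

lemma smooth_var_rep: "c \<in> A \<Longrightarrow> d \<in> B \<Longrightarrow> smooth_on (var_dom c d \<epsilon> \<Phi>) (var_rep c d \<Phi>)"
  using sm by blast

lemma open_var_dom:
  assumes c: "c \<in> A" and d: "d \<in> B"
  shows "open (var_dom c d \<epsilon> \<Phi>)"
proof -
  note cc = is_chart_facts[OF atlas_facts(1)[OF SA c]] and dd = is_chart_facts[OF atlas_facts(1)[OF SB d]]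
  have o: "open ({-\<epsilon><..<\<epsilon>} \<times> img_c c)" using cc(2) by (intro open_Times) auto
  have "continuous_on ({-\<epsilon><..<\<epsilon>} \<times> img_c c) (\<lambda>z. (fst z, inv_c c (snd z)))"
    by (intro continuous_on_Pair continuous_on_fst continuous_on_id continuous_on_compose2[OF cc(7) continuous_on_snd[OF continuous_on_id]]) auto
  moreover have "(\<lambda>z. (fst z, inv_c c (snd z))) ` ({-\<epsilon><..<\<epsilon>} \<times> img_c c) \<subseteq> {-\<epsilon><..<\<epsilon>} \<times> UNIV" by auto
  ultimately have "continuous_on ({-\<epsilon><..<\<epsilon>} \<times> img_c c) (\<lambda>z. \<Phi> (fst z) (inv_c c (snd z)))"
    using continuous_on_compose2[OF cont] by fastforce
  from continuous_open_preimage[OF this o dd(1)]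
  show ?thesis by (rule back_subst[where P="open"]) (auto simp: var_dom_def)
qed

lemma var_smooth_map:
  assumes t: "t \<in> {-\<epsilon><..<\<epsilon>}"
  shows "smooth_map A B (\<Phi> t)"
  unfolding smooth_map_def
proof (intro conjI ballI)
  have "continuous_on UNIV (\<lambda>p. (t, p))" by (intro continuous_on_Pair continuous_on_const continuous_on_id)
  moreover have "(\<lambda>p. (t, p)) ` UNIV \<subseteq> {-\<epsilon><..<\<epsilon>} \<times> UNIV" using t by auto
  ultimately show ct: "continuous_on UNIV (\<Phi> t)"
    using continuous_on_compose2[OF cont, of UNIV "\<lambda>p. (t, p)"] by simp
  fix c d assume c: "c \<in> A" and d: "d \<in> B"
  note cc = is_chart_facts[OF atlas_facts(1)[OF SA c]] and dd = is_chart_facts[OF atlas_facts(1)[OF SB d]]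
  let ?W = "snd c ` (dom_c c \<inter> \<Phi> t -` dom_c d)"
  have o: "open ?W" using cc(8) ct dd(1) by (simp add: open_vimage)
  have "(\<lambda>x. (t, x)) ` ?W \<subseteq> var_dom c d \<epsilon> \<Phi>" using t cc(3) by (auto simp: var_dom_def)
  from smooth_on_compose[OF o open_var_dom[OF c d] this smooth_on_Pair_right[OF o] smooth_var_rep[OF c d]]
  show "smooth_on ?W (snd d \<circ> \<Phi> t \<circ> inv_c c)" by (simp add: var_rep_def o_def)
qed

lemma var_differentiable:
  "c \<in> A \<Longrightarrow> d \<in> B \<Longrightarrow> z \<in> var_dom c d \<epsilon> \<Phi> \<Longrightarrow> var_rep c d \<Phi> differentiable (at z)"
  using smooth_on_differentiable[OF smooth_var_rep] .

lemma var_pullback_local: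
  assumes c: "c \<in> A" and d: "d \<in> B" and z: "(t, x) \<in> var_dom c d \<epsilon> \<Phi>"
  shows "loc2 A c (pullback2 A B (\<Phi> t) \<omega>) x u v = var_omega B \<omega> c d \<Phi> (t, x) (0, u) (0, v)"
proof -
  have t: "t \<in> {-\<epsilon><..<\<epsilon>}" using z by (auto simp: var_dom_def)
  have x: "x \<in> snd c ` (dom_c c \<inter> \<Phi> t -` dom_c d)"
    using z map_in_charts(5)[OF SA SB var_smooth_map[OF t] c d, of x] by (simp add: var_dom_def)
  have f: "(snd d \<circ> \<Phi> t \<circ> inv_c c) = (\<lambda>y. var_rep c d \<Phi> (t, y))" by (simp add: var_rep_def o_def)
  have "FD (snd d \<circ> \<Phi> t \<circ> inv_c c) x = (\<lambda>u. FD (var_rep c d \<Phi>) (t, x) (0, u))"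
    unfolding f by (rule FD_eq[OF FD_slice_right[OF var_differentiable[OF c d z]]])
  then show ?thesis
    unfolding pullback2_in_charts[OF SA SB var_smooth_map[OF t] c d x] var_omega_def by (simp add: var_rep_def)
qed

lemma var_field_local:
  assumes c: "c \<in> A" and d: "d \<in> B" and z: "(0, x) \<in> var_dom c d \<epsilon> \<Phi>"
  shows "var_field B \<Phi> (inv_c c x) = from_coord B d (\<Phi> 0 (inv_c c x)) (FD (var_rep c d \<Phi>) (0, x) (1, 0))"
proof -
  define p where "p = inv_c c x"
  define d' where "d' = chart_at B (\<Phi> 0 p)"
  have d': "d' \<in> B" "\<Phi> 0 p \<in> dom_c d'" using atlas_facts(5,6)[OF SB] by (auto simp: d'_def)
  have p: "\<Phi> 0 p \<in> dom_c d" using z by (simp add: var_dom_def p_def)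
  note bt = atlas_facts(1)[OF SB]
  note td = transition_facts[OF bt[OF d] bt[OF d'(1)] atlas_facts(4)[OF SB d d'(1)]]
  have z': "(0, x) \<in> var_dom c d' \<epsilon> \<Phi>" using z d'(2) by (simp add: var_dom_def p_def)
  define V where "V = (\<lambda>t. (t, x)) -` (var_dom c d \<epsilon> \<Phi> \<inter> var_dom c d' \<epsilon> \<Phi>)"
  have "continuous_on UNIV (\<lambda>t::real. (t, x))" by (intro continuous_on_Pair continuous_on_const continuous_on_id)
  then have V: "open V" "0 \<in> V"
    unfolding V_def using open_var_dom[OF c d] open_var_dom[OF c d'(1)] z z' by (auto intro!: open_vimage)
  have eq: "snd d' (\<Phi> t p) = transition d d' (var_rep c d \<Phi> (t, x))" if "t \<in> V" for t
    using that is_chart_facts(3)[OF bt[OF d]] by (auto simp: V_def var_dom_def var_rep_def p_def transition_def)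
  have F0: "var_rep c d \<Phi> (0, x) = snd d (\<Phi> 0 p)" by (simp add: var_rep_def p_def)
  note sl = FD_slice_left[OF var_differentiable[OF c d z]]
  have 1: "(\<lambda>t. var_rep c d \<Phi> (t, x)) differentiable (at 0)" using sl by (rule differentiableI)
  have 2: "transition d d' differentiable (at (var_rep c d \<Phi> (0, x)))"
    unfolding F0 by (rule smooth_on_differentiable[OF td(2)]) (use p d'(2) in blast)
  have "var_field B \<Phi> p = FD (transition d d') (snd d (\<Phi> 0 p)) (FD (\<lambda>t. var_rep c d \<Phi> (t, x)) 0 1)"
    unfolding var_field_def d'_def[symmetric]
    using FD_local_compose[OF V eq 1 2, of 1] F0 by simp
  also have "FD (\<lambda>t. var_rep c d \<Phi> (t, x)) 0 1 = FD (var_rep c d \<Phi>) (0, x) (1, 0)" using FD_eq[OF sl] by simp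
  finally show ?thesis unfolding from_coord_def p_def[symmetric] d'_def[symmetric] .
qed

lemma in0: "0 \<in> {-\<epsilon><..<\<epsilon>}" using e by simp

text \<open>The 1-form is the contraction of the space-time form with the time direction
  \<open>(1, 0)\<close>. Closedness on space-time becomes a statement about it through this
  identification.\<close>

lemma var_form_local:
  assumes c: "c \<in> A" and d: "d \<in> B" and z: "(0, x) \<in> var_dom c d \<epsilon> \<Phi>"
  shows "loc1 A c (var_form A B \<omega> \<Phi>) x u = var_omega B \<omega> c d \<Phi> (0, x) (1, 0) (0, u)"
proof -
  define p where "p = inv_c c x"
  have x: "x \<in> img_c c" and p: "p \<in> dom_c c" "\<Phi> 0 p \<in> dom_c d" "snd c p = x"
    using z is_chart_facts(4,5)[OF atlas_facts(1)[OF SA c]] by (auto simp: var_dom_def p_def)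
  have f: "(snd d \<circ> \<Phi> 0 \<circ> inv_c c) = (\<lambda>y. var_rep c d \<Phi> (0, y))" by (simp add: var_rep_def o_def)
  have 1: "FD (snd d \<circ> \<Phi> 0 \<circ> inv_c c) x = (\<lambda>u. FD (var_rep c d \<Phi>) (0, x) (0, u))"
    unfolding f by (rule FD_eq[OF FD_slice_right[OF var_differentiable[OF c d z]]])
  have "inv_c d (var_rep c d \<Phi> (0, x)) = \<Phi> 0 p"
    using is_chart_facts(3)[OF atlas_facts(1)[OF SB d] p(2)] by (simp add: var_rep_def p_def)
  moreover have "loc1 A c (var_form A B \<omega> \<Phi>) x u =
      \<omega> (\<Phi> 0 p) (var_field B \<Phi> p) (differential A B (\<Phi> 0) p (from_coord A c p u))"
    by (simp add: loc1_def var_form_def p_def)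
  ultimately show ?thesis
    unfolding var_omega_def loc2_def
    using differential_in_charts[OF SA SB var_smooth_map[OF in0] c d p(1,2), of u] var_field_local[OF c d z] 1 p(3)
    by (simp add: p_def)
qed

lemma smooth_var_omega:
  assumes c: "c \<in> A" and d: "d \<in> B"
  shows "smooth_on (var_dom c d \<epsilon> \<Phi>) (\<lambda>z. var_omega B \<omega> c d \<Phi> z U V)"
    and "var_rep c d \<Phi> ` var_dom c d \<epsilon> \<Phi> \<subseteq> img_c d"
proof -
  show *: "var_rep c d \<Phi> ` var_dom c d \<epsilon> \<Phi> \<subseteq> img_c d" by (auto simp: var_dom_def var_rep_def)
  show "smooth_on (var_dom c d \<epsilon> \<Phi>) (\<lambda>z. var_omega B \<omega> c d \<Phi> z U V)"
    unfolding var_omega_def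
    by (rule smooth_on_pullback2[OF open_var_dom[OF c d] is_chart_facts(2)[OF atlas_facts(1)[OF SB d]] *
        smooth_var_rep[OF c d] form2_facts(1,2)[OF SB w(1) d]])
qed

lemma var_dom_exists:
  assumes c: "c \<in> A" and x: "x \<in> img_c c" and t: "t \<in> {-\<epsilon><..<\<epsilon>}"
  shows "\<exists>d\<in>B. (t, x) \<in> var_dom c d \<epsilon> \<Phi>"
  using atlas_facts(3)[OF SB, of "\<Phi> t (inv_c c x)"] x t by (auto simp: var_dom_def)

lemma form1_var_form: "form1 A (var_form A B \<omega> \<Phi>)"
  unfolding form1_def
proof (intro conjI allI ballI)
  have "linear (\<omega> q v)" for q v using w(1) by (simp add: form2_def smooth_bilinear_field_def bilinear_def)
  from linear_compose[OF linear_differential[OF SA SB var_smooth_map[OF in0]] this]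
  show "linear (var_form A B \<omega> \<Phi> p)" for p by (simp add: var_form_def[abs_def] o_def)
  fix c u assume c: "c \<in> A"
  show "smooth_on (img_c c) (\<lambda>x. loc1 A c (var_form A B \<omega> \<Phi>) x u)"
  proof (rule smooth_on_local)
    fix x assume x: "x \<in> img_c c"
    obtain d where d: "d \<in> B" "(0, x) \<in> var_dom c d \<epsilon> \<Phi>" using var_dom_exists[OF c x in0] by blast
    define V where "V = (\<lambda>x. (0::real, x)) -` var_dom c d \<epsilon> \<Phi>"
    have "continuous_on UNIV (\<lambda>x. (0::real, x))" by (intro continuous_on_Pair continuous_on_const continuous_on_id)
    then have V: "open V" unfolding V_def by (rule open_vimage[OF open_var_dom[OF c d(1)]])
    have "smooth_on V (\<lambda>x. var_omega B \<omega> c d \<Phi> (0, x) (1, 0) (0, u))"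
      by (rule smooth_on_compose[OF V open_var_dom[OF c d(1)] _ smooth_on_Pair_right[OF V] smooth_var_omega(1)[OF c d(1)]])
        (auto simp: V_def)
    moreover have "\<forall>y\<in>V. loc1 A c (var_form A B \<omega> \<Phi>) y u = var_omega B \<omega> c d \<Phi> (0, y) (1, 0) (0, u)"
      using var_form_local[OF c d(1)] by (simp add: V_def)
    ultimately show "\<exists>T g. open T \<and> x \<in> T \<and> (\<forall>y\<in>T. loc1 A c (var_form A B \<omega> \<Phi>) y u = g y) \<and> smooth_on T g"
      using V d(2) by (intro exI[of _ V] exI[of _ "\<lambda>x. var_omega B \<omega> c d \<Phi> (0, x) (1, 0) (0, u)"]) (auto simp: V_def)
  qed
qed

text \<open>Joint smoothness in time and space, as differentiation under the integral sign requires.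
  The chart of the target may have to change from one space-time point to the next.\<close>

lemma smooth_var_pullback:
  assumes c: "c \<in> A"
  shows "smooth_on ({-\<epsilon><..<\<epsilon>} \<times> img_c c) (\<lambda>z. loc2 A c (pullback2 A B (\<Phi> (fst z)) \<omega>) (snd z) u v)"
proof (rule smooth_on_local)
  fix z assume z: "z \<in> {-\<epsilon><..<\<epsilon>} \<times> img_c c"
  then obtain d where d: "d \<in> B" "z \<in> var_dom c d \<epsilon> \<Phi>" using var_dom_exists[OF c, of "snd z" "fst z"] by auto
  have "loc2 A c (pullback2 A B (\<Phi> (fst y)) \<omega>) (snd y) u v = var_omega B \<omega> c d \<Phi> y (0, u) (0, v)"
    if "y \<in> var_dom c d \<epsilon> \<Phi>" for y
    using var_pullback_local[OF c d(1), of "fst y" "snd y" u v] that by simp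
  then show "\<exists>T g. open T \<and> z \<in> T \<and> (\<forall>y\<in>T. loc2 A c (pullback2 A B (\<Phi> (fst y)) \<omega>) (snd y) u v = g y) \<and> smooth_on T g"
    using d open_var_dom[OF c d(1)] smooth_var_omega(1)[OF c d(1), of "(0, u)" "(0, v)"]
    by (intro exI[of _ "var_dom c d \<epsilon> \<Phi>"] exI[of _ "\<lambda>y. var_omega B \<omega> c d \<Phi> y (0, u) (0, v)"]) auto
qed

text \<open>Closedness on space-time gives Cartan's formula: the time derivative of the pulled back
  form is the exterior derivative of its contraction with the variation field.\<close>

lemma var_time_derivative:
  assumes c: "c \<in> A" and x: "x \<in> img_c c"
  shows "((\<lambda>t. loc2 A c (pullback2 A B (\<Phi> t) \<omega>) x u v) has_field_derivative
    ext_d1_eucl (loc1 A c (var_form A B \<omega> \<Phi>)) x u v) (at 0)"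
proof -
  obtain d where d: "d \<in> B" and z: "(0, x) \<in> var_dom c d \<epsilon> \<Phi>" using var_dom_exists[OF c x in0] by blast
  define \<Omega> where "\<Omega> = var_omega B \<omega> c d \<Phi>"
  let ?W = "var_dom c d \<epsilon> \<Phi>"
  note W = open_var_dom[OF c d] and s = smooth_var_omega[OF c d, folded \<Omega>_def]
  have \<Omega>: "\<Omega> z U V = loc2 B d \<omega> (var_rep c d \<Phi> z) (FD (var_rep c d \<Phi>) z U) (FD (var_rep c d \<Phi>) z V)" for z U V
    unfolding \<Omega>_def var_omega_def ..
  have \<Omega>d: "(\<lambda>z. \<Omega> z U V) differentiable (at (0, x))" for U V by (rule smooth_on_differentiable[OF s(1) z])
  \<comment> \<open>The exterior derivative of the space-time form on the time direction,
    \<open>u\<close> and \<open>v\<close>. These are constant vector fields, so no bracket terms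
    occur.\<close>
  have "FD (\<lambda>z. \<Omega> z (0, u) (0, v)) (0, x) (1, 0) - FD (\<lambda>z. \<Omega> z (1, 0) (0, v)) (0, x) (0, u)
      + FD (\<lambda>z. \<Omega> z (1, 0) (0, u)) (0, x) (0, v) =
    ext_d2_eucl (loc2 B d \<omega>) (var_rep c d \<Phi> (0, x)) (FD (var_rep c d \<Phi>) (0, x) (1, 0))
      (FD (var_rep c d \<Phi>) (0, x) (0, u)) (FD (var_rep c d \<Phi>) (0, x) (0, v))"
    unfolding ext_d2_eucl_def
    by (rule ext_d2_general_pullback[OF W z is_chart_facts(2)[OF atlas_facts(1)[OF SB d]] s(2) smooth_var_rep[OF c d]
          form2_facts(1-3)[OF SB w(1) d] \<Omega>])
  also have "\<dots> = 0"
    by (rule closed_form2_local[OF SB w d]) (use s(2) z in blast)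
  finally have closed: "FD (\<lambda>z. \<Omega> z (0, u) (0, v)) (0, x) (1, 0) =
      FD (\<lambda>z. \<Omega> z (1, 0) (0, v)) (0, x) (0, u) - FD (\<lambda>z. \<Omega> z (1, 0) (0, u)) (0, x) (0, v)" by simp
  define V where "V = (\<lambda>x. (0::real, x)) -` ?W"
  have "continuous_on UNIV (\<lambda>x. (0::real, x))" by (intro continuous_on_Pair continuous_on_const continuous_on_id)
  then have V: "open V" "x \<in> V" unfolding V_def using open_vimage[OF W] z by auto
  have sp: "FD (\<lambda>y. loc1 A c (var_form A B \<omega> \<Phi>) y u) x = (\<lambda>h. FD (\<lambda>z. \<Omega> z (1, 0) (0, u)) (0, x) (0, h))" for u
  proof -
    note sl = FD_slice_right[OF \<Omega>d[of "(1, 0)" "(0, u)"]]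
    have "FD (\<lambda>y. \<Omega> (0, y) (1, 0) (0, u)) x = FD (\<lambda>y. loc1 A c (var_form A B \<omega> \<Phi>) y u) x"
      by (rule FD_cong[OF V _ differentiableI[OF sl]]) (use var_form_local[OF c d] in \<open>auto simp: V_def \<Omega>_def\<close>)
    then show ?thesis using FD_eq[OF sl] by simp
  qed
  have ext: "FD (\<lambda>z. \<Omega> z (0, u) (0, v)) (0, x) (1, 0) = ext_d1_eucl (loc1 A c (var_form A B \<omega> \<Phi>)) x u v"
    unfolding closed ext_d1_eucl_def sp ..
  define T where "T = (\<lambda>t. (t, x)) -` ?W"
  have "continuous_on UNIV (\<lambda>t::real. (t, x))" by (intro continuous_on_Pair continuous_on_const continuous_on_id)
  then have T: "open T" "0 \<in> T" unfolding T_def using open_vimage[OF W] z by auto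
  note sl = FD_slice_left[OF \<Omega>d[of "(0, u)" "(0, v)"]]
  have "(\<lambda>s. FD (\<lambda>z. \<Omega> z (0, u) (0, v)) (0, x) (s, 0)) = (*) (FD (\<lambda>z. \<Omega> z (0, u) (0, v)) (0, x) (1, 0))"
  proof
    fix r
    show "FD (\<lambda>z. \<Omega> z (0, u) (0, v)) (0, x) (r, 0) = FD (\<lambda>z. \<Omega> z (0, u) (0, v)) (0, x) (1, 0) * r"
      using linear_cmul[OF FD_linear[OF \<Omega>d[of "(0, u)" "(0, v)"]], of r "(1, 0)"] by (simp add: mult.commute)
  qed
  with sl have "((\<lambda>t. \<Omega> (t, x) (0, u) (0, v)) has_field_derivative ext_d1_eucl (loc1 A c (var_form A B \<omega> \<Phi>)) x u v) (at 0)"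
    unfolding has_field_derivative_def ext[symmetric] by simp
  then show ?thesis
    by (rule has_field_derivative_transform_within_open[OF _ T])
      (use var_pullback_local[OF c d] in \<open>auto simp: T_def \<Omega>_def\<close>)
qed

end

text \<open>Metric, density and weights do not depend on time, so only the pulled back form is
  differentiated. The symmetry of its squared norm produces a factor 2 that cancels the 1/2 of the
  energy, and adjointness moves the derivative onto the pullback.\<close>

theorem first_variation:
  fixes A :: "('m::t2_space, 'd::finite) chart set" and B :: "('n::t2_space, 'k::finite) chart set"
  assumes cpt: "compact (UNIV :: 'm set)" and OA: "oriented_atlas A" and g: "riemannian_metric A g"
    and SB: "smooth_atlas B" and w: "form2 B \<omega>" "closed_form2 B \<omega>"
    and var: "smooth_variation A B \<phi> \<Phi>"
  shows "form1 A (var_form A B \<omega> \<Phi>)"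
    and "((\<lambda>t. energy A g B \<omega> (\<Phi> t)) has_real_derivative
      volume_integral A g (codiff_pairing A g (pullback2 A B \<phi> \<omega>) (var_form A B \<omega> \<Phi>))) (at 0)"
proof -
  note SA = smooth_A[OF cpt OA g]
  obtain \<epsilon> where e: "\<epsilon> > 0" and cont: "continuous_on ({-\<epsilon><..<\<epsilon>} \<times> UNIV) (\<lambda>(t, p). \<Phi> t p)"
    and sm: "\<forall>c\<in>A. \<forall>d\<in>B. smooth_on (var_dom c d \<epsilon> \<Phi>) (var_rep c d \<Phi>)"
    and \<Phi>0: "\<Phi> 0 = \<phi>"
    using var unfolding smooth_variation_def var_dom_def var_rep_def by blast
  let ?I = "{-\<epsilon><..<\<epsilon>}"
  note V = form1_var_form[OF SA SB w e cont sm] var_smooth_map[OF SA SB w e cont sm]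
    smooth_var_pullback[OF SA SB w e cont sm] var_time_derivative[OF SA SB w e cont sm]
  show f1: "form1 A (var_form A B \<omega> \<Phi>)" by (rule V(1))
  define \<Psi> where "\<Psi> t = pullback2 A B (\<Phi> t) \<omega>" for t
  have in0: "0 \<in> ?I" using e by simp
  have f2: "form2 A (\<Psi> t)" if "t \<in> ?I" for t
    unfolding \<Psi>_def by (rule form2_pullback2[OF SA SB V(2)[OF that] w(1)])
  define k where "k c z = pou_weight A c (inv_c c (snd z)) *
    inner2 (loc2 A c g (snd z)) (loc2 A c (\<Psi> (fst z)) (snd z)) (loc2 A c (\<Psi> (fst z)) (snd z)) * vol_density A g c (snd z)"
    for c z
  note pf = pou_facts[OF cpt OA g]
  have energy: "energy A g B \<omega> (\<Phi> t) = 1 / 2 * (\<Sum>c\<in>pou_charts A. integral (img_c c) (\<lambda>x. k c (t, x)))"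
    if t: "t \<in> ?I" for t
  proof -
    have "energy A g B \<omega> (\<Phi> t) = 1 / 2 * volume_integral A g (\<lambda>p. inner_form2 (g p) (\<Psi> t p) (\<Psi> t p))"
      by (simp add: energy_def volume_integral_def \<Psi>_def)
    also have "volume_integral A g (\<lambda>p. inner_form2 (g p) (\<Psi> t p) (\<Psi> t p)) =
        (\<Sum>c\<in>pou_charts A. integral (img_c c) (\<lambda>x. k c (t, x)))"
      unfolding volume_integral_eq[OF cpt OA g]
    proof (rule sum.cong[OF refl], rule Henstock_Kurzweil_Integration.integral_cong)
      fix c x assume c: "c \<in> pou_charts A" and x: "x \<in> img_c c"
      have cA: "c \<in> A" using c pf(2) by blast
      have bil: "bilinear (\<Psi> t p)" for p using f2[OF t] by (simp add: form2_def smooth_bilinear_field_def)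
      have "inner_form2 (g (inv_c c x)) (\<Psi> t (inv_c c x)) (\<Psi> t (inv_c c x)) =
          inner2 (loc2 A c g x) (loc2 A c (\<Psi> t) x) (loc2 A c (\<Psi> t) x)"
        by (rule inner_form2_in_chart[OF SA g cA x bil bil])
      then show "pou_weight A c (inv_c c x) * inner_form2 (g (inv_c c x)) (\<Psi> t (inv_c c x)) (\<Psi> t (inv_c c x)) * vol_density A g c x
        = k c (t, x)"
        by (simp add: k_def)
    qed
    finally show ?thesis .
  qed
  have der: "((\<lambda>t. integral (img_c c) (\<lambda>x. k c (t, x))) has_field_derivative
      2 * integral (img_c c) (\<lambda>x. pou_weight A c (inv_c c x) *
        ext_d1_pairing A g (\<Psi> 0) (var_form A B \<omega> \<Phi>) (inv_c c x) * vol_density A g c x)) (at 0)"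
    if c: "c \<in> pou_charts A" for c
  proof -
    have cA: "c \<in> A" using c pf(2) by blast
    note G = riemannian_metric_on[OF SA g cA]
    note oc = metric_on_facts(1)[OF G]
    have o: "open (?I \<times> img_c c)" using oc by (intro open_Times) auto
    have snd_smooth: "smooth_on (?I \<times> img_c c) (\<lambda>z. f (snd z))" if "smooth_on (img_c c) f" for f :: "real^'d \<Rightarrow> real"
      by (rule smooth_on_compose[OF o oc _ smooth_on_bounded_linear_id[OF bounded_linear_snd o] that]) auto
    have \<Psi>s: "smooth_on (?I \<times> img_c c) (\<lambda>z. loc2 A c (\<Psi> (fst z)) (snd z) u v)" for u v
      unfolding \<Psi>_def by (rule V(3)[OF cA])
    have "smooth_on (?I \<times> img_c c) (\<lambda>z. inner2 (loc2 A c g (snd z)) (loc2 A c (\<Psi> (fst z)) (snd z)) (loc2 A c (\<Psi> (fst z)) (snd z)))"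
      unfolding inner2_def metric_trace_def
      by (intro smooth_on_mult[OF o] smooth_on_sum[OF o] smooth_on_const snd_smooth[OF smooth_inverse_entry[OF G]] \<Psi>s)
    then have ks: "smooth_on (?I \<times> img_c c) (k c)"
      unfolding k_def[abs_def]
      by (intro smooth_on_mult[OF o] snd_smooth[OF vol_density_facts(1)[OF cpt OA g cA]]
          snd_smooth[OF smooth_fun_D[OF SA pf(3)[OF c] cA]])
    note ch = chart_compact[OF cpt OA g cA pf(6) pf(5)[OF c]]
    have kz: "k c (t, x) = 0" if "x \<in> img_c c - snd c ` pou_support A c" for t x
      using pf(8)[OF ch(3)[OF that]] by (simp add: k_def)
    have kd: "FD (k c) (0, x) (1, 0) = 2 * (pou_weight A c (inv_c c x) *
        ext_d1_pairing A g (\<Psi> 0) (var_form A B \<omega> \<Phi>) (inv_c c x) * vol_density A g c x)" if x: "x \<in> img_c c" for x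
    proof -
      note P = metric_on_facts(2)[OF G x]
      define f where "f = some_frame (loc2 A c g x)"
      have f: "orthonormal_frame (loc2 A c g x) f" unfolding f_def by (rule orthonormal_some_frame[OF P])
      define a where "a t i j = loc2 A c (\<Psi> t) x (f i) (f j)" for t i j
      define b where "b i j = ext_d1_eucl (loc1 A c (var_form A B \<omega> \<Phi>)) x (f i) (f j)" for i j
      \<comment> \<open>The frame at \<open>x\<close> is the same for all times, which reduces the
        derivative of the squared norm to that of the components.\<close>
      have da: "((\<lambda>t. a t i j) has_field_derivative b i j) (at 0)" for i j
        unfolding a_def b_def \<Psi>_def by (rule V(4)[OF cA x])
      define r where "r = pou_weight A c (inv_c c x) * vol_density A g c x"
      have D: "((\<lambda>t. r * (1 / 2 * (\<Sum>i\<in>UNIV. \<Sum>j\<in>UNIV. a t i j * a t i j))) has_field_derivative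
          r * (1 / 2 * (\<Sum>i\<in>UNIV. \<Sum>j\<in>UNIV. b i j * a 0 i j + b i j * a 0 i j))) (at 0)"
        by (intro DERIV_cmult DERIV_sum DERIV_mult da)
      have ke: "r * (1 / 2 * (\<Sum>i\<in>UNIV. \<Sum>j\<in>UNIV. a t i j * a t i j)) = k c (t, x)" if t: "t \<in> ?I" for t
      proof -
        note bl = form2_facts(1)[OF SA f2[OF t] cA x]
        show ?thesis
          unfolding k_def fst_conv snd_conv inner_form2_frame[OF P f bl bl] by (simp add: a_def r_def mult_ac)
      qed
      have val: "r * (1 / 2 * (\<Sum>i\<in>UNIV. \<Sum>j\<in>UNIV. b i j * a 0 i j + b i j * a 0 i j)) =
          2 * (pou_weight A c (inv_c c x) *
            ext_d1_pairing A g (\<Psi> 0) (var_form A B \<omega> \<Phi>) (inv_c c x) * vol_density A g c x)"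
      proof -
        have "ext_d1_pairing A g (\<Psi> 0) (var_form A B \<omega> \<Phi>) (inv_c c x) =
            1 / 2 * (\<Sum>i\<in>UNIV. \<Sum>j\<in>UNIV. a 0 i j * b i j)"
          unfolding pairings_in_chart(1)[OF cpt OA g f2[OF in0] f1 cA x] a_def b_def
          by (rule inner_form2_frame[OF P f form2_facts(1)[OF SA f2[OF in0] cA x]
              bilinear_ext_d1_eucl[OF oc x form1_facts[OF SA f1 cA]]])
        then have p: "(\<Sum>i\<in>UNIV. \<Sum>j\<in>UNIV. a 0 i j * b i j) =
            2 * ext_d1_pairing A g (\<Psi> 0) (var_form A B \<omega> \<Phi>) (inv_c c x)" by simp
        have "(\<Sum>i\<in>UNIV. \<Sum>j\<in>UNIV. b i j * a 0 i j + b i j * a 0 i j) = 2 * (\<Sum>i\<in>UNIV. \<Sum>j\<in>UNIV. a 0 i j * b i j)"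
          unfolding sum_distrib_left by (intro sum.cong refl) (simp add: mult.commute)
        then show ?thesis unfolding p by (simp add: r_def)
      qed
      have "((\<lambda>t. k c (t, x)) has_field_derivative 2 * (pou_weight A c (inv_c c x) *
            ext_d1_pairing A g (\<Psi> 0) (var_form A B \<omega> \<Phi>) (inv_c c x) * vol_density A g c x)) (at 0)"
        by (rule has_field_derivative_transform_within_open[OF D[unfolded val] _ in0 ke]) simp_all
      moreover have "k c differentiable (at (0, x))"
        by (rule smooth_on_differentiable[OF ks]) (use in0 x in auto)
      from FD_slice_left[OF this] have "((\<lambda>t. k c (t, x)) has_derivative (\<lambda>s. FD (k c) (0, x) (s, 0))) (at 0)" .
      ultimately have "(\<lambda>s. FD (k c) (0, x) (s, 0)) = (*) (2 * (pou_weight A c (inv_c c x) *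
            ext_d1_pairing A g (\<Psi> 0) (var_form A B \<omega> \<Phi>) (inv_c c x) * vol_density A g c x))"
        unfolding has_field_derivative_def by (metis has_derivative_unique)
      from fun_cong[OF this, of 1] show ?thesis by simp
    qed
    have "((\<lambda>t. integral (img_c c) (\<lambda>x. k c (t, x))) has_field_derivative
        integral (img_c c) (\<lambda>x. FD (k c) (0, x) (1, 0))) (at 0)"
      by (rule derivative_of_compactly_supported_integral[OF e oc ch(1,2) ks kz])
    also have "integral (img_c c) (\<lambda>x. FD (k c) (0, x) (1, 0)) =
      integral (img_c c) (\<lambda>x. 2 * (pou_weight A c (inv_c c x) *
        ext_d1_pairing A g (\<Psi> 0) (var_form A B \<omega> \<Phi>) (inv_c c x) * vol_density A g c x))"
      by (rule Henstock_Kurzweil_Integration.integral_cong) (rule kd)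
    finally show ?thesis by simp
  qed
  have "((\<lambda>t. 1 / 2 * (\<Sum>c\<in>pou_charts A. integral (img_c c) (\<lambda>x. k c (t, x)))) has_field_derivative
      1 / 2 * (\<Sum>c\<in>pou_charts A. 2 * integral (img_c c) (\<lambda>x. pou_weight A c (inv_c c x) *
        ext_d1_pairing A g (\<Psi> 0) (var_form A B \<omega> \<Phi>) (inv_c c x) * vol_density A g c x))) (at 0)"
    by (intro DERIV_cmult DERIV_sum der)
  also have "1 / 2 * (\<Sum>c\<in>pou_charts A. 2 * integral (img_c c) (\<lambda>x. pou_weight A c (inv_c c x) *
        ext_d1_pairing A g (\<Psi> 0) (var_form A B \<omega> \<Phi>) (inv_c c x) * vol_density A g c x)) =
      volume_integral A g (ext_d1_pairing A g (\<Psi> 0) (var_form A B \<omega> \<Phi>))"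
    unfolding volume_integral_eq[OF cpt OA g] by (simp add: sum_distrib_left[symmetric])
  also have "\<dots> = volume_integral A g (codiff_pairing A g (\<Psi> 0) (var_form A B \<omega> \<Phi>))"
    by (rule stokes_codifferential[OF cpt OA g f2[OF in0] f1])
  finally have "((\<lambda>t. 1 / 2 * (\<Sum>c\<in>pou_charts A. integral (img_c c) (\<lambda>x. k c (t, x)))) has_field_derivative
      volume_integral A g (codiff_pairing A g (\<Psi> 0) (var_form A B \<omega> \<Phi>))) (at 0)" .
  then have "((\<lambda>t. energy A g B \<omega> (\<Phi> t)) has_field_derivative
      volume_integral A g (codiff_pairing A g (\<Psi> 0) (var_form A B \<omega> \<Phi>))) (at 0)"
    by (rule has_field_derivative_transform_within_open[of _ _ _ ?I]) (use in0 energy in auto)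
  then show "((\<lambda>t. energy A g B \<omega> (\<Phi> t)) has_real_derivative
      volume_integral A g (codiff_pairing A g (pullback2 A B \<phi> \<omega>) (var_form A B \<omega> \<Phi>))) (at 0)"
    by (simp add: \<Psi>_def \<Phi>0)
qed

section \<open>Variations supported in a chart\<close>

lemma continuous_in_chart:
  assumes c: "is_chart c" and f: "continuous_on (img_c c) (\<lambda>x. f (inv_c c x))"
  shows "continuous_on (dom_c c) f"
proof -
  note cc = is_chart_facts[OF c]
  have "continuous_on (dom_c c) (\<lambda>q. f (inv_c c (snd c q)))"
    by (rule continuous_on_compose2[OF f cc(6)]) auto
  then show ?thesis by (rule continuous_on_eq) (simp add: cc(3))
qed

lemma chart_continuous_imp_continuous:
  assumes A: "smooth_atlas A" and f: "chart_continuous A f"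
  shows "continuous_on UNIV f"
proof -
  have "continuous_on (\<Union>c\<in>A. dom_c c) f"
  proof (rule continuous_on_open_UN)
    fix c assume "c \<in> A"
    note ic = atlas_facts(1)[OF A this]
    show "open (dom_c c)" by (rule is_chart_facts(1)[OF ic])
    show "continuous_on (dom_c c) f"
      by (rule continuous_in_chart[OF ic]) (use f \<open>c \<in> A\<close> in \<open>auto simp: chart_continuous_def\<close>)
  qed
  then show ?thesis using A by (simp add: smooth_atlas_def)
qed

text \<open>In the chart \<open>d\<close> the map moves along straight segments in the direction
  \<open>w\<close>, damped by \<eta>. The compact image of \<open>K\<close> has a positive distance
  from the edge of the chart, so small times stay inside; off \<open>K\<close> nothing moves, and
  the pieces glue.\<close>

lemma coordinate_variation:
  fixes A :: "('m::t2_space, 'd::finite) chart set" and B :: "('n::t2_space, 'k::finite) chart set"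
  assumes SA: "smooth_atlas A" and SB: "smooth_atlas B" and \<phi>: "smooth_map A B \<phi>" and d: "d \<in> B"
    and \<eta>: "smooth_fun A \<eta>" and K: "compact K" "K \<subseteq> \<phi> -` dom_c d"
    and \<eta>01: "\<And>q. 0 \<le> \<eta> q" "\<And>q. \<eta> q \<le> 1" and off: "\<And>q. q \<notin> K \<Longrightarrow> \<eta> q = 0"
  obtains \<Phi> where "smooth_variation A B \<phi> \<Phi>"
    "\<And>p. \<phi> p \<in> dom_c d \<Longrightarrow> var_field B \<Phi> p = \<eta> p *\<^sub>R from_coord B d (\<phi> p) w"
    "\<And>p. \<phi> p \<notin> dom_c d \<Longrightarrow> var_field B \<Phi> p = 0"
proof -
  note dd = is_chart_facts[OF atlas_facts(1)[OF SB d]]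
  have \<phi>c: "continuous_on UNIV \<phi>" using \<phi> by (simp add: smooth_map_def)
  define U where "U = \<phi> -` dom_c d"
  have U: "open U" unfolding U_def by (rule open_vimage[OF dd(1) \<phi>c])
  have Kc: "open (- K)" using compact_imp_closed[OF K(1)] by (rule open_Compl)
  define s where "s z = snd d (\<phi> (snd z)) + (fst z * \<eta> (snd z)) *\<^sub>R w" for z
  define \<Phi> where "\<Phi> t q = (if q \<in> U then inv_c d (s (t, q)) else \<phi> q)" for t q
  have "compact (snd d ` \<phi> ` K)"
    by (intro compact_continuous_image K continuous_on_subset[OF \<phi>c] continuous_on_subset[OF dd(6)]) (use K(2) in auto)
  moreover have "snd d ` \<phi> ` K \<subseteq> img_c d" using K(2) by auto
  ultimately obtain \<delta> where \<delta>: "\<delta> > 0" "(\<Union>y\<in>snd d ` \<phi> ` K. ball y \<delta>) \<subseteq> img_c d"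
    using compact_subset_open_imp_ball_epsilon_subset[OF _ dd(2)] by blast
  \<comment> \<open>Displacements of length at most \<open>|t| norm w\<close> then stay below
    \<delta>; the summand 1 covers \<open>w = 0\<close>.\<close>
  define \<epsilon> where "\<epsilon> = \<delta> / (norm w + 1)"
  let ?I = "{-\<epsilon><..<\<epsilon>}"
  have n: "norm w + 1 > 0" using norm_ge_zero[of w] by linarith
  have e: "\<epsilon> > 0" using \<delta>(1) n by (simp add: \<epsilon>_def)
  have s_img: "s (t, q) \<in> img_c d" if t: "t \<in> ?I" and q: "q \<in> U" for t q
  proof (cases "q \<in> K")
    case False
    then show ?thesis using q off by (simp add: s_def U_def)
  next
    case True
    have "norm ((t * \<eta> q) *\<^sub>R w) \<le> \<bar>t\<bar> * norm w"
      using \<eta>01[of q] by (simp add: abs_mult mult_right_mono mult_left_le)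
    also have "\<dots> \<le> \<bar>t\<bar> * (norm w + 1)" by (intro mult_left_mono) auto
    also have "\<dots> < \<epsilon> * (norm w + 1)" using t n by (intro mult_strict_right_mono) auto
    also have "\<dots> = \<delta>" using n by (simp add: \<epsilon>_def)
    finally have "s (t, q) \<in> ball (snd d (\<phi> q)) \<delta>" by (simp add: s_def dist_norm)
    then show ?thesis using \<delta>(2) True by blast
  qed
  have \<Phi>off: "\<Phi> t q = \<phi> q" if "q \<notin> K" for t q
    using that off dd(3) by (simp add: \<Phi>_def s_def U_def)
  have \<Phi>0: "\<Phi> 0 q = \<phi> q" for q using dd(3) by (simp add: \<Phi>_def s_def U_def)
  have "chart_continuous A \<eta>"
    using smooth_on_imp_continuous_on[OF smooth_fun_D[OF SA \<eta>]] by (simp add: chart_continuous_def)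
  note \<eta>c = chart_continuous_imp_continuous[OF SA this]

  have cont: "continuous_on (?I \<times> UNIV) (\<lambda>(t, p). \<Phi> t p)"
  proof -
    have sc: "continuous_on (?I \<times> U) s"
      unfolding s_def
      by (intro continuous_on_add continuous_on_scaleR continuous_on_mult continuous_on_const
          continuous_on_fst[OF continuous_on_id] continuous_on_compose2[OF \<eta>c continuous_on_snd[OF continuous_on_id]]
          continuous_on_compose2[OF dd(6) continuous_on_compose2[OF \<phi>c continuous_on_snd[OF continuous_on_id]]])
        (auto simp: U_def)
    have "continuous_on (?I \<times> U) (\<lambda>z. inv_c d (s z))"
      by (rule continuous_on_compose2[OF dd(7) sc]) (use s_img in auto)
    then have 1: "continuous_on (?I \<times> U) (\<lambda>(t, p). \<Phi> t p)" by (rule continuous_on_eq) (auto simp: \<Phi>_def)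
    have "continuous_on (?I \<times> (- K)) (\<lambda>z. \<phi> (snd z))"
      by (rule continuous_on_compose2[OF \<phi>c continuous_on_snd[OF continuous_on_id]]) auto
    then have 2: "continuous_on (?I \<times> (- K)) (\<lambda>(t, p). \<Phi> t p)" by (rule continuous_on_eq) (auto simp: \<Phi>off)
    have "continuous_on (?I \<times> U \<union> ?I \<times> (- K)) (\<lambda>(t, p). \<Phi> t p)"
      by (rule continuous_on_open_Un[OF _ _ 1 2]) (intro open_Times U Kc open_greaterThanLessThan)+
    moreover have "?I \<times> UNIV = ?I \<times> U \<union> ?I \<times> (- K)" using K(2) by (auto simp: U_def)
    ultimately show ?thesis by simp
  qed

  have smooth: "smooth_on {(t, x). t \<in> ?I \<and> x \<in> img_c c \<and> \<Phi> t (inv_c c x) \<in> dom_c d'}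
      (\<lambda>(t, x). snd d' (\<Phi> t (inv_c c x)))" if c: "c \<in> A" and d': "d' \<in> B" for c d'
  proof (rule smooth_on_local)
    note cc = is_chart_facts[OF atlas_facts(1)[OF SA c]]
    note td = transition_facts[OF atlas_facts(1)[OF SB d] atlas_facts(1)[OF SB d'] atlas_facts(4)[OF SB d d']]
    fix z assume "z \<in> {(t, x). t \<in> ?I \<and> x \<in> img_c c \<and> \<Phi> t (inv_c c x) \<in> dom_c d'}"
    then obtain t x where z: "z = (t, x)" "t \<in> ?I" "x \<in> img_c c" "\<Phi> t (inv_c c x) \<in> dom_c d'" by auto
    let ?F = "\<lambda>(t, x). snd d' (\<Phi> t (inv_c c x))"
    show "\<exists>T g. open T \<and> z \<in> T \<and> (\<forall>y\<in>T. ?F y = g y) \<and> smooth_on T g"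
    \<comment> \<open>Over \<open>U\<close> the variation is given by the segments in
      \<open>d\<close>; at other points it is locally independent of time, because they have
      neighbourhoods that miss \<open>K\<close>. The two regions cover the manifold.\<close>
    proof (cases "inv_c c x \<in> U")
      case True
      note m = map_in_charts[OF SA SB \<phi> c d, folded U_def]
      let ?W = "snd c ` (dom_c c \<inter> U)"
      let ?S = "?I \<times> ?W"
      let ?s = "\<lambda>y. s (fst y, inv_c c (snd y))"
      have So: "open ?S" by (intro open_Times m(1) open_greaterThanLessThan)
      have zS: "z \<in> ?S" using z True m(5)[of x] by (auto simp: U_def)
      have inU: "inv_c c (snd y) \<in> U" if "y \<in> ?S" for y using that m(5)[of "snd y"] by (auto simp: U_def)
      have sn: "smooth_on ?S snd" and fs: "smooth_on ?S fst"
        using smooth_on_bounded_linear[OF bounded_linear_snd So smooth_on_id]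
          smooth_on_bounded_linear[OF bounded_linear_fst So smooth_on_id] by simp_all
      have 1: "smooth_on ?S (\<lambda>y. (snd d \<circ> \<phi> \<circ> inv_c c) (snd y))"
        by (rule smooth_on_compose[OF So m(1) _ sn m(2)]) auto
      have 2: "smooth_on ?S (\<lambda>y. \<eta> (inv_c c (snd y)))"
        by (rule smooth_on_compose[OF So cc(2) _ sn smooth_fun_D[OF SA \<eta> c]]) auto
      have ss: "smooth_on ?S ?s"
        using smooth_on_add[OF So 1 smooth_on_scaleR[OF So smooth_on_mult[OF So fs 2] smooth_on_const]]
        by (simp add: s_def o_def)
      define T where "T = ?S \<inter> ?s -` overlap d d'"
      have T: "open T" unfolding T_def
        by (rule continuous_open_preimage[OF smooth_on_imp_continuous_on[OF ss] So td(1)])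
      have "inv_c d (s (t, inv_c c x)) \<in> dom_c d'" using z(4) True by (simp add: \<Phi>_def)
      then have "s (t, inv_c c x) \<in> overlap d d'" using td(8) s_img[OF z(2) True] by blast
      then have zT: "z \<in> T" using zS z(1) by (simp add: T_def)
      have st: "smooth_on T (\<lambda>y. transition d d' (?s y))"
        by (rule smooth_on_compose[OF T td(1) _ smooth_on_subset[OF ss] td(2)]) (auto simp: T_def)
      have eq: "?F y = transition d d' (?s y)" if "y \<in> T" for y
        using that inU[of y] by (simp add: T_def \<Phi>_def transition_def case_prod_beta)
      show ?thesis by (rule exI[of _ T], rule exI[of _ "\<lambda>y. transition d d' (?s y)"]) (intro conjI ballI T zT st eq)
    next
      case False
      then have nK: "inv_c c x \<notin> K" using K(2) by (auto simp: U_def)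
      note m = map_in_charts[OF SA SB \<phi> c d']
      let ?f = "snd d' \<circ> \<phi> \<circ> inv_c c"
      let ?W = "snd c ` (dom_c c \<inter> \<phi> -` dom_c d') \<inter> snd c ` (dom_c c \<inter> (- K))"
      let ?T = "?I \<times> ?W"
      have T: "open ?T" by (intro open_Times open_Int m(1) cc(8) Kc open_greaterThanLessThan)
      have sn: "smooth_on ?T snd"
        using smooth_on_bounded_linear[OF bounded_linear_snd T smooth_on_id] by simp
      have st: "smooth_on ?T (\<lambda>y. ?f (snd y))"
        by (rule smooth_on_compose[OF T m(1) _ sn m(2)]) auto
      have "x \<in> snd c ` (dom_c c \<inter> \<phi> -` dom_c d')" using m(5)[of x] z(3,4) nK \<Phi>off by simp
      moreover have "x \<in> snd c ` (dom_c c \<inter> (- K))"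
        using nK cc(4,5)[OF z(3)] by (intro image_eqI[of _ _ "inv_c c x"]) auto
      ultimately have zT: "z \<in> ?T" using z by simp
      have eq: "?F y = ?f (snd y)" if "y \<in> ?T" for y
        using that cc(3) by (auto simp: \<Phi>off)
      show ?thesis by (rule exI[of _ ?T], rule exI[of _ "\<lambda>y. ?f (snd y)"]) (intro conjI ballI T zT st eq)
    qed
  qed

  show thesis
  proof (rule that[of \<Phi>])
    show "smooth_variation A B \<phi> \<Phi>"
      unfolding smooth_variation_def using \<Phi>0 e cont smooth by (intro conjI exI[of _ \<epsilon>] ballI) auto
  next
    fix p assume p: "\<phi> p \<in> dom_c d"
    define d' where "d' = chart_at B (\<phi> p)"
    have d': "d' \<in> B" "\<phi> p \<in> dom_c d'" using atlas_facts(5,6)[OF SB] by (auto simp: d'_def)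
    note td = transition_facts[OF atlas_facts(1)[OF SB d] atlas_facts(1)[OF SB d'(1)] atlas_facts(4)[OF SB d d'(1)]]
    have sd: "((\<lambda>t. s (t, p)) has_derivative (\<lambda>t. (t * \<eta> p) *\<^sub>R w)) (at t)" for t
      unfolding s_def by (auto intro!: derivative_eq_intros)
    have "continuous_on UNIV (\<lambda>t. s (t, p))"
      using has_derivative_continuous[OF sd] by (simp add: continuous_on_eq_continuous_at)
    define V where "V = (\<lambda>t. s (t, p)) -` overlap d d'"
    have V: "open V" unfolding V_def by (rule open_vimage[OF td(1)]) fact
    have s0: "s (0, p) = snd d (\<phi> p)" by (simp add: s_def)
    have V0: "0 \<in> V" using p d'(2) by (auto simp: V_def s0)
    have eq: "snd d' (\<Phi> t p) = transition d d' (s (t, p))" for t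
      using p by (simp add: \<Phi>_def U_def transition_def)
    have "FD (\<lambda>t. snd d' (\<Phi> t p)) 0 1 = FD (transition d d') (s (0, p)) (FD (\<lambda>t. s (t, p)) 0 1)"
      by (rule FD_local_compose[OF V V0 eq differentiableI[OF sd] smooth_on_differentiable[OF td(2)]])
        (use V0 in \<open>simp add: V_def\<close>)
    also have "FD (\<lambda>t. s (t, p)) 0 1 = \<eta> p *\<^sub>R w" using FD_eq[OF sd] by simp
    finally have "var_field B \<Phi> p = from_coord B d (\<phi> p) (\<eta> p *\<^sub>R w)"
      by (simp add: var_field_def \<Phi>0 d'_def from_coord_def s0)
    also have "\<dots> = \<eta> p *\<^sub>R from_coord B d (\<phi> p) w"
      by (rule linear_cmul[OF from_coord_linear[OF SB atlas_facts(2)[OF SB d] p]])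
    finally show "var_field B \<Phi> p = \<eta> p *\<^sub>R from_coord B d (\<phi> p) w" .
  next
    fix p assume "\<phi> p \<notin> dom_c d"
    then have "\<Phi> t p = \<phi> p" for t by (simp add: \<Phi>_def U_def)
    then show "var_field B \<Phi> p = 0" by (simp add: var_field_def)
  qed
qed

section \<open>Critical points and harmonic pullbacks\<close>

context
  fixes A :: "('m::t2_space, 'd::finite) chart set" and g :: "('m, 'd) field2"
    and B :: "('n::t2_space, 'k::finite) chart set" and \<omega> :: "('n, 'k) field2" and \<phi> :: "'m \<Rightarrow> 'n"
  assumes cpt: "compact (UNIV :: 'm set)" and OA: "oriented_atlas A" and g: "riemannian_metric A g"
    and SB: "smooth_atlas B" and w: "form2 B \<omega>" "closed_form2 B \<omega>" and \<phi>: "smooth_map A B \<phi>"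
begin

lemma coclosed_imp_critical:
  assumes "coclosed_form2 A g (pullback2 A B \<phi> \<omega>)"
  shows "critical_point A g B \<omega> \<phi>"
  unfolding critical_point_def
proof (intro conjI allI impI \<phi>)
  fix \<Phi> assume "smooth_variation A B \<phi> \<Phi>"
  note fv = first_variation(2)[OF cpt OA g SB w this]
  have "codiff_pairing A g (pullback2 A B \<phi> \<omega>) \<beta> = (\<lambda>p. 0)" for \<beta>
    using assms by (simp add: codiff_pairing_def coclosed_form2_def fun_eq_iff)
  then show "((\<lambda>t. energy A g B \<omega> (\<Phi> t)) has_real_derivative 0) (at 0)"
    using fv by (simp add: volume_integral_eq[OF cpt OA g])
qed

text \<open>At an immersive point, a nonzero codifferential is the metric dual of some \<open>\<xi>\<close> with
  \<open>d\<phi> \<xi> \<noteq> 0\<close>, and moving \<open>\<phi>\<close> in a direction \<open>Y\<close> with \<open>\<omega>(Y, d\<phi> \<xi>) > 0\<close> changes the energy to first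
  order. The first of the two bump functions below only serves to find a neighbourhood on which the
  integrand for the second one is nonnegative.\<close>

lemma critical_imp_coclosed:
  assumes nd: "\<And>q z. z \<noteq> 0 \<Longrightarrow> \<exists>y. \<omega> q y z > 0"
    and im: "immersive_on_dense_set A B \<phi>" and crit: "critical_point A g B \<omega> \<phi>"
  shows "coclosed_form2 A g (pullback2 A B \<phi> \<omega>)"
proof (rule ccontr)
  note SA = smooth_A[OF cpt OA g]
  define \<alpha> where "\<alpha> = pullback2 A B \<phi> \<omega>"
  define \<delta> where "\<delta> = codiff2 A g \<alpha>"
  have a: "form2 A \<alpha>" unfolding \<alpha>_def by (rule form2_pullback2[OF SA SB \<phi> w(1)])
  have bw: "bilinear (\<omega> q)" for q using w(1) by (simp add: form2_def smooth_bilinear_field_def)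
  assume "\<not> coclosed_form2 A g (pullback2 A B \<phi> \<omega>)"
  then obtain p0 v where p0: "\<delta> p0 v \<noteq> 0" by (auto simp: coclosed_form2_def \<delta>_def \<alpha>_def)
  obtain D where D: "closure D = UNIV" "\<And>p. p \<in> D \<Longrightarrow> immersive_at A B \<phi> p"
    using im by (auto simp: immersive_on_dense_set_def)
  define c where "c = chart_at A p0"
  have c: "c \<in> A" "p0 \<in> dom_c c" using atlas_facts(5,6)[OF SA] by (auto simp: c_def)
  note cc = is_chart_facts[OF atlas_facts(1)[OF SA c(1)]]
  have "continuous_on (img_c c) (\<lambda>x. \<delta> (inv_c c x) (from_coord A c (inv_c c x) v))"
    using smooth_on_imp_continuous_on[OF smooth_codiff[OF SA g a c(1), of v]] by (simp add: loc1_def \<delta>_def)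
  then have "continuous_on (dom_c c) (\<lambda>q. \<delta> q (from_coord A c q v))"
    by (rule continuous_in_chart[OF atlas_facts(1)[OF SA c(1)]])
  then have "open (dom_c c \<inter> (\<lambda>q. \<delta> q (from_coord A c q v)) -` (- {0}))"
    by (rule continuous_open_preimage[OF _ cc(1)]) (simp add: open_Compl)
  moreover have "p0 \<in> dom_c c \<inter> (\<lambda>q. \<delta> q (from_coord A c q v)) -` (- {0})"
    using c(2) p0 from_coord_chart_at[OF SA, of p0 v] by (simp add: c_def)
  \<comment> \<open>The codifferential is nonzero on an open set around \<open>p0\<close>, which
    meets the dense set of immersive points.\<close>
  ultimately obtain p where p: "p \<in> D" "p \<in> dom_c c" "\<delta> p (from_coord A c p v) \<noteq> 0"
    using D(1) open_Int_closure_eq_empty[of _ D] by blast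
  have ld: "linear (\<delta> q)" for q unfolding \<delta>_def by (rule linear_codiff[OF SA g a])
  note P = riemannian_pos_inner[OF SA g]
  note fr = orthonormal_some_frame[OF P]
  let ?e = "\<lambda>q. some_frame (g q)"
  define \<xi> where "\<xi> = sharp (g p) (\<delta> p)"
  have "g p \<xi> u = \<delta> p u" for u unfolding \<xi>_def by (rule sharp_inner[OF P fr ld])
  then have "\<xi> \<noteq> 0" using p(3) P[of p] bilinear_lzero[of "g p"] by (auto simp: pos_inner_def)
  note dl = linear_differential[OF SA SB \<phi>]
  define Z where "Z = differential A B \<phi> p \<xi>"
  have "Z \<noteq> 0"
    using D(2)[OF p(1)] \<open>\<xi> \<noteq> 0\<close> linear_0[OF dl] by (metis Z_def immersive_at_def injD)
  then obtain Y where Y: "\<omega> (\<phi> p) Y Z > 0" using nd by blast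
  define d where "d = chart_at B (\<phi> p)"
  have d: "d \<in> B" "\<phi> p \<in> dom_c d" using atlas_facts(5,6)[OF SB] by (auto simp: d_def)
  \<comment> \<open>The pairing of the codifferential with the 1-form of a variation whose field has
    constant components \<open>Y\<close> in \<open>d\<close>, before damping. At \<open>p\<close>,
    where \<open>d\<close> is the preferred chart, it equals \<open>\<omega>(Y, Z)\<close>.\<close>
  define Q where "Q q = (\<Sum>i\<in>UNIV. \<delta> q (?e q i) * \<omega> (\<phi> q) (from_coord B d (\<phi> q) Y) (differential A B \<phi> q (?e q i)))" for q
  have "Z = (\<Sum>i\<in>UNIV. \<delta> p (?e p i) *\<^sub>R differential A B \<phi> p (?e p i))"
    unfolding Z_def \<xi>_def sharp_frame[OF P fr ld] by (simp add: linear_sum[OF dl] linear_cmul[OF dl])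
  then have "Q p = \<omega> (\<phi> p) Y Z"
    using from_coord_chart_at[OF SB, of "\<phi> p" Y]
    by (simp add: Q_def d_def bilinear_sum_right[OF bw] bilinear_rmul[OF bw])
  with Y have Qp: "Q p > 0" by simp
  have dU: "open (\<phi> -` dom_c d)"
    using \<phi> is_chart_facts(1)[OF atlas_facts(1)[OF SB d(1)]] by (simp add: smooth_map_def open_vimage)
  \<comment> \<open>Every cutoff \<eta> supported over the chart \<open>d\<close> comes from a
    variation, so criticality makes the integral of \<open>\<eta> Q\<close> vanish.\<close>
  have vary: "\<exists>\<beta>. form1 A \<beta> \<and> volume_integral A g (codiff_pairing A g \<alpha> \<beta>) = 0 \<and>
      (\<forall>q. codiff_pairing A g \<alpha> \<beta> q = \<eta> q * Q q)"
    if \<eta>: "smooth_fun A \<eta>" "compact K" "K \<subseteq> \<phi> -` dom_c d" "\<And>q. 0 \<le> \<eta> q" "\<And>q. \<eta> q \<le> 1"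
      "\<And>q. q \<notin> K \<Longrightarrow> \<eta> q = 0" for \<eta> K
  proof -
    obtain \<Phi> where \<Phi>: "smooth_variation A B \<phi> \<Phi>"
      "\<And>p. \<phi> p \<in> dom_c d \<Longrightarrow> var_field B \<Phi> p = \<eta> p *\<^sub>R from_coord B d (\<phi> p) Y"
      "\<And>p. \<phi> p \<notin> dom_c d \<Longrightarrow> var_field B \<Phi> p = 0"
      using coordinate_variation[OF SA SB \<phi> d(1) \<eta>] by blast
    note fv = first_variation[OF cpt OA g SB w \<Phi>(1), folded \<alpha>_def]
    have "((\<lambda>t. energy A g B \<omega> (\<Phi> t)) has_real_derivative 0) (at 0)"
      using crit \<Phi>(1) by (simp add: critical_point_def)
    with fv(2) have "volume_integral A g (codiff_pairing A g \<alpha> (var_form A B \<omega> \<Phi>)) = 0"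
      by (rule DERIV_unique)
    moreover have "codiff_pairing A g \<alpha> (var_form A B \<omega> \<Phi>) q = \<eta> q * Q q" for q
    proof (cases "\<phi> q \<in> dom_c d")
      case True
      have "\<Phi> 0 = \<phi>" using \<Phi>(1) by (simp add: smooth_variation_def)
      with True show ?thesis
        by (simp add: codiff_pairing_def var_form_def Q_def \<Phi>(2) \<delta>_def bilinear_lmul[OF bw] sum_distrib_left mult_ac)
    next
      case False
      then have "\<eta> q = 0" using \<eta>(3,6) by auto
      then show ?thesis using False by (simp add: codiff_pairing_def var_form_def \<Phi>(3) bilinear_lzero[OF bw])
    qed
    ultimately show ?thesis using fv(1) by blast
  qed
  obtain \<eta> K V where \<eta>: "smooth_fun A \<eta>" "compact K" "K \<subseteq> dom_c c \<inter> \<phi> -` dom_c d" "\<And>q. 0 \<le> \<eta> q"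
    "\<And>q. \<eta> q \<le> 1" "\<And>q. q \<notin> K \<Longrightarrow> \<eta> q = (0::real)" "open V" "p \<in> V" "\<And>q. q \<in> V \<Longrightarrow> \<eta> q > 0"
    using bump_function[OF SA c(1) p(2) _ dU] d(2) by blast
  obtain \<beta> where \<beta>: "form1 A \<beta>" "\<And>q. codiff_pairing A g \<alpha> \<beta> q = \<eta> q * Q q"
    using vary[OF \<eta>(1,2) _ \<eta>(4,5,6)] \<eta>(3) by blast
  \<comment> \<open>\<open>Q\<close> is built from frames chosen pointwise, so its continuity is not
    at hand. The pairing with a smooth form is continuous, which makes this set open, and
    \<open>Q\<close> is positive on it.\<close>
  define O' where "O' = {q. codiff_pairing A g \<alpha> \<beta> q > 0}"
  have "continuous_on UNIV (codiff_pairing A g \<alpha> \<beta>)"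
    by (rule chart_continuous_imp_continuous[OF SA chart_continuous_pairings(2)[OF cpt OA g a \<beta>(1)]])
  then have O': "open O'" unfolding O'_def by (intro open_Collect_less continuous_on_const)
  have pO: "p \<in> O'" using Qp \<eta>(8,9) by (simp add: O'_def \<beta>(2))
  have Qpos: "Q q > 0" if "q \<in> O'" for q
    using that \<eta>(4)[of q] by (auto simp: O'_def \<beta>(2) zero_less_mult_iff)
  obtain \<eta>' K' V' where \<eta>': "smooth_fun A \<eta>'" "compact K'" "K' \<subseteq> dom_c c \<inter> (\<phi> -` dom_c d \<inter> O')" "\<And>q. 0 \<le> \<eta>' q"
    "\<And>q. \<eta>' q \<le> 1" "\<And>q. q \<notin> K' \<Longrightarrow> \<eta>' q = (0::real)" "open V'" "p \<in> V'" "\<And>q. q \<in> V' \<Longrightarrow> \<eta>' q > 0"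
    using bump_function[OF SA c(1) p(2) _ open_Int[OF dU O']] d(2) pO by blast
  obtain \<beta>' where \<beta>': "form1 A \<beta>'" "volume_integral A g (codiff_pairing A g \<alpha> \<beta>') = 0"
    "\<And>q. codiff_pairing A g \<alpha> \<beta>' q = \<eta>' q * Q q"
    using vary[OF \<eta>'(1,2) _ \<eta>'(4,5,6)] \<eta>'(3) by blast
  have "codiff_pairing A g \<alpha> \<beta>' q \<ge> 0" for q
  proof (cases "q \<in> K'")
    case True
    then have "Q q > 0" using \<eta>'(3) Qpos by blast
    then show ?thesis using \<eta>'(4)[of q] by (simp add: \<beta>'(3))
  qed (simp add: \<beta>'(3) \<eta>'(6))
  from volume_integral_eq_0_imp[OF cpt OA g chart_continuous_pairings(2)[OF cpt OA g a \<beta>'(1)] this \<beta>'(2), of p]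
  show False using Qp \<eta>'(9)[OF \<eta>'(8)] by (simp add: \<beta>'(3))
qed

text \<open>The squared norm is continuous and nonnegative, so its zero integral makes it vanish at
  every point; with it vanish all components in an orthonormal frame, and by bilinearity the
  form.\<close>

lemma exact_coclosed_pullback_vanishes:
  assumes b: "form1 A \<beta>" "pullback2 A B \<phi> \<omega> = ext_d1 A \<beta>"
    and co: "coclosed_form2 A g (pullback2 A B \<phi> \<omega>)"
  shows "pullback2 A B \<phi> \<omega> p u v = 0" and "energy A g B \<omega> \<phi> = 0"
proof -
  note SA = smooth_A[OF cpt OA g]
  define \<alpha> where "\<alpha> = pullback2 A B \<phi> \<omega>"
  have a: "form2 A \<alpha>" unfolding \<alpha>_def by (rule form2_pullback2[OF SA SB \<phi> w(1)])
  have "codiff_pairing A g \<alpha> \<beta> = (\<lambda>p. 0)"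
    using co by (simp add: codiff_pairing_def coclosed_form2_def \<alpha>_def fun_eq_iff)
  then have 0: "volume_integral A g (ext_d1_pairing A g \<alpha> \<beta>) = 0"
    unfolding stokes_codifferential[OF cpt OA g a b(1)] by (simp add: volume_integral_eq[OF cpt OA g])
  have pair: "ext_d1_pairing A g \<alpha> \<beta> = (\<lambda>p. inner_form2 (g p) (\<alpha> p) (\<alpha> p))"
    using b(2) by (simp add: ext_d1_pairing_def[abs_def] \<alpha>_def)
  show "energy A g B \<omega> \<phi> = 0"
    using 0 unfolding pair by (simp add: energy_def volume_integral_def \<alpha>_def)
  let ?e = "some_frame (g p)"
  have "inner_form2 (g q) (\<alpha> q) (\<alpha> q) \<ge> 0" for q
    by (auto simp: inner_form2_def Let_def intro!: sum_nonneg)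
  then have "inner_form2 (g p) (\<alpha> p) (\<alpha> p) = 0"
    using volume_integral_eq_0_imp[OF cpt OA g chart_continuous_pairings(1)[OF cpt OA g a b(1)] _ 0, of p]
    by (simp add: pair)
  then have "(\<Sum>i\<in>UNIV. \<Sum>j\<in>UNIV. \<alpha> p (?e i) (?e j) * \<alpha> p (?e i) (?e j)) = 0"
    by (simp add: inner_form2_def Let_def)
  then have "\<forall>i\<in>UNIV. (\<Sum>j\<in>UNIV. \<alpha> p (?e i) (?e j) * \<alpha> p (?e i) (?e j)) = 0"
    by (subst (asm) sum_nonneg_eq_0_iff) (auto intro!: sum_nonneg)
  then have z: "\<alpha> p (?e i) (?e j) = 0" for i j
    by (auto simp: sum_nonneg_eq_0_iff)
  have bl: "linear (\<alpha> p x)" "linear (\<lambda>x. \<alpha> p x y)" for x y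
    using a by (auto simp: form2_def smooth_bilinear_field_def bilinear_def)
  note P = riemannian_pos_inner[OF SA g, of p]
  note fr = orthonormal_some_frame[OF P]
  have "\<alpha> p (?e i) v = 0" for i using linear_frame_sum[OF P fr bl(1), of "?e i" v] z by simp
  then have "\<alpha> p u v = 0" using linear_frame_sum[OF P fr bl(2), of u v] by simp
  then show "pullback2 A B \<phi> \<omega> p u v = 0" by (simp add: \<alpha>_def)
qed

end

theorem mainTheorem4:
  fixes A :: "('m::t2_space, 'd::finite) chart set"
    and g :: "('m, 'd) field2"
    and B :: "('n::t2_space, 'k::finite) chart set"
    and h :: "('n, 'k) field2"
    and J :: "'n \<Rightarrow> real^'k \<Rightarrow> real^'k"
    and \<omega> :: "('n, 'k) field2"
  assumes "compact (UNIV :: 'm set)"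
    and "oriented_atlas A"
    and "riemannian_metric A g"
    and "compact (UNIV :: 'n set)"
    and "kaehler B h J"
    and "\<omega> = kaehler_form h J"
  shows "(\<forall>\<phi>. smooth_map A B \<phi> \<and> immersive_on_dense_set A B \<phi> \<longrightarrow>
            (critical_point A g B \<omega> \<phi> \<longleftrightarrow> harmonic_form2 A g (pullback2 A B \<phi> \<omega>))) \<and>
         (H2_vanishes A \<longrightarrow>
            (\<forall>\<phi>. immersion A B \<phi> \<and> critical_point A g B \<omega> \<phi> \<longrightarrow>
               isotropic_immersion A B \<omega> \<phi> \<and> energy A g B \<omega> \<phi> = 0))"
proof -
  note M = assms(1-3)
  note SA = smooth_A[OF M]
  have SB: "smooth_atlas B" and h: "riemannian_metric B h" and J: "complex_structure B J"
    and cl: "closed_form2 B \<omega>" using assms(5,6) by (auto simp: kaehler_def)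
  have w: "form2 B \<omega>" unfolding assms(6) by (rule form2_kaehler_form[OF assms(5)])
  have nd: "\<exists>y. \<omega> q y z > 0" if "z \<noteq> 0" for q z
  proof -
    \<comment> \<open>Nondegeneracy of the Kaehler form: \<open>y = - J z\<close> gives
      \<open>\<omega>(y, z) = h(z, z)\<close>.\<close>
    have "J q (- J q z) = z" using J linear_neg[of "J q"] by (simp add: complex_structure_def)
    then have "\<omega> q (- J q z) z = h q z z" by (simp add: assms(6) kaehler_form_def)
    moreover have "h q z z > 0" using h that by (simp add: riemannian_metric_def)
    ultimately have "\<omega> q (- J q z) z > 0" by simp
    then show ?thesis by blast
  qed
  \<comment> \<open>The pullback of the closed form \<omega> is always a closed 2-form, so
    harmonicity amounts to coclosedness.\<close>
  have harm: "critical_point A g B \<omega> \<phi> \<longleftrightarrow> harmonic_form2 A g (pullback2 A B \<phi> \<omega>)"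
    if \<phi>: "smooth_map A B \<phi>" "immersive_on_dense_set A B \<phi>" for \<phi>
    using critical_imp_coclosed[OF M SB w cl \<phi>(1) nd \<phi>(2)] coclosed_imp_critical[OF M SB w cl \<phi>(1)]
      form2_pullback2[OF SA SB \<phi>(1) w] closed_pullback2[OF SA SB \<phi>(1) w cl]
    by (auto simp: harmonic_form2_def)
  have iso: "isotropic_immersion A B \<omega> \<phi> \<and> energy A g B \<omega> \<phi> = 0"
    if H: "H2_vanishes A" and \<phi>: "immersion A B \<phi>" "critical_point A g B \<omega> \<phi>" for \<phi>
  proof -
    have s: "smooth_map A B \<phi>" using \<phi>(1) by (simp add: immersion_def)
    have "immersive_on_dense_set A B \<phi>"
      unfolding immersive_on_dense_set_def using \<phi>(1) by (intro exI[of _ UNIV]) (simp add: immersion_def)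
    with harm[OF s] \<phi>(2) have hf: "harmonic_form2 A g (pullback2 A B \<phi> \<omega>)" by simp
    then obtain \<beta> where b: "form1 A \<beta>" "pullback2 A B \<phi> \<omega> = ext_d1 A \<beta>"
      using H by (auto simp: H2_vanishes_def harmonic_form2_def)
    have co: "coclosed_form2 A g (pullback2 A B \<phi> \<omega>)" using hf by (simp add: harmonic_form2_def)
    show ?thesis
      using exact_coclosed_pullback_vanishes[OF M SB w cl s b co] \<phi>(1) by (simp add: isotropic_immersion_def)
  qed
  show ?thesis using harm iso by blast
qed

end
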